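(* Let $d\in\mathbb{N}$ and let $(\mu_i,\nu_i)_{i\in[d]}$ be irreducible pairs of probability measures on $\mathbb{R}$ (in particular $\mu_i\le_c\nu_i$). Let $c:\mathbb{R}^{d}\times\mathbb{R}^d\to\mathbb{R}$ be lower semicontinuous and such that $$|c(x,y)|\le\sum_{i=1}^d\big(v_i(x_i)+w_i(y_i)\big)\qquad \forall (x,y)\in\mathbb{R}^{2d}$$ for some continuous functions $v_i\in L^1(\mu_i)$, $w_i\in L^1(\nu_i)$, $i\in[d]$. Then there exist functions $\varphi_i,\psi_i:\mathbb{R}\to\mathbb{R}\cup\{-\infty\}$ and $h_i:\mathbb{R}^d\to\mathbb{R}$, $i\in[d]$, such that $$\sum_{i=1}^d\big(\varphi_i(x_i)+\psi_i(y_i)+h_i(x)(y_i-x_i)\big)\le c(x,y)\qquad\forall (x,y)\in\mathbb{R}^{2d},$$ and such that $$\sum_{i=1}^d\big(\varphi_i(x_i)+\psi_i(y_i)+h_i(x)(y_i-x_i)\big)= c(x,y)\qquad\pi\text{-a.s.}$$ for every $\pi$ which solves the problem of minimizing $\mathbb{E}_\pi[c(X,Y)]$ over $\pi\in\mathrm{VMT}(\vec\mu,\vec\nu)$. (No integrability of $\varphi_i,\psi_i$ and no boundedness of $h_i$ is claimed.)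
   Context: $[d]=\{1,\dots,d\}$; $x=(x_1,\dots,x_d)$, $y=(y_1,\dots,y_d)$; $\vec\mu=(\mu_1,\dots,\mu_d)$, $\vec\nu=(\nu_1,\dots,\nu_d)$. All measures have finite first moments. For probability measures $\mu,\nu$ on $\mathbb{R}$ with finite first moments, $\mu\le_c\nu$ (convex order) means $\int f\,d\mu\le\int f\,d\nu$ for every convex $f:\mathbb{R}\to\mathbb{R}$. For a measure $\xi$ on $\mathbb{R}$ its potential function is $u_\xi(x)=\int|x-y|\,d\xi(y)$. A pair $\mu\le_c\nu$ is irreducible if the set $I:=\{x\in\mathbb{R}: u_\mu(x)<u_\nu(x)\}$ is connected and $\mu(I)=\mu(\mathbb{R})$. $\mathrm{VMT}(\vec\mu,\vec\nu)$ (vectorial martingale transports) is the set of Borel probability measures $\pi$ on $\mathbb{R}^{d}\times\mathbb{R}^d$ such that $\pi=\mathrm{Law}(X,Y)$ for $\mathbb{R}^d$-valued random variables $X=(X_1,\dots,X_d)$, $Y=(Y_1,\dots,Y_d)$ with $\mathbb{E}[Y|X]=X$, $X_i\sim\mu_i$ and $Y_i\sim\nu_i$ for all $i\in[d]$. $\mathbb{E}_\pi$ denotes expectation when $(X,Y)\sim\pi$. *)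

theory Defs
  imports "HOL-Probability.Probability"
begin

definition finite_first_moment :: "real measure \<Rightarrow> bool" where
  "finite_first_moment \<mu> \<longleftrightarrow> integrable \<mu> (\<lambda>x. x)"

text \<open>
  The integral of a convex function against a measure with finite first moment lies in
  \<open>(-\<infinity>, \<infinity>]\<close> and may be \<open>\<infinity>\<close>, whereas the Bochner integral of a non-integrable function is \<open>0\<close>.
  Hence the integral in the convex order is taken as (integral of the positive part) minus
  (integral of the negative part); the latter is finite because a convex function has an affine
  minorant.
\<close>

definition extended_integral :: "real measure \<Rightarrow> (real \<Rightarrow> real) \<Rightarrow> ereal" where
  "extended_integral \<mu> f =
     enn2ereal (\<integral>\<^sup>+ x. ennreal (f x) \<partial>\<mu>) - enn2ereal (\<integral>\<^sup>+ x. ennreal (- f x) \<partial>\<mu>)"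

definition convex_order :: "real measure \<Rightarrow> real measure \<Rightarrow> bool" where
  "convex_order \<mu> \<nu> \<longleftrightarrow>
     (\<forall>f. convex_on UNIV f \<longrightarrow> extended_integral \<mu> f \<le> extended_integral \<nu> f)"

definition potential_function :: "real measure \<Rightarrow> real \<Rightarrow> real" where
  "potential_function \<xi> x = (\<integral>y. \<bar>x - y\<bar> \<partial>\<xi>)"

definition potential_gap :: "real measure \<Rightarrow> real measure \<Rightarrow> real set" where
  "potential_gap \<mu> \<nu> = {x. potential_function \<mu> x < potential_function \<nu> x}"

definition irreducible_pair :: "real measure \<Rightarrow> real measure \<Rightarrow> bool" where
  "irreducible_pair \<mu> \<nu> \<longleftrightarrow>
     convex_order \<mu> \<nu> \<and>
     connected (potential_gap \<mu> \<nu>) \<and>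
     measure \<mu> (potential_gap \<mu> \<nu>) = measure \<mu> UNIV"

definition lower_semicontinuous :: "('a::topological_space \<Rightarrow> real) \<Rightarrow> bool" where
  "lower_semicontinuous f \<longleftrightarrow> (\<forall>x a. a < f x \<longrightarrow> (\<forall>\<^sub>F z in nhds x. a < f z))"

text \<open>
  The vectors of length \<open>d\<close> are elements of \<^typ>\<open>real ^ 'd\<close>. A law on pairs of vectors is realised by
  the coordinate maps \<^const>\<open>fst\<close> (for \<open>X\<close>) and \<^const>\<open>snd\<close> (for \<open>Y\<close>) on the product space itself.
  Conditioning on the whole vector \<open>X\<close> is conditioning on the sigma-algebra generated by
  \<^const>\<open>fst\<close>, and the vector identity \<open>E[Y | X] = X\<close> is stated componentwise.
\<close>

definition VMT ::
  "('d \<Rightarrow> real measure) \<Rightarrow> ('d \<Rightarrow> real measure) \<Rightarrow> ((real ^ 'd) \<times> (real ^ 'd)) measure set" where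
  "VMT \<mu> \<nu> = {\<pi>. prob_space \<pi> \<and> sets \<pi> = sets borel \<and>
     (\<forall>i. distr \<pi> borel (\<lambda>z. fst z $ i) = \<mu> i) \<and>
     (\<forall>i. distr \<pi> borel (\<lambda>z. snd z $ i) = \<nu> i) \<and>
     (\<forall>i. AE z in \<pi>.
        real_cond_exp \<pi> (vimage_algebra (space \<pi>) fst borel) (\<lambda>z. snd z $ i) z = fst z $ i)}"

text \<open>
  For measurable \<open>c\<close> the Bochner integral is the genuine expectation as soon as \<open>c\<close> is integrable
  for every \<open>\<pi>\<close> in \<open>VMT \<mu> \<nu>\<close>, in particular under an integrable bound of the form
  \<open>\<bar>c (x, y)\<bar> \<le> (\<Sum>i. v i (x $ i) + w i (y $ i))\<close>.
\<close>

definition VMT_minimizer ::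
  "('d \<Rightarrow> real measure) \<Rightarrow> ('d \<Rightarrow> real measure) \<Rightarrow> ((real ^ 'd) \<times> (real ^ 'd) \<Rightarrow> real) \<Rightarrow>
   ((real ^ 'd) \<times> (real ^ 'd)) measure \<Rightarrow> bool" where
  "VMT_minimizer \<mu> \<nu> c \<pi> \<longleftrightarrow> is_arg_min (\<lambda>\<pi>. \<integral>z. c z \<partial>\<pi>) (\<lambda>\<pi>. \<pi> \<in> VMT \<mu> \<nu>) \<pi>"

end

theory Submission
  imports Defs "HOL-Library.Function_Algebras"
begin

text \<open>
  Strong duality comes from Hahn--Banach: the superhedging value of a function by dual sums is
  sublinear, and a linear functional below it that is extremal at the cost \<open>c\<close> is a finitely
  additive measure with the prescribed marginals. The marginals make it tight and continuous on
  half-spaces, so it induces a Borel measure, which is a martingale transport whose cost is at most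
  the dual value.

  For attainment, subtract the bounding function so that \<open>c \<le> 0\<close>. Minimising the dual inequality over
  each \<open>y\<^sub>i\<close> separately yields convex functions \<open>f\<^sub>i\<close> between \<open>\<phi>\<^sub>i\<close> and \<open>-\<psi>\<^sub>i\<close> (after shifting
  constants), so a near-optimal dual value bounds the three nonnegative quantities
  \<open>\<integral>(f\<^sub>i - \<phi>\<^sub>i) d\<mu>\<^sub>i\<close>, \<open>\<integral>f\<^sub>i d(\<nu>\<^sub>i - \<mu>\<^sub>i)\<close> and \<open>\<integral>(-\<psi>\<^sub>i - f\<^sub>i) d\<nu>\<^sub>i\<close>. Irreducibility turns the middle
  bound into pointwise bounds on \<open>f\<^sub>i\<close>, normalised to vanish at an inner point, on the open interval
  where the potentials differ and at the endpoint atoms of \<open>\<nu>\<^sub>i\<close>. Almost minimising a strictly convex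
  functional of these three functions over near-optimal duals selects a sequence that converges
  almost everywhere, with finite limits by the bounds. The coefficients \<open>h\<^sub>i(x)\<close> stay bounded because
  \<open>\<nu>\<^sub>i\<close> charges both sides of \<open>x\<^sub>i\<close>, and the duality gaps, being summable in \<open>L\<^sup>1(\<pi>)\<close>, vanish in the
  limit for every minimiser \<open>\<pi>\<close>.
\<close>

section \<open>Hahn--Banach\<close>

text \<open>The obstacle is that a near-optimal dual value bounds the integral of \<open>f i\<close>
  against the difference of \<nu> and \<mu>, never against either measure alone. Fatou's lemma thus
  keeps the limits of \<open>f i - \<phi> i\<close> and \<open>- \<psi> i - f i\<close> finite but
  says nothing about \<open>f i\<close>; that gap is filled by pointwise bounds, uniform over all
  near-optimal duals. The strictly convex functional is the integral of \<open>exp (- Z)\<close>: it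
  is bounded without any integrability of \<open>Z\<close>, and its midpoint defect is an exact
  square. Its almost minimisers converge only in the sense of \<open>exp (- Z / 2)\<close>, where a
  limit 0 stands for divergence of \<open>Z\<close> and has to be ruled out afterwards. The shift to
  a nonpositive cost matters because the upper bound 0 is separable: only then does the minimisation
  over y split into coordinates. The coefficients \<open>h\<close> are limits along a subsequence
  chosen for each x on its own, so they come without measurability. Points where \<phi> or \<psi>
  fails to converge get the value minus infinity.\<close>

definition sublinear_on :: "'a::real_vector set \<Rightarrow> ('a \<Rightarrow> real) \<Rightarrow> bool" where
  "sublinear_on E q \<longleftrightarrow>
     (\<forall>x\<in>E. \<forall>y\<in>E. q (x + y) \<le> q x + q y) \<and> (\<forall>x\<in>E. \<forall>t\<ge>0. q (t *\<^sub>R x) = t * q x)"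

lemma sublinear_onD:
  assumes "sublinear_on E q"
  shows "x \<in> E \<Longrightarrow> y \<in> E \<Longrightarrow> q (x + y) \<le> q x + q y"
    and "x \<in> E \<Longrightarrow> t \<ge> 0 \<Longrightarrow> q (t *\<^sub>R x) = t * q x"
  using assms unfolding sublinear_on_def by auto

lemma sublinear_on_zero: "sublinear_on E q \<Longrightarrow> subspace E \<Longrightarrow> q 0 = 0"
  using sublinear_onD(2)[of E q 0 0] subspace_0 by auto

lemma sublinear_on_neg:
  assumes "sublinear_on E q" "subspace E" "x \<in> E"
  shows "- q (- x) \<le> q x"
  using sublinear_onD(1)[OF assms(1), of x "- x"] sublinear_on_zero[OF assms(1,2)] assms(2,3)
  by (simp add: subspace_neg)

text \<open>On \<open>E\<close> this is the largest sublinear functional below \<open>q\<close>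
  whose value at \<open>- f\<close> is at most \<open>- q f\<close>. It is fixed to 0 off
  \<open>E\<close>, so that comparing such functionals on the whole type amounts to comparing them
  on \<open>E\<close>.\<close>

definition lower_towards :: "'a::real_vector set \<Rightarrow> ('a \<Rightarrow> real) \<Rightarrow> 'a \<Rightarrow> 'a \<Rightarrow> real" where
  "lower_towards E q f x = (if x \<in> E then INF t\<in>{0..}. q (x + t *\<^sub>R f) - t * q f else 0)"

context
  fixes E :: "'a::real_vector set" and q :: "'a \<Rightarrow> real" and f :: 'a
  assumes E: "subspace E" and q: "sublinear_on E q" and f: "f \<in> E"
begin

text \<open>Subadditivity applied to \<open>t *\<^sub>R f = (x + t *\<^sub>R f) + (- x)\<close>
  bounds the terms of the infimum from below, so that the infimum is a genuine real number.\<close>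

lemma lower_towards_bound:
  assumes "x \<in> E" "t \<ge> 0"
  shows "- q (- x) \<le> q (x + t *\<^sub>R f) - t * q f"
proof -
  have "q (t *\<^sub>R f) \<le> q (x + t *\<^sub>R f) + q (- x)"
    using sublinear_onD(1)[OF q, of "x + t *\<^sub>R f" "- x"] assms(1) E f
    by (simp add: subspace_neg subspace_add subspace_scale)
  then show ?thesis
    using sublinear_onD(2)[OF q f \<open>t \<ge> 0\<close>] by simp
qed

lemma lower_towards_le:
  assumes "x \<in> E" "t \<ge> 0"
  shows "lower_towards E q f x \<le> q (x + t *\<^sub>R f) - t * q f"
proof -
  have "bdd_below ((\<lambda>t. q (x + t *\<^sub>R f) - t * q f) ` {0..})"
    by (intro bdd_belowI[where m = "- q (- x)"]) (auto simp: lower_towards_bound assms(1))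
  then show ?thesis
    unfolding lower_towards_def using assms by (auto intro!: cINF_lower)
qed

lemma lower_towards_ge:
  assumes "x \<in> E" "\<And>t. t \<ge> 0 \<Longrightarrow> r \<le> q (x + t *\<^sub>R f) - t * q f"
  shows "r \<le> lower_towards E q f x"
  unfolding lower_towards_def using assms by (auto intro!: cINF_greatest)

lemma sublinear_lower_towards: "sublinear_on E (lower_towards E q f)"
  unfolding sublinear_on_def
proof (intro conjI ballI allI impI)
  fix x y assume xy: "x \<in> E" "y \<in> E"
  then have xyE: "x + y \<in> E"
    using E subspace_add by blast
  have "lower_towards E q f (x + y) - (q (y + s *\<^sub>R f) - s * q f) \<le> lower_towards E q f x"
    if s: "s \<ge> 0" for s
  proof (rule lower_towards_ge[OF xy(1)])
    fix t :: real assume t: "t \<ge> 0"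
    have "q ((x + t *\<^sub>R f) + (y + s *\<^sub>R f)) \<le> q (x + t *\<^sub>R f) + q (y + s *\<^sub>R f)"
      by (rule sublinear_onD(1)[OF q]) (use xy E f in \<open>auto intro!: subspace_add subspace_scale\<close>)
    moreover have "(x + t *\<^sub>R f) + (y + s *\<^sub>R f) = (x + y) + (t + s) *\<^sub>R f"
      by (simp add: algebra_simps)
    moreover have "lower_towards E q f (x + y) \<le> q ((x + y) + (t + s) *\<^sub>R f) - (t + s) * q f"
      using s t by (intro lower_towards_le[OF xyE]) auto
    ultimately show "lower_towards E q f (x + y) - (q (y + s *\<^sub>R f) - s * q f)
        \<le> q (x + t *\<^sub>R f) - t * q f"
      by (simp add: algebra_simps)
  qed
  then have "lower_towards E q f (x + y) - lower_towards E q f x \<le> lower_towards E q f y"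
    by (intro lower_towards_ge[OF xy(2)]) (fastforce simp: algebra_simps)
  then show "lower_towards E q f (x + y) \<le> lower_towards E q f x + lower_towards E q f y"
    by simp
next
  fix x and r :: real assume x: "x \<in> E" and "r \<ge> 0"
  then have rx: "r *\<^sub>R x \<in> E"
    using E subspace_scale by blast
  show "lower_towards E q f (r *\<^sub>R x) = r * lower_towards E q f x"
  proof (cases "r = 0")
    case True
    have "lower_towards E q f 0 = (INF t\<in>{0::real..}. 0)"
      using sublinear_onD(2)[OF q f] subspace_0[OF E] unfolding lower_towards_def by simp
    then show ?thesis
      using True by simp
  next
    case False
    with \<open>r \<ge> 0\<close> have r: "r > 0" by simp
    have scale: "q (r *\<^sub>R x + (r * t) *\<^sub>R f) - (r * t) * q f = r * (q (x + t *\<^sub>R f) - t * q f)"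
      if "t \<ge> 0" for t
    proof -
      have "x + t *\<^sub>R f \<in> E"
        using x E f by (intro subspace_add subspace_scale)
      from sublinear_onD(2)[OF q this, of r] show ?thesis
        using r by (simp add: algebra_simps)
    qed
    show ?thesis
    proof (rule antisym)
      have "lower_towards E q f (r *\<^sub>R x) / r \<le> lower_towards E q f x"
      proof (rule lower_towards_ge[OF x])
        fix t :: real assume t: "t \<ge> 0"
        have "lower_towards E q f (r *\<^sub>R x) \<le> r * (q (x + t *\<^sub>R f) - t * q f)"
          using lower_towards_le[OF rx, of "r * t"] scale[OF t] r t by simp
        then show "lower_towards E q f (r *\<^sub>R x) / r \<le> q (x + t *\<^sub>R f) - t * q f"
          using r by (simp add: field_simps)
      qed
      then show "lower_towards E q f (r *\<^sub>R x) \<le> r * lower_towards E q f x"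
        using r by (simp add: field_simps)
    next
      show "r * lower_towards E q f x \<le> lower_towards E q f (r *\<^sub>R x)"
      proof (rule lower_towards_ge[OF rx])
        fix t :: real assume t: "t \<ge> 0"
        have "lower_towards E q f x \<le> q (x + (t / r) *\<^sub>R f) - (t / r) * q f"
          using r t by (intro lower_towards_le[OF x]) auto
        then have "r * lower_towards E q f x \<le> r * (q (x + (t / r) *\<^sub>R f) - (t / r) * q f)"
          using r by (intro mult_left_mono) auto
        also have "\<dots> = q (r *\<^sub>R x + t *\<^sub>R f) - t * q f"
          using scale[of "t / r"] r t by simp
        finally show "r * lower_towards E q f x \<le> q (r *\<^sub>R x + t *\<^sub>R f) - t * q f" .
      qed
    qed
  qed
qed

lemma lower_towards_le_self: "x \<in> E \<Longrightarrow> lower_towards E q f x \<le> q x"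
  using lower_towards_le[of x 0] by simp

lemma lower_towards_minus: "lower_towards E q f (- f) \<le> - q f"
  using lower_towards_le[of "- f" 1] E f sublinear_on_zero[OF q E] by (simp add: subspace_neg)

end

text \<open>A minimal sublinear functional \<open>L\<close> is linear:
  \<open>lower_towards E L f\<close> lies below \<open>L\<close>, hence equals it, and this forces
  \<open>L (- f) \<le> - L f\<close>. Zorn's lemma is run below \<open>lower_towards E p x0\<close>
  instead of \<open>p\<close>, because every functional there satisfies
  \<open>L (- x0) \<le> - p x0\<close>; this yields equality at \<open>x0\<close>.\<close>

theorem hahn_banach_sublinear:
  fixes p :: "'a::real_vector \<Rightarrow> real"
  assumes E: "subspace E" and p: "sublinear_on E p" and x0: "x0 \<in> E"
  obtains L where "\<And>x y. x \<in> E \<Longrightarrow> y \<in> E \<Longrightarrow> L (x + y) = L x + L y"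
    and "\<And>x t. x \<in> E \<Longrightarrow> L (t *\<^sub>R x) = t * L x"
    and "\<And>x. x \<in> E \<Longrightarrow> L x \<le> p x" and "L x0 = p x0"
proof -
  define p0 where "p0 = lower_towards E p x0"
  have p0: "sublinear_on E p0"
    unfolding p0_def by (rule sublinear_lower_towards[OF E p x0])
  define A where "A = {q. sublinear_on E q \<and> (\<forall>x. x \<notin> E \<longrightarrow> q x = 0) \<and> (\<forall>x\<in>E. q x \<le> p0 x)}"
  have p0A: "p0 \<in> A"
    using p0 unfolding A_def by (auto simp: p0_def lower_towards_def)
  have lbA: "- p0 (- x) \<le> q x" if "q \<in> A" "x \<in> E" for q x
    using that sublinear_on_neg[of E q x] E subspace_neg[OF E, of x] unfolding A_def by force
  have "\<exists>m\<in>A. \<forall>a\<in>A. a \<le> m \<longrightarrow> a = m"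
  proof (rule predicate_Zorn[where P = "\<lambda>a b. b \<le> a"])
    show "partial_order_on A (relation_of (\<lambda>a b. b \<le> a) A)"
      by (rule partial_order_on_relation_ofI) auto
  next
    fix C assume C: "C \<in> Chains (relation_of (\<lambda>a b. b \<le> a) A)"
    then have CA: "C \<subseteq> A" and tot: "\<And>a b. a \<in> C \<Longrightarrow> b \<in> C \<Longrightarrow> a \<le> b \<or> b \<le> a"
      unfolding Chains_def relation_of_def by blast+
    show "\<exists>u\<in>A. \<forall>a\<in>C. u \<le> a"
    proof (cases "C = {}")
      case True
      then show ?thesis using p0A by auto
    next
      case False
      define u where "u x = (if x \<in> E then INF a\<in>C. a x else 0)" for x
      have bdd: "bdd_below ((\<lambda>a. a x) ` C)" if "x \<in> E" for x
        using that CA lbA by (intro bdd_belowI[where m = "- p0 (- x)"]) auto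
      have u_le: "u x \<le> a x" if "a \<in> C" "x \<in> E" for a x
        using bdd that unfolding u_def by (auto intro!: cINF_lower)
      have u_ge: "r \<le> u x" if "x \<in> E" "\<And>a. a \<in> C \<Longrightarrow> r \<le> a x" for r x
        using that False unfolding u_def by (auto intro!: cINF_greatest)
      have subl: "sublinear_on E a" if "a \<in> C" for a
        using CA that unfolding A_def by auto
      have "u (x + y) \<le> u x + u y" if xy: "x \<in> E" "y \<in> E" for x y
      proof -
        have xyE: "x + y \<in> E"
          using E xy subspace_add by blast
        \<comment> \<open>Two chain members are comparable, so a single member \<open>d\<close> lies
          below both, and its subadditivity is inherited by the infimum.\<close>
        have *: "u (x + y) \<le> a x + b y" if ab: "a \<in> C" "b \<in> C" for a b
        proof -
          obtain d where d: "d \<in> C" "d \<le> a" "d \<le> b"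
            using tot[OF ab] ab by blast
          have "u (x + y) \<le> d (x + y)"
            using u_le[OF d(1) xyE] .
          also have "\<dots> \<le> d x + d y"
            using sublinear_onD(1)[OF subl[OF d(1)]] xy by blast
          also have "\<dots> \<le> a x + b y"
            using d(2,3) by (simp add: le_fun_def add_mono)
          finally show ?thesis .
        qed
        have "u (x + y) - b y \<le> u x" if "b \<in> C" for b
          using *[OF _ that] by (intro u_ge[OF xy(1)]) (simp add: algebra_simps)
        then have "u (x + y) - u x \<le> u y"
          by (intro u_ge[OF xy(2)]) (fastforce simp: algebra_simps)
        then show ?thesis by simp
      qed
      moreover have "u (t *\<^sub>R x) = t * u x" if x: "x \<in> E" and t: "t \<ge> 0" for x t
      proof -
        have tx: "t *\<^sub>R x \<in> E"
          using E x subspace_scale by blast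
        have sc: "a (t *\<^sub>R x) = t * a x" if "a \<in> C" for a
          using sublinear_onD(2)[OF subl[OF that] x t] .
        show ?thesis
        proof (cases "t = 0")
          case True
          have "a 0 = 0" if "a \<in> C" for a
            using sublinear_on_zero[OF subl[OF that] E] .
          then have "u 0 = (INF a\<in>C. 0)"
            using subspace_0[OF E] unfolding u_def by (auto intro!: INF_cong)
          then show ?thesis using True False by simp
        next
          case False
          with t have t: "t > 0" by simp
          have "t * u x \<le> u (t *\<^sub>R x)"
            using u_le[OF _ x] t by (intro u_ge[OF tx]) (simp add: sc)
          moreover have "u (t *\<^sub>R x) / t \<le> u x"
            using u_le[OF _ tx] t by (intro u_ge[OF x]) (simp add: sc field_simps)
          ultimately show ?thesis
            using t by (simp add: field_simps)
        qed
      qed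
      ultimately have "sublinear_on E u"
        unfolding sublinear_on_def by blast
      moreover have "u x \<le> p0 x" if "x \<in> E" for x
        using u_le[OF _ that] False CA that unfolding A_def by (force intro: order_trans)
      ultimately have "u \<in> A"
        unfolding A_def by (auto simp: u_def)
      moreover have "u \<le> a" if "a \<in> C" for a
      proof (rule le_funI)
        fix x show "u x \<le> a x"
          using u_le[OF that, of x] CA that unfolding A_def by (cases "x \<in> E") (auto simp: u_def)
      qed
      ultimately show ?thesis by blast
    qed
  qed
  then obtain L where L: "L \<in> A" and min: "\<And>a. a \<in> A \<Longrightarrow> a \<le> L \<Longrightarrow> a = L"
    by blast
  have Ls: "sublinear_on E L"
    using L unfolding A_def by blast
  have neg: "L (- f) = - L f" if f: "f \<in> E" for f
  proof -
    have nf: "- f \<in> E"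
      using E f subspace_neg by blast
    have "lower_towards E L f \<le> L"
    proof (rule le_funI)
      fix x show "lower_towards E L f x \<le> L x"
        using lower_towards_le_self[OF E Ls f, of x] L unfolding A_def
        by (cases "x \<in> E") (auto simp: lower_towards_def)
    qed
    moreover have "lower_towards E L f \<in> A"
      using sublinear_lower_towards[OF E Ls f] lower_towards_le_self[OF E Ls f] L
      unfolding A_def by (force simp: lower_towards_def)
    ultimately have "lower_towards E L f = L"
      using min by blast
    then have "L (- f) \<le> - L f"
      using lower_towards_minus[OF E Ls f] by simp
    with sublinear_on_neg[OF Ls E f] show ?thesis by simp
  qed
  show thesis
  proof
    fix x y assume xy: "x \<in> E" "y \<in> E"
    have "L (x + y) \<le> L x + L y"
      using sublinear_onD(1)[OF Ls xy] .
    moreover have "L (- x + - y) \<le> L (- x) + L (- y)"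
      using xy E by (intro sublinear_onD(1)[OF Ls]) (auto simp: subspace_neg)
    moreover have "L (- x + - y) = - L (x + y)"
      using neg[of "x + y"] xy E by (simp add: subspace_add)
    ultimately show "L (x + y) = L x + L y"
      using neg xy by simp
  next
    fix x and t :: real assume x: "x \<in> E"
    show "L (t *\<^sub>R x) = t * L x"
    proof (cases "t \<ge> 0")
      case True
      then show ?thesis using sublinear_onD(2)[OF Ls x] by blast
    next
      case False
      then have "L ((- t) *\<^sub>R x) = - t * L x"
        using sublinear_onD(2)[OF Ls x, of "- t"] by simp
      then show ?thesis
        using neg[of "t *\<^sub>R x"] E x by (simp add: subspace_scale)
    qed
  next
    fix x assume "x \<in> E"
    then show "L x \<le> p x"
      using L lower_towards_le_self[OF E p x0, of x] unfolding A_def p0_def by force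
  next
    have "L (- x0) \<le> p0 (- x0)"
      using L E x0 unfolding A_def by (simp add: subspace_neg)
    also have "\<dots> \<le> - p x0"
      unfolding p0_def by (rule lower_towards_minus[OF E p x0])
    finally have "p x0 \<le> L x0"
      using neg[OF x0] by simp
    moreover have "L x0 \<le> p x0"
      using L lower_towards_le_self[OF E p x0 x0] x0 unfolding A_def p0_def by force
    ultimately show "L x0 = p x0" by simp
  qed
qed

text \<open>With the pointwise addition of \<open>Function_Algebras\<close> this turns spaces of
  real functions into real vector spaces, to which Hahn-Banach applies.\<close>

instantiation "fun" :: (type, scaleR) scaleR
begin
definition scaleR_fun_def: "r *\<^sub>R f = (\<lambda>x. r *\<^sub>R f x)"
instance ..
end

lemma scaleR_fun_apply [simp]: "(r *\<^sub>R f) x = r *\<^sub>R f x"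
  by (simp add: scaleR_fun_def)

instance "fun" :: (type, real_vector) real_vector
  by standard (auto simp: fun_eq_iff scaleR_add_right scaleR_add_left)

section \<open>Positive functionals and representing measures\<close>

lemma sum_halves: "(\<Sum>i\<le>n. r * (1 / 2) ^ Suc i) = (r::real) * (1 - (1 / 2) ^ Suc n)"
  by (induction n) (simp_all add: algebra_simps)

text \<open>These bounds evaluate a staircase: counting the integer levels below \<open>a\<close>
  recovers \<open>a\<close> up to an error 1, with a cut at height \<open>N\<close>. They serve the
  layer-cake approximation of an integral.\<close>

lemma count_less_bounds:
  fixes a :: real
  assumes "a \<ge> 0"
  shows "(\<Sum>k=1..N. if real k < a then 1 else 0 :: real) \<le> a"
    and "min (real N) (a - 1) \<le> (\<Sum>k=1..N. if real k < a then 1 else 0 :: real)"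
proof -
  have le_N: "(\<Sum>k=1..N. if real k < a then 1 else 0 :: real) \<le> real N" for N
    by (induction N) auto
  have "(\<Sum>k=1..N. if real k < a then 1 else 0 :: real) \<le> a
      \<and> min (real N) (a - 1) \<le> (\<Sum>k=1..N. if real k < a then 1 else 0 :: real)"
  proof (induction N)
    case 0
    then show ?case using assms by auto
  next
    case (Suc N)
    then show ?case
      using le_N[of N] by (auto simp: min_def split: if_splits)
  qed
  then show "(\<Sum>k=1..N. if real k < a then 1 else 0 :: real) \<le> a"
    and "min (real N) (a - 1) \<le> (\<Sum>k=1..N. if real k < a then 1 else 0 :: real)"
    by auto
qed

text \<open>No measurability is built in: \<open>solid\<close> and \<open>one_mem\<close> put the
  indicator of every set into \<open>E\<close>, so \<open>L\<close> induces a finitely additive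
  probability on all subsets.\<close>

locale positive_functional =
  fixes E :: "('z \<Rightarrow> real) set" and L :: "('z \<Rightarrow> real) \<Rightarrow> real"
  assumes add_mem: "f \<in> E \<Longrightarrow> g \<in> E \<Longrightarrow> (\<lambda>z. f z + g z) \<in> E"
    and scale_mem: "f \<in> E \<Longrightarrow> (\<lambda>z. t * f z) \<in> E"
    and solid: "g \<in> E \<Longrightarrow> (\<And>z. \<bar>f z\<bar> \<le> g z) \<Longrightarrow> f \<in> E"
    and one_mem: "(\<lambda>_. 1) \<in> E"
    and L_add: "f \<in> E \<Longrightarrow> g \<in> E \<Longrightarrow> L (\<lambda>z. f z + g z) = L f + L g"
    and L_scale: "f \<in> E \<Longrightarrow> L (\<lambda>z. t * f z) = t * L f"
    and L_mono: "f \<in> E \<Longrightarrow> g \<in> E \<Longrightarrow> (\<And>z. f z \<le> g z) \<Longrightarrow> L f \<le> L g"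
    and L_one: "L (\<lambda>_. 1) = 1"
begin

definition charge :: "'z set \<Rightarrow> real" where
  "charge A = L (indicator A)"

lemma indicator_mem: "indicator A \<in> E"
  by (rule solid[OF one_mem]) (auto simp: indicator_def)

lemma zero_mem: "(\<lambda>_. 0) \<in> E"
  using scale_mem[OF one_mem, of 0] by simp

lemma L_zero: "L (\<lambda>_. 0) = 0"
  using L_scale[OF one_mem, of 0] by simp

lemma sum_mem:
  assumes "\<And>k. k \<in> S \<Longrightarrow> g k \<in> E"
  shows "(\<lambda>z. \<Sum>k\<in>S. g k z) \<in> E"
  using assms by (induction S rule: infinite_finite_induct) (auto simp: zero_mem add_mem)

lemma L_sum:
  assumes "\<And>k. k \<in> S \<Longrightarrow> g k \<in> E"
  shows "L (\<lambda>z. \<Sum>k\<in>S. g k z) = (\<Sum>k\<in>S. L (g k))"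
  using assms
  by (induction S rule: infinite_finite_induct) (auto simp: L_zero L_add sum_mem)

lemma charge_nonneg: "charge A \<ge> 0"
proof -
  have "L (\<lambda>_. 0) \<le> L (indicator A)"
    by (rule L_mono[OF zero_mem indicator_mem]) auto
  then show ?thesis by (simp add: L_zero charge_def)
qed

lemma charge_mono: "A \<subseteq> B \<Longrightarrow> charge A \<le> charge B"
  unfolding charge_def by (rule L_mono[OF indicator_mem indicator_mem]) (auto simp: indicator_def)

lemma charge_Un_disjoint: "A \<inter> B = {} \<Longrightarrow> charge (A \<union> B) = charge A + charge B"
proof -
  assume "A \<inter> B = {}"
  then have "(indicator (A \<union> B) :: 'z \<Rightarrow> real) = (\<lambda>z. indicator A z + indicator B z)"
    by (auto simp: indicator_def fun_eq_iff)
  then show ?thesis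
    unfolding charge_def by (simp add: L_add indicator_mem)
qed

lemma charge_Un_le: "charge (A \<union> B) \<le> charge A + charge B"
proof -
  have "A \<union> B = A \<union> (B - A)" by auto
  then have "charge (A \<union> B) = charge A + charge (B - A)"
    using charge_Un_disjoint[of A "B - A"] by auto
  then show ?thesis
    using charge_mono[of "B - A" B] by auto
qed

lemma charge_UN_le: "charge (\<Union>i\<in>{..n::nat}. B i) \<le> (\<Sum>i\<le>n. charge (B i))"
proof (induction n)
  case (Suc n)
  have "charge (\<Union>i\<in>{..Suc n}. B i) \<le> charge (\<Union>i\<in>{..n}. B i) + charge (B (Suc n))"
    using charge_Un_le[of "\<Union>i\<in>{..n}. B i" "B (Suc n)"] by (simp add: atMost_Suc Un_commute)
  then show ?case using Suc by auto
qed auto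

lemma charge_empty: "charge {} = 0"
proof -
  have "(indicator {} :: 'z \<Rightarrow> real) = (\<lambda>_. 0)" by auto
  then show ?thesis by (simp add: charge_def L_zero)
qed

lemma charge_UNIV: "charge UNIV = 1"
proof -
  have "(indicator UNIV :: 'z \<Rightarrow> real) = (\<lambda>_. 1)" by auto
  then show ?thesis by (simp add: charge_def L_one)
qed

end

text \<open>A finitely additive probability can lose mass at infinity or next to a hyperplane;
  \<open>tight\<close> excludes the former and the slab conditions the latter. The slabs are open
  and leave out the hyperplane, so that an atom of a marginal is allowed.\<close>

locale tight_positive_functional = positive_functional E L
  for E :: "('z::euclidean_space \<Rightarrow> real) set" and L +
  assumes tight: "e > 0 \<Longrightarrow> \<exists>K. compact K \<and> charge (- K) < e"
    and slab_left: "b \<in> Basis \<Longrightarrow> e > 0 \<Longrightarrow> \<exists>s<t. charge {z. s < z \<bullet> b \<and> z \<bullet> b < t} < e"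
    and slab_right: "b \<in> Basis \<Longrightarrow> e > 0 \<Longrightarrow> \<exists>s>t. charge {z. t < z \<bullet> b \<and> z \<bullet> b < s} < e"
begin

text \<open>This is the class of sets for Alexandroff's theorem: finitely additive set functions
  with compact inner and open outer approximation are countably additive. No Borel condition is
  imposed; every subset of an open set of charge 0 belongs to the class.\<close>

definition regular_sets :: "'z set set" where
  "regular_sets =
     {A. \<forall>e>0. \<exists>K U. compact K \<and> open U \<and> K \<subseteq> A \<and> A \<subseteq> U \<and> charge (U - K) < e}"

lemma regular_setsD:
  assumes "A \<in> regular_sets" "e > 0"
  obtains K U where "compact K" "open U" "K \<subseteq> A" "A \<subseteq> U" "charge (U - K) < e"
  using assms unfolding regular_sets_def by blast

text \<open>An open set is its own outer approximation. From inside, a closed approximation becomes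
  compact by intersecting it with a compact set of nearly full charge.\<close>

lemma regular_sets_halfspace:
  assumes A: "open A" and C: "\<And>e. e > 0 \<Longrightarrow> \<exists>C. closed C \<and> C \<subseteq> A \<and> charge (A - C) < e"
  shows "A \<in> regular_sets"
  unfolding regular_sets_def
proof (intro CollectI allI impI)
  fix e :: real assume "e > 0"
  obtain K where K: "compact K" "charge (- K) < e / 2"
    using tight[of "e / 2"] \<open>e > 0\<close> by auto
  obtain C where C: "closed C" "C \<subseteq> A" "charge (A - C) < e / 2"
    using C[of "e / 2"] \<open>e > 0\<close> by auto
  have "charge (A - K \<inter> C) \<le> charge ((- K) \<union> (A - C))"
    by (rule charge_mono) auto
  also have "\<dots> < e"
    using charge_Un_le[of "- K" "A - C"] K C by linarith
  finally show "\<exists>K U. compact K \<and> open U \<and> K \<subseteq> A \<and> A \<subseteq> U \<and> charge (U - K) < e"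
    using K(1) C(1,2) A by (intro exI[of _ "K \<inter> C"] exI[of _ A]) auto
qed

lemma regular_sets_less: "b \<in> Basis \<Longrightarrow> {z. z \<bullet> b < t} \<in> regular_sets"
proof (rule regular_sets_halfspace)
  fix e :: real assume b: "b \<in> Basis" and "e > 0"
  then obtain s where s: "s < t" "charge {z. s < z \<bullet> b \<and> z \<bullet> b < t} < e"
    using slab_left by blast
  moreover have "{z. z \<bullet> b < t} - {z. z \<bullet> b \<le> s} = {z. s < z \<bullet> b \<and> z \<bullet> b < t}"
    by auto
  moreover have "closed {z. z \<bullet> b \<le> s}"
    by (intro closed_Collect_le continuous_intros)
  ultimately show "\<exists>C. closed C \<and> C \<subseteq> {z. z \<bullet> b < t} \<and> charge ({z. z \<bullet> b < t} - C) < e"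
    by (intro exI[of _ "{z. z \<bullet> b \<le> s}"] conjI) (simp_all add: Collect_mono_iff)
qed (intro open_Collect_less continuous_intros)

lemma regular_sets_greater: "b \<in> Basis \<Longrightarrow> {z. t < z \<bullet> b} \<in> regular_sets"
proof (rule regular_sets_halfspace)
  fix e :: real assume b: "b \<in> Basis" and "e > 0"
  then obtain s where s: "s > t" "charge {z. t < z \<bullet> b \<and> z \<bullet> b < s} < e"
    using slab_right by blast
  moreover have "{z. t < z \<bullet> b} - {z. s \<le> z \<bullet> b} = {z. t < z \<bullet> b \<and> z \<bullet> b < s}"
    by auto
  moreover have "closed {z. s \<le> z \<bullet> b}"
    by (intro closed_Collect_le continuous_intros)
  ultimately show "\<exists>C. closed C \<and> C \<subseteq> {z. t < z \<bullet> b} \<and> charge ({z. t < z \<bullet> b} - C) < e"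
    by (intro exI[of _ "{z. s \<le> z \<bullet> b}"] conjI) (simp_all add: Collect_mono_iff)
qed (intro open_Collect_less continuous_intros)

lemma algebra_regular_sets: "algebra UNIV regular_sets"
  unfolding algebra_iff_Un
proof (intro conjI ballI)
  show "{} \<in> regular_sets"
    unfolding regular_sets_def
    by (auto intro!: exI[of _ "{}"] simp: charge_empty)
next
  fix A assume A: "A \<in> regular_sets"
  show "UNIV - A \<in> regular_sets"
    unfolding regular_sets_def
  proof (intro CollectI allI impI)
    fix e :: real assume "e > 0"
    then obtain K U where KU: "compact K" "open U" "K \<subseteq> A" "A \<subseteq> U" "charge (U - K) < e / 2"
      using regular_setsD[OF A, of "e / 2"] by auto
    \<comment> \<open>The complement of \<open>U\<close> is merely closed; tightness makes it
      compact at small cost.\<close>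
    obtain C where C: "compact C" "charge (- C) < e / 2"
      using tight[of "e / 2"] \<open>e > 0\<close> by auto
    have "charge (- K - (C \<inter> - U)) \<le> charge ((U - K) \<union> - C)"
      by (rule charge_mono) auto
    also have "\<dots> < e"
      using charge_Un_le[of "U - K" "- C"] KU C by linarith
    finally show "\<exists>K U. compact K \<and> open U \<and> K \<subseteq> UNIV - A \<and> UNIV - A \<subseteq> U \<and> charge (U - K) < e"
      using KU C by (intro exI[of _ "C \<inter> - U"] exI[of _ "- K"])
        (auto intro!: compact_Int_closed simp: compact_imp_closed)
  qed
next
  fix A B assume A: "A \<in> regular_sets" and B: "B \<in> regular_sets"
  show "A \<union> B \<in> regular_sets"
    unfolding regular_sets_def
  proof (intro CollectI allI impI)
    fix e :: real assume "e > 0"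
    then obtain K U where KU: "compact K" "open U" "K \<subseteq> A" "A \<subseteq> U" "charge (U - K) < e / 2"
      using regular_setsD[OF A, of "e / 2"] by auto
    obtain K' U' where KU': "compact K'" "open U'" "K' \<subseteq> B" "B \<subseteq> U'" "charge (U' - K') < e / 2"
      using regular_setsD[OF B, of "e / 2"] \<open>e > 0\<close> by auto
    have "charge (U \<union> U' - (K \<union> K')) \<le> charge ((U - K) \<union> (U' - K'))"
      by (rule charge_mono) auto
    also have "\<dots> < e"
      using charge_Un_le[of "U - K" "U' - K'"] KU KU' by linarith
    finally show "\<exists>K U. compact K \<and> open U \<and> K \<subseteq> A \<union> B \<and> A \<union> B \<subseteq> U \<and> charge (U - K) < e"
      using KU KU' by (intro exI[of _ "K \<union> K'"] exI[of _ "U \<union> U'"]) auto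
  qed
qed auto

text \<open>Compact inner approximations \<open>K i\<close> of sets decreasing to the empty set have
  empty intersection, hence finitely many of them do. Beyond that index every \<open>A n\<close> is
  covered by the finitely many errors \<open>A i - K i\<close>, whose geometric bounds add up to
  less than \<open>r\<close>.\<close>

lemma charge_decseq_tendsto_0:
  assumes A: "range A \<subseteq> regular_sets" "decseq A" "(\<Inter>i. A i) = {}"
  shows "(\<lambda>i. charge (A i)) \<longlonglongrightarrow> 0"
proof (rule LIMSEQ_I)
  fix r :: real assume r: "r > 0"
  have "\<exists>K. compact K \<and> K \<subseteq> A i \<and> charge (A i - K) < r * (1 / 2) ^ Suc i" for i
  proof -
    have "A i \<in> regular_sets" "r * (1 / 2) ^ Suc i > 0"
      using A r by auto
    then obtain K U where KU: "compact K" "open U" "K \<subseteq> A i" "A i \<subseteq> U"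
        "charge (U - K) < r * (1 / 2) ^ Suc i"
      by (rule regular_setsD)
    moreover have "charge (A i - K) \<le> charge (U - K)"
      using KU by (intro charge_mono) auto
    ultimately show ?thesis by (intro exI[of _ K]) auto
  qed
  then obtain K where K: "\<And>i. compact (K i)" "\<And>i. K i \<subseteq> A i"
      "\<And>i. charge (A i - K i) < r * (1 / 2) ^ Suc i"
    by metis
  have "\<exists>n. (\<Inter>i\<le>n. K i) = {}"
  proof (rule ccontr)
    assume *: "\<not> ?thesis"
    have "(\<Inter>n. (\<Inter>i\<le>n. K i)) \<noteq> {}"
    proof (rule compact_nest)
      fix n show "compact (\<Inter>i\<le>n. K i)"
        by (rule compact_Inter) (use K in \<open>auto\<close>)
      show "(\<Inter>i\<le>n. K i) \<noteq> {}" using * by blast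
    next
      fix m n :: nat assume "m \<le> n"
      then show "(\<Inter>i\<le>n. K i) \<subseteq> (\<Inter>i\<le>m. K i)" by auto
    qed
    then have "(\<Inter>i. A i) \<noteq> {}" using K(2) by blast
    with A(3) show False by simp
  qed
  then obtain N where N: "(\<Inter>i\<le>N. K i) = {}" by blast
  have "norm (charge (A n) - 0) < r" if "n \<ge> N" for n
  proof -
    have "A n \<subseteq> (\<Union>i\<le>N. A i - K i)"
    proof
      fix x assume x: "x \<in> A n"
      from N obtain i where i: "i \<le> N" "x \<notin> K i" by blast
      moreover have "x \<in> A i"
        using x decseqD[OF A(2), of i n] i that by auto
      ultimately show "x \<in> (\<Union>i\<le>N. A i - K i)" by blast
    qed
    then have "charge (A n) \<le> charge (\<Union>i\<in>{..N}. A i - K i)"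
      by (rule charge_mono)
    also have "\<dots> \<le> (\<Sum>i\<le>N. charge (A i - K i))"
      by (rule charge_UN_le)
    also have "\<dots> \<le> (\<Sum>i\<le>N. r * (1 / 2) ^ Suc i)"
      using K(3) by (intro sum_mono less_imp_le)
    also have "\<dots> = r * (1 - (1 / 2) ^ Suc N)"
      by (rule sum_halves)
    also have "\<dots> < r" using r by auto
    finally show ?thesis using charge_nonneg by simp
  qed
  then show "\<exists>no. \<forall>n\<ge>no. norm (charge (A n) - 0) < r" by blast
qed

lemma open_box_regular: "box a b \<in> regular_sets"
proof -
  interpret algebra UNIV regular_sets by (rule algebra_regular_sets)
  have "box a b = (\<Inter>i\<in>Basis. {z. a \<bullet> i < z \<bullet> i} \<inter> {z. z \<bullet> i < b \<bullet> i})"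
    by (auto simp: box_def)
  also have "\<dots> \<in> regular_sets"
    by (rule finite_INT) (auto simp: regular_sets_less regular_sets_greater)
  finally show ?thesis .
qed

text \<open>Caratheodory extends \<open>charge\<close> from the algebra of regular sets. Half-spaces
  are regular, so they keep their charge. A general open set is only a countable union of boxes;
  continuity from below is available for \<pi> but not for \<open>charge\<close>, so just an
  inequality survives. It has the direction needed for lower semicontinuous functions.\<close>

lemma representing_measure:
  obtains \<pi> :: "'z measure" where "prob_space \<pi>" "sets \<pi> = sets borel"
    "\<And>U. open U \<Longrightarrow> measure \<pi> U \<le> charge U"
    "\<And>b t. b \<in> Basis \<Longrightarrow> measure \<pi> {z. t < z \<bullet> b} = charge {z. t < z \<bullet> b}"
proof -
  interpret algebra UNIV regular_sets by (rule algebra_regular_sets)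
  have "\<exists>\<mu> :: 'z set \<Rightarrow> ennreal. (\<forall>s \<in> regular_sets. \<mu> s = ennreal (charge s))
      \<and> measure_space UNIV (sigma_sets UNIV regular_sets) \<mu>"
  proof (rule caratheodory_empty_continuous)
    show "positive regular_sets (\<lambda>A. ennreal (charge A))"
      by (simp add: positive_def charge_empty)
    show "additive regular_sets (\<lambda>A. ennreal (charge A))"
      by (auto simp: additive_def charge_Un_disjoint charge_nonneg)
    show "(\<lambda>i. ennreal (charge (A i))) \<longlonglongrightarrow> 0"
      if "range A \<subseteq> regular_sets" "decseq A" "(\<Inter>i. A i) = {}" for A
      using tendsto_ennrealI[OF charge_decseq_tendsto_0[OF that]] by simp
  qed auto
  then obtain \<mu> where \<mu>: "\<And>s. s \<in> regular_sets \<Longrightarrow> \<mu> s = ennreal (charge s)"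
    and ms: "measure_space UNIV (sigma_sets UNIV regular_sets) \<mu>" by blast
  define M where "M = measure_of UNIV (sigma_sets UNIV regular_sets) \<mu>"
  have sa: "sigma_algebra UNIV (sigma_sets UNIV regular_sets)"
    by (rule sigma_algebra_sigma_sets) auto
  have sM: "sets M = sigma_sets UNIV regular_sets" and spM: "space M = UNIV"
    unfolding M_def using sigma_algebra.sigma_sets_eq[OF sa] by simp_all
  have eM: "emeasure M A = \<mu> A" if "A \<in> sigma_sets UNIV regular_sets" for A
    unfolding M_def using ms that sa unfolding measure_space_def
    by (intro emeasure_measure_of_sigma) auto
  have boxM: "box a b \<in> sets M" for a b
    unfolding sM using open_box_regular by blast
  have meas: "(\<lambda>x. x) \<in> measurable M borel"
    unfolding borel_eq_box using boxM spM by (intro measurable_measure_of) auto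
  \<comment> \<open>The generated sigma-algebra contains the Borel sets but may be larger; the image
    under the identity restricts the measure to Borel sets.\<close>
  define \<pi> where "\<pi> = distr M borel (\<lambda>x. x)"
  have e\<pi>: "emeasure \<pi> A = ennreal (charge A)" if "A \<in> sets borel" "A \<in> regular_sets" for A
    unfolding \<pi>_def using that meas spM eM[of A] \<mu>[of A]
    by (subst emeasure_distr) auto
  have m\<pi>: "measure \<pi> A = charge A" if "A \<in> sets borel" "A \<in> regular_sets" for A
    using e\<pi>[OF that] charge_nonneg by (simp add: measure_def)
  have U\<pi>: "emeasure \<pi> UNIV = 1"
    using e\<pi>[of UNIV] top charge_UNIV by auto
  have prob: "prob_space \<pi>"
    by (rule prob_spaceI) (use U\<pi> in \<open>simp add: \<pi>_def\<close>)
  interpret \<pi>: prob_space \<pi> by (rule prob)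
  have s\<pi>: "sets \<pi> = sets borel" by (simp add: \<pi>_def)
  have "measure \<pi> U \<le> charge U" if U: "open U" for U
  proof (cases "U = {}")
    case True
    then show ?thesis by (simp add: charge_empty)
  next
    case False
    obtain \<D> where \<D>: "countable \<D>" "\<D> \<subseteq> Pow U" "\<And>X. X \<in> \<D> \<Longrightarrow> \<exists>a b. X = box a b" "\<Union>\<D> = U"
      using open_countable_Union_open_box[OF U] by metis
    have "\<D> \<noteq> {}" using \<D>(4) False by auto
    define V where "V n = (\<Union>k\<le>n. from_nat_into \<D> k)" for n
    have in\<D>: "from_nat_into \<D> k \<in> \<D>" for k
      using \<open>\<D> \<noteq> {}\<close> by (rule from_nat_into)
    have "from_nat_into \<D> k \<in> regular_sets" for k
      using \<D>(3)[OF in\<D>, of k] open_box_regular by auto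
    then have Vreg: "V n \<in> regular_sets" for n
      unfolding V_def by (intro finite_UN) auto
    have "open (from_nat_into \<D> k)" for k
      using \<D>(3)[OF in\<D>, of k] open_box by auto
    then have Vopen: "open (V n)" for n
      unfolding V_def by (intro open_UN) auto
    have Vsets: "range V \<subseteq> sets \<pi>"
      using Vopen s\<pi> by auto
    have Vinc: "incseq V"
      unfolding V_def incseq_def by force
    have "(\<Union>n. V n) = \<Union>(range (from_nat_into \<D>))"
      unfolding V_def by auto
    then have UV: "(\<Union>n. V n) = U"
      using \<D>(1,4) \<open>\<D> \<noteq> {}\<close> by simp
    have "(\<lambda>n. measure \<pi> (V n)) \<longlonglongrightarrow> measure \<pi> (\<Union>n. V n)"
      by (rule \<pi>.finite_Lim_measure_incseq[OF Vsets Vinc])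
    moreover have "measure \<pi> (V n) \<le> charge U" for n
    proof -
      have "measure \<pi> (V n) = charge (V n)"
        using Vopen by (intro m\<pi> Vreg) auto
      then show ?thesis
        using UV charge_mono[of "V n" U] by auto
    qed
    ultimately show ?thesis
      unfolding UV by (intro LIMSEQ_le_const2) auto
  qed
  moreover have "measure \<pi> {z. t < z \<bullet> b} = charge {z. t < z \<bullet> b}" if "b \<in> Basis" for b t
    by (rule m\<pi>[OF _ regular_sets_greater[OF that]]) measurable
  ultimately show thesis
    using that prob s\<pi> by blast
qed

end

text \<open>Layer cake: a staircase below \<open>f\<close> built from the open superlevel sets has
  integral at most its \<open>L\<close>-value, hence at most \<open>L f\<close>. Fatou's lemma
  passes to the limit on the side of the measure, so no continuity of \<open>L\<close> is
  required.\<close>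

lemma nn_integral_le_functional:
  fixes \<pi> :: "'z::topological_space measure"
  assumes "positive_functional E L"
    and \<pi>: "prob_space \<pi>" "sets \<pi> = sets borel" and U: "\<And>U. open U \<Longrightarrow> measure \<pi> U \<le> L (indicator U)"
    and lsc: "\<And>a. open {z. a < f z}" and nonneg: "\<And>z. f z \<ge> 0" and f: "f \<in> E"
  shows "(\<integral>\<^sup>+z. ennreal (f z) \<partial>\<pi>) \<le> ennreal (L f)"
proof -
  interpret positive_functional E L by fact
  note U = U[folded charge_def]
  interpret prob_space \<pi> by fact
  \<comment> \<open>There are n * n levels of height 1 / n, so the mesh tends to 0 while the cut-off
    height n tends to infinity.\<close>
  define F where "F n z = (1 / real n) * (\<Sum>k=1..n * n. indicator {z. real k / real n < f z} z)"
    for n z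
  have sets[measurable]: "{z. a < f z} \<in> sets \<pi>" for a
    using lsc \<pi>(2) by auto
  have F_eq: "F n z = (1 / real n) * (\<Sum>k=1..n * n. if real k < real n * f z then 1 else 0)"
    if "n > 0" for n z
    unfolding F_def using that
    by (intro arg_cong2[where f = "(*)"] sum.cong) (auto simp: indicator_def field_simps)
  have F_le: "F n z \<le> f z" if "n > 0" for n z
    using count_less_bounds(1)[of "real n * f z" "n * n"] nonneg[of z] that
    unfolding F_eq[OF that] by (simp add: field_simps)
  have F_ge: "f z - 1 / real n \<le> F n z" if n: "n > 0" "f z \<le> real n" for n z
  proof -
    have "real n * f z - 1 \<le> min (real (n * n)) (real n * f z - 1)"
    proof (rule min.boundedI)
      show "real n * f z - 1 \<le> real (n * n)"
        using mult_left_mono[OF n(2), of "real n"] by simp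
    qed simp
    also have "\<dots> \<le> (\<Sum>k=1..n * n. if real k < real n * f z then 1 else 0)"
      by (rule count_less_bounds(2)) (use nonneg in auto)
    finally have "(1 / real n) * (real n * f z - 1) \<le> F n z"
      unfolding F_eq[OF n(1)] by (intro mult_left_mono) auto
    then show ?thesis
      using n(1) by (simp add: algebra_simps)
  qed
  have F_lim: "(\<lambda>n. F n z) \<longlonglongrightarrow> f z" for z
  proof (rule tendsto_sandwich)
    show "\<forall>\<^sub>F n in sequentially. f z - 1 / real n \<le> F n z"
      using eventually_gt_at_top[of "0::nat"] eventually_ge_at_top[of "nat \<lceil>f z\<rceil>"]
      by eventually_elim (rule F_ge, auto)
    show "\<forall>\<^sub>F n in sequentially. F n z \<le> f z"
      using eventually_gt_at_top[of "0::nat"] by eventually_elim (rule F_le)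
    show "(\<lambda>n. f z - 1 / real n) \<longlonglongrightarrow> f z"
      using tendsto_diff[OF tendsto_const lim_1_over_n, of "f z"] by simp
  qed auto
  have F_meas[measurable]: "F n \<in> borel_measurable \<pi>" for n
    unfolding F_def by measurable
  have F_mem: "F n \<in> E" for n
    unfolding F_def by (intro scale_mem sum_mem indicator_mem)
  have F_int: "(\<integral>\<^sup>+z. ennreal (F n z) \<partial>\<pi>) \<le> ennreal (L f)" if "n > 0" for n
  proof -
    have int: "integrable \<pi> (F n)"
      unfolding F_def by (intro integrable_mult_right integrable_sum integrable_real_indicator)
        (auto simp: emeasure_eq_measure)
    have "integral\<^sup>L \<pi> (F n) = (1 / real n) * (\<Sum>k=1..n * n. measure \<pi> {z. real k / real n < f z})"
      unfolding F_def
      by (subst integral_mult_right_zero, subst Bochner_Integration.integral_sum)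
        (auto simp: emeasure_eq_measure)
    also have "\<dots> \<le> (1 / real n) * (\<Sum>k=1..n * n. charge {z. real k / real n < f z})"
      by (intro mult_left_mono sum_mono U lsc) auto
    also have "\<dots> = L (F n)"
      unfolding F_def charge_def
      by (subst L_scale, intro sum_mem indicator_mem) (simp add: L_sum indicator_mem)
    also have "\<dots> \<le> L f"
      using F_mem f F_le[OF that] by (rule L_mono)
    finally have "integral\<^sup>L \<pi> (F n) \<le> L f" .
    moreover have "F n z \<ge> 0" for z
      unfolding F_def by (intro mult_nonneg_nonneg sum_nonneg) auto
    ultimately show ?thesis
      by (subst nn_integral_eq_integral[OF int]) (auto intro!: ennreal_leI)
  qed
  have "(\<integral>\<^sup>+z. ennreal (f z) \<partial>\<pi>) = (\<integral>\<^sup>+z. liminf (\<lambda>n. ennreal (F n z)) \<partial>\<pi>)"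
    by (intro nn_integral_cong lim_imp_Liminf[symmetric] tendsto_ennrealI F_lim) simp
  also have "\<dots> \<le> liminf (\<lambda>n. \<integral>\<^sup>+z. ennreal (F n z) \<partial>\<pi>)"
    by (rule nn_integral_liminf) measurable
  also have "\<dots> \<le> ennreal (L f)"
    by (rule Liminf_le[OF _ eventually_mono[OF eventually_gt_at_top[of "0::nat"] F_int]]) simp
  finally show ?thesis .
qed

text \<open>The functional \<open>p f\<close>, the infimum of \<open>v\<close> over pairs with
  \<open>f \<le> s\<close>, is sublinear on \<open>E\<close>; \<open>D_mono\<close> makes it finite
  and gives it the value \<open>v\<close> at \<open>s\<close>. Hahn-Banach is applied at
  \<open>- f0\<close>, not at \<open>f0\<close>: then \<open>L f0\<close> is the supremum of
  \<open>v\<close> over pairs with \<open>s \<le> f0\<close>, the least value that a linear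
  functional below \<open>p\<close> can take there. Positivity comes from \<open>p f \<le> 0\<close>
  for \<open>f \<le> 0\<close>.\<close>

lemma dominated_functional_exists:
  fixes D :: "(('z \<Rightarrow> real) \<times> real) set" and f0 :: "'z \<Rightarrow> real"
  assumes D_add: "\<And>s v s' v'. (s, v) \<in> D \<Longrightarrow> (s', v') \<in> D \<Longrightarrow> (\<lambda>z. s z + s' z, v + v') \<in> D"
    and D_scale: "\<And>s v t. (s, v) \<in> D \<Longrightarrow> (\<lambda>z. t * s z, t * v) \<in> D"
    and D_mono: "\<And>s v s' v'. (s, v) \<in> D \<Longrightarrow> (s', v') \<in> D \<Longrightarrow> (\<And>z. s z \<le> s' z) \<Longrightarrow> v \<le> v'"
    and D_abs: "\<And>s v. (s, v) \<in> D \<Longrightarrow> \<exists>s' v'. (s', v') \<in> D \<and> (\<forall>z. \<bar>s z\<bar> \<le> s' z)"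
    and D_one: "(\<lambda>_. 1, 1) \<in> D"
  defines "E \<equiv> {f. \<exists>s v. (s, v) \<in> D \<and> (\<forall>z. \<bar>f z\<bar> \<le> s z)}"
  assumes f0: "f0 \<in> E"
  obtains L where "positive_functional E L"
    and "\<And>s v. (s, v) \<in> D \<Longrightarrow> s \<in> E \<and> L s = v"
    and "\<And>r. (\<And>s v. (s, v) \<in> D \<Longrightarrow> (\<And>z. s z \<le> f0 z) \<Longrightarrow> v \<le> r) \<Longrightarrow> L f0 \<le> r"
proof -
  have D_zero: "(\<lambda>_. 0, 0) \<in> D"
    using D_scale[OF D_one, of 0] by simp
  have E_add: "(\<lambda>z. f z + g z) \<in> E" if fg: "f \<in> E" "g \<in> E" for f g
  proof -
    obtain s v where sv: "(s, v) \<in> D" "\<And>z. \<bar>f z\<bar> \<le> s z" using fg unfolding E_def by blast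
    obtain s' v' where sv': "(s', v') \<in> D" "\<And>z. \<bar>g z\<bar> \<le> s' z" using fg unfolding E_def by blast
    have "\<bar>f z + g z\<bar> \<le> s z + s' z" for z
      using sv(2)[of z] sv'(2)[of z] by linarith
    then show ?thesis
      unfolding E_def using D_add[OF sv(1) sv'(1)] by blast
  qed
  have E_scale: "(\<lambda>z. t * f z) \<in> E" if f: "f \<in> E" for f t
  proof -
    obtain s v where sv: "(s, v) \<in> D" "\<And>z. \<bar>f z\<bar> \<le> s z" using f unfolding E_def by blast
    then have "\<bar>t * f z\<bar> \<le> \<bar>t\<bar> * s z" for z
      by (simp add: abs_mult mult_left_mono)
    then show ?thesis
      unfolding E_def using D_scale[OF sv(1), of "\<bar>t\<bar>"] by blast
  qed
  have E_sub: "subspace E"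
    unfolding subspace_def using E_add E_scale D_zero
    by (auto simp: E_def plus_fun_def scaleR_fun_def zero_fun_def intro!: exI[of _ "\<lambda>_. 0"] exI[of _ 0])
  have D_in_E: "s \<in> E" if "(s, v) \<in> D" for s v
    using D_abs[OF that] unfolding E_def by blast
  define P where "P f = {v. \<exists>s. (s, v) \<in> D \<and> (\<forall>z. f z \<le> s z)}" for f
  define p where "p f = Inf (P f)" for f
  have P_ne: "P f \<noteq> {}" if "f \<in> E" for f
    using that abs_le_D1 unfolding P_def E_def by blast
  have P_bdd: "bdd_below (P f)" if f: "f \<in> E" for f
  proof -
    obtain s v where sv: "(s, v) \<in> D" "\<And>z. \<bar>f z\<bar> \<le> s z" using f unfolding E_def by blast
    have "- v \<le> v'" if "(s', v') \<in> D" "\<forall>z. f z \<le> s' z" for s' v'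
    proof -
      have "- s z \<le> s' z" for z
        using sv(2)[of z] that(2) by (smt (verit))
      then show ?thesis
        using D_mono[OF D_scale[OF sv(1), of "-1"] that(1)] by simp
    qed
    then show ?thesis
      unfolding P_def by (intro bdd_belowI[of _ "- v"]) auto
  qed
  have p_le: "p f \<le> v" if "f \<in> E" "(s, v) \<in> D" "\<And>z. f z \<le> s z" for f s v
    unfolding p_def using P_bdd[OF that(1)] that by (intro cInf_lower) (auto simp: P_def)
  have p_ge: "r \<le> p f" if "f \<in> E" "\<And>s v. (s, v) \<in> D \<Longrightarrow> (\<And>z. f z \<le> s z) \<Longrightarrow> r \<le> v" for f r
    unfolding p_def using P_ne[OF that(1)] that(2) by (intro cInf_greatest) (auto simp: P_def)
  have p_add: "p (\<lambda>z. f z + g z) \<le> p f + p g" if fg: "f \<in> E" "g \<in> E" for f g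
  proof -
    have *: "p (\<lambda>z. f z + g z) \<le> v + v'"
      if "(s, v) \<in> D" "\<And>z. f z \<le> s z" "(s', v') \<in> D" "\<And>z. g z \<le> s' z" for s v s' v'
      using that by (intro p_le[OF E_add[OF fg] D_add[of s v s' v']]) (auto intro: add_mono)
    have "p (\<lambda>z. f z + g z) - v' \<le> p f" if "(s', v') \<in> D" "\<And>z. g z \<le> s' z" for s' v'
      using *[OF _ _ that] by (intro p_ge[OF fg(1)]) (simp add: algebra_simps)
    then have "p (\<lambda>z. f z + g z) - p f \<le> p g"
      by (intro p_ge[OF fg(2)]) (smt (verit))
    then show ?thesis by simp
  qed
  have p_scale_le: "p (\<lambda>z. t * f z) \<le> t * p f" if f: "f \<in> E" and t: "t > 0" for f t
  proof -
    have "p (\<lambda>z. t * f z) / t \<le> p f"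
    proof (rule p_ge[OF f])
      fix s v assume "(s, v) \<in> D" "\<And>z. f z \<le> s z"
      then have "p (\<lambda>z. t * f z) \<le> t * v"
        using t by (intro p_le[OF E_scale[OF f] D_scale]) auto
      then show "p (\<lambda>z. t * f z) / t \<le> v" using t by (simp add: field_simps)
    qed
    then show ?thesis using t by (simp add: field_simps)
  qed
  have p_zero: "p (\<lambda>_. 0) = 0"
  proof (rule antisym)
    show "p (\<lambda>_. 0) \<le> 0"
      by (rule p_le[OF D_in_E[OF D_zero] D_zero]) simp
    show "0 \<le> p (\<lambda>_. 0)"
      using D_mono[OF D_zero] by (intro p_ge[OF D_in_E[OF D_zero]]) auto
  qed
  have p_scale: "p (\<lambda>z. t * f z) = t * p f" if f: "f \<in> E" and t: "t \<ge> 0" for f t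
  proof (cases "t = 0")
    case True
    then show ?thesis using p_zero by simp
  next
    case False
    with t have t: "t > 0" by simp
    have "p (\<lambda>z. (1 / t) * (t * f z)) \<le> (1 / t) * p (\<lambda>z. t * f z)"
      using t by (intro p_scale_le E_scale f) auto
    then have "t * p f \<le> p (\<lambda>z. t * f z)"
      using t by (simp add: field_simps)
    with p_scale_le[OF f t] show ?thesis by simp
  qed
  have p_subl: "sublinear_on E p"
    unfolding sublinear_on_def using p_add p_scale by (simp add: plus_fun_def scaleR_fun_def)
  have nf0: "- f0 \<in> E"
    using E_sub f0 by (simp add: subspace_neg)
  obtain L where L_add: "\<And>x y. x \<in> E \<Longrightarrow> y \<in> E \<Longrightarrow> L (x + y) = L x + L y"
    and L_scale: "\<And>x t. x \<in> E \<Longrightarrow> L (t *\<^sub>R x) = t * L x"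
    and L_le: "\<And>x. x \<in> E \<Longrightarrow> L x \<le> p x" and L_f0: "L (- f0) = p (- f0)"
    using hahn_banach_sublinear[OF E_sub p_subl nf0] by blast
  have L_neg: "L (- x) = - L x" if "x \<in> E" for x
    using L_scale[OF that, of "-1"] by simp
  have L_D: "L s = v" if sv: "(s, v) \<in> D" for s v
  proof (rule antisym)
    show "L s \<le> v"
      using L_le[OF D_in_E[OF sv]] p_le[OF D_in_E[OF sv] sv] by simp
    have sv': "(- s, - v) \<in> D"
      using D_scale[OF sv, of "-1"] by (simp add: fun_Compl_def)
    then have "L (- s) \<le> - v"
      using L_le[OF D_in_E[OF sv']] p_le[OF D_in_E[OF sv'] sv'] by simp
    then show "v \<le> L s"
      using L_neg[OF D_in_E[OF sv]] by simp
  qed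
  have "positive_functional E L"
  proof
    show "f \<in> E" if g: "g \<in> E" and fg: "\<And>z. \<bar>f z\<bar> \<le> g z" for f g
    proof -
      obtain s v where sv: "(s, v) \<in> D" "\<And>z. \<bar>g z\<bar> \<le> s z" using g unfolding E_def by blast
      then have "\<bar>f z\<bar> \<le> s z" for z
        using fg[of z] sv(2)[of z] by linarith
      then show ?thesis using sv(1) unfolding E_def by blast
    qed
    show "L f \<le> L g" if fg: "f \<in> E" "g \<in> E" "\<And>z. f z \<le> g z" for f g
    proof -
      have "f - g \<in> E" using fg E_sub by (simp add: subspace_diff)
      then have "L (f - g) \<le> 0"
        using L_le[of "f - g"] p_le[OF _ D_zero, of "f - g"] fg(3) by (simp add: order_trans)
      moreover have "L (f + - g) = L f + L (- g)"
        using fg E_sub by (intro L_add) (auto simp: subspace_neg)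
      ultimately show ?thesis
        using L_neg[OF fg(2)] by simp
    qed
  qed (use E_add E_scale D_in_E[OF D_one] L_add L_scale L_D[OF D_one] in
      \<open>auto simp: plus_fun_def scaleR_fun_def\<close>)
  moreover have "L f0 \<le> r" if r: "\<And>s v. (s, v) \<in> D \<Longrightarrow> (\<And>z. s z \<le> f0 z) \<Longrightarrow> v \<le> r" for r
  proof -
    have "- r \<le> p (- f0)"
    proof (rule p_ge[OF nf0])
      fix s v assume sv: "(s, v) \<in> D" "\<And>z. (- f0) z \<le> s z"
      have "- s z \<le> f0 z" for z
        using sv(2)[of z] by simp
      then show "- r \<le> v"
        using r[OF D_scale[OF sv(1), of "-1"]] by simp
    qed
    then show ?thesis
      using L_f0 L_neg[OF f0] by simp
  qed
  ultimately show thesis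
    using that L_D D_in_E by blast
qed

section \<open>Semicontinuity and small intervals\<close>

lemma open_lower_semicontinuous:
  assumes "lower_semicontinuous f"
  shows "open {z. a < f z}"
proof (subst open_subopen, intro ballI)
  fix x assume "x \<in> {z. a < f z}"
  then have "\<forall>\<^sub>F z in nhds x. a < f z"
    using assms unfolding lower_semicontinuous_def by auto
  then show "\<exists>T. open T \<and> x \<in> T \<and> T \<subseteq> {z. a < f z}"
    unfolding eventually_nhds by auto
qed

lemma borel_measurable_lower_semicontinuous:
  assumes "lower_semicontinuous f"
  shows "f \<in> borel_measurable borel"
  using open_lower_semicontinuous[OF assms] by (auto simp: borel_measurable_iff_greater)

lemma lower_semicontinuous_add_continuous:
  fixes f g :: "'a::topological_space \<Rightarrow> real"
  assumes f: "lower_semicontinuous f" and g: "continuous_on UNIV g"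
  shows "lower_semicontinuous (\<lambda>z. f z + g z)"
  unfolding lower_semicontinuous_def
proof (intro allI impI)
  fix x a assume a: "a < f x + g x"
  define d where "d = (f x + g x - a) / 2"
  have "d > 0" using a by (simp add: d_def)
  then have "\<forall>\<^sub>F z in nhds x. f x - d < f z"
    using f unfolding lower_semicontinuous_def by simp
  moreover have "open {z. g x - d < g z}"
    by (intro open_Collect_less g continuous_on_const)
  then have "\<forall>\<^sub>F z in nhds x. g x - d < g z"
    using eventually_nhds_in_open[of "{z. g x - d < g z}" x] \<open>d > 0\<close> by simp
  ultimately show "\<forall>\<^sub>F z in nhds x. a < f z + g z"
    by eventually_elim (simp add: d_def field_simps)
qed

lemma lower_semicontinuous_continuous:
  fixes g :: "'a::topological_space \<Rightarrow> real"
  assumes "continuous_on UNIV g"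
  shows "lower_semicontinuous g"
  using lower_semicontinuous_add_continuous[of "\<lambda>_. 0" g] assms
  by (simp add: lower_semicontinuous_def)

text \<open>The open intervals with right end \<open>t\<close> shrink to the empty set, because
  \<open>t\<close> itself is left out even if it carries an atom.\<close>

lemma (in real_distribution) measure_small_left_interval:
  fixes t e :: real
  assumes "e > 0"
  shows "\<exists>s<t. measure M {s<..<t} < e"
proof -
  define A where "A n = {t - 1 / real (Suc n)<..<t}" for n
  have "(\<lambda>n. measure M (A n)) \<longlonglongrightarrow> measure M (\<Inter>n. A n)"
  proof (rule finite_Lim_measure_decseq)
    show "decseq A"
    proof (rule decseq_SucI)
      fix n
      have "1 / real (Suc (Suc n)) \<le> 1 / real (Suc n)" by (simp add: frac_le)
      then show "A (Suc n) \<subseteq> A n" unfolding A_def by (intro greaterThanLessThan_subseteq_greaterThanLessThan[THEN iffD2]) auto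
    qed
  qed (auto simp: A_def)
  moreover have "(\<Inter>n. A n) = {}"
  proof -
    have "\<exists>n. x \<notin> A n" for x
    proof (cases "x < t")
      case True
      then obtain n where "1 / real (Suc n) < t - x"
        using nat_approx_posE[of "t - x"] by auto
      then show ?thesis by (intro exI[of _ n]) (auto simp: A_def)
    qed (auto simp: A_def)
    then show ?thesis by auto
  qed
  ultimately have "(\<lambda>n. measure M (A n)) \<longlonglongrightarrow> 0" by simp
  then have "\<forall>\<^sub>F n in sequentially. measure M (A n) < e"
    using assms by (rule order_tendstoD)
  then obtain n where "measure M (A n) < e"
    by (auto simp: eventually_sequentially)
  then show ?thesis
    unfolding A_def by (intro exI[of _ "t - 1 / real (Suc n)"]) auto
qed

lemma (in real_distribution) measure_small_right_interval:
  fixes t e :: real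
  assumes "e > 0"
  shows "\<exists>s>t. measure M {t<..<s} < e"
proof -
  define A where "A n = {t<..<t + 1 / real (Suc n)}" for n
  have "(\<lambda>n. measure M (A n)) \<longlonglongrightarrow> measure M (\<Inter>n. A n)"
  proof (rule finite_Lim_measure_decseq)
    show "decseq A"
    proof (rule decseq_SucI)
      fix n
      have "1 / real (Suc (Suc n)) \<le> 1 / real (Suc n)" by (simp add: frac_le)
      then show "A (Suc n) \<subseteq> A n" unfolding A_def by (intro greaterThanLessThan_subseteq_greaterThanLessThan[THEN iffD2]) auto
    qed
  qed (auto simp: A_def)
  moreover have "(\<Inter>n. A n) = {}"
  proof -
    have "\<exists>n. x \<notin> A n" for x
    proof (cases "t < x")
      case True
      then obtain n where "1 / real (Suc n) < x - t"
        using nat_approx_posE[of "x - t"] by auto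
      then show ?thesis by (intro exI[of _ n]) (auto simp: A_def)
    qed (auto simp: A_def)
    then show ?thesis by auto
  qed
  ultimately have "(\<lambda>n. measure M (A n)) \<longlonglongrightarrow> 0" by simp
  then have "\<forall>\<^sub>F n in sequentially. measure M (A n) < e"
    using assms by (rule order_tendstoD)
  then obtain n where "measure M (A n) < e"
    by (auto simp: eventually_sequentially)
  then show ?thesis
    unfolding A_def by (intro exI[of _ "t + 1 / real (Suc n)"]) auto
qed

section \<open>Martingale transports and dual functions\<close>

definition dual_sum ::
  "('d::finite \<Rightarrow> real \<Rightarrow> real) \<Rightarrow> ('d \<Rightarrow> real \<Rightarrow> real) \<Rightarrow> ('d \<Rightarrow> real ^ 'd \<Rightarrow> real) \<Rightarrow>
   (real ^ 'd) \<times> (real ^ 'd) \<Rightarrow> real" where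
  "dual_sum \<phi> \<psi> h z =
     (\<Sum>i\<in>UNIV. \<phi> i (fst z $ i) + \<psi> i (snd z $ i) + h i (fst z) * (snd z $ i - fst z $ i))"

locale marginals =
  fixes \<mu> \<nu> :: "'d::finite \<Rightarrow> real measure"
  assumes \<mu>: "\<And>i. real_distribution (\<mu> i)" and \<nu>: "\<And>i. real_distribution (\<nu> i)"
    and \<mu>_moment: "\<And>i. finite_first_moment (\<mu> i)" and \<nu>_moment: "\<And>i. finite_first_moment (\<nu> i)"
begin

text \<open>Boundedness of \<open>h\<close> makes the martingale term integrable under every measure
  with the given marginals, by their first moments.\<close>

definition admissible ::
  "('d \<Rightarrow> real \<Rightarrow> real) \<Rightarrow> ('d \<Rightarrow> real \<Rightarrow> real) \<Rightarrow> ('d \<Rightarrow> real ^ 'd \<Rightarrow> real) \<Rightarrow> bool" where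
  "admissible \<phi> \<psi> h \<longleftrightarrow> (\<forall>i. integrable (\<mu> i) (\<phi> i) \<and> integrable (\<nu> i) (\<psi> i)
     \<and> h i \<in> borel_measurable borel \<and> (\<exists>B. \<forall>x. \<bar>h i x\<bar> \<le> B))"

definition dual_value :: "('d \<Rightarrow> real \<Rightarrow> real) \<Rightarrow> ('d \<Rightarrow> real \<Rightarrow> real) \<Rightarrow> real" where
  "dual_value \<phi> \<psi> = (\<Sum>i\<in>UNIV. integral\<^sup>L (\<mu> i) (\<phi> i) + integral\<^sup>L (\<nu> i) (\<psi> i))"

text \<open>A relation and not a function, because different triples can give the same function:
  affine terms can be moved between \<phi>, \<psi> and \<open>h\<close>. That the value depends on
  the function alone is seen by integrating against some martingale transport.\<close>

definition dual_pairs :: "(((real ^ 'd) \<times> (real ^ 'd) \<Rightarrow> real) \<times> real) set" where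
  "dual_pairs = {(dual_sum \<phi> \<psi> h, dual_value \<phi> \<psi>) | \<phi> \<psi> h. admissible \<phi> \<psi> h}"

lemma sets_\<mu>[measurable_cong]: "sets (\<mu> i) = sets borel" and sets_\<nu>[measurable_cong]: "sets (\<nu> i) = sets borel"
  using real_distribution.events_eq_borel[OF \<mu>] real_distribution.events_eq_borel[OF \<nu>] by auto

lemma prob_\<mu>: "prob_space (\<mu> i)" and prob_\<nu>: "prob_space (\<nu> i)"
  using \<mu>[of i] \<nu>[of i] unfolding real_distribution_def by auto

lemma integrable_id: "integrable (\<mu> i) (\<lambda>x. x)" "integrable (\<nu> i) (\<lambda>x. x)"
  using \<mu>_moment \<nu>_moment unfolding finite_first_moment_def by auto

lemma integrable_const: "integrable (\<mu> i) (\<lambda>_. a::real)" "integrable (\<nu> i) (\<lambda>_. a::real)"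
proof -
  interpret m: prob_space "\<mu> i" by (rule prob_\<mu>)
  interpret n: prob_space "\<nu> i" by (rule prob_\<nu>)
  show "integrable (\<mu> i) (\<lambda>_. a::real)" "integrable (\<nu> i) (\<lambda>_. a::real)" by auto
qed

lemma integral_const: "integral\<^sup>L (\<mu> i) (\<lambda>_. a::real) = a" "integral\<^sup>L (\<nu> i) (\<lambda>_. a::real) = a"
proof -
  interpret m: prob_space "\<mu> i" by (rule prob_\<mu>)
  interpret n: prob_space "\<nu> i" by (rule prob_\<nu>)
  show "integral\<^sup>L (\<mu> i) (\<lambda>_. a::real) = a" "integral\<^sup>L (\<nu> i) (\<lambda>_. a::real) = a"
    using m.prob_space n.prob_space by auto
qed

lemma measurable_coord [measurable]:
  "(\<lambda>z::(real ^ 'd) \<times> (real ^ 'd). fst z $ i) \<in> borel_measurable borel"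
  "(\<lambda>z::(real ^ 'd) \<times> (real ^ 'd). snd z $ i) \<in> borel_measurable borel"
  "(fst :: (real ^ 'd) \<times> (real ^ 'd) \<Rightarrow> _) \<in> borel_measurable borel"
  by (intro borel_measurable_continuous_onI continuous_intros)+

context
  fixes \<pi> :: "((real ^ 'd) \<times> (real ^ 'd)) measure"
  assumes \<pi>_sets [measurable_cong]: "sets \<pi> = sets borel"
    and \<pi>_fst: "\<And>i. distr \<pi> borel (\<lambda>z. fst z $ i) = \<mu> i"
    and \<pi>_snd: "\<And>i. distr \<pi> borel (\<lambda>z. snd z $ i) = \<nu> i"
begin

lemma marginal_integral_fst:
  fixes f :: "real \<Rightarrow> real"
  assumes f: "f \<in> borel_measurable borel"
  shows "integrable \<pi> (\<lambda>z. f (fst z $ i)) \<longleftrightarrow> integrable (\<mu> i) f"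
    and "(\<integral>z. f (fst z $ i) \<partial>\<pi>) = (\<integral>x. f x \<partial>\<mu> i)"
proof -
  have m: "(\<lambda>z. fst z $ i) \<in> measurable \<pi> borel" by measurable
  show "integrable \<pi> (\<lambda>z. f (fst z $ i)) \<longleftrightarrow> integrable (\<mu> i) f"
    using integrable_distr_eq[OF m f] \<pi>_fst by simp
  show "(\<integral>z. f (fst z $ i) \<partial>\<pi>) = (\<integral>x. f x \<partial>\<mu> i)"
    using integral_distr[OF m f] \<pi>_fst by simp
qed

lemma marginal_integral_snd:
  fixes f :: "real \<Rightarrow> real"
  assumes f: "f \<in> borel_measurable borel"
  shows "integrable \<pi> (\<lambda>z. f (snd z $ i)) \<longleftrightarrow> integrable (\<nu> i) f"
    and "(\<integral>z. f (snd z $ i) \<partial>\<pi>) = (\<integral>x. f x \<partial>\<nu> i)"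
proof -
  have m: "(\<lambda>z. snd z $ i) \<in> measurable \<pi> borel" by measurable
  show "integrable \<pi> (\<lambda>z. f (snd z $ i)) \<longleftrightarrow> integrable (\<nu> i) f"
    using integrable_distr_eq[OF m f] \<pi>_snd by simp
  show "(\<integral>z. f (snd z $ i) \<partial>\<pi>) = (\<integral>x. f x \<partial>\<nu> i)"
    using integral_distr[OF m f] \<pi>_snd by simp
qed

lemma integrable_increment: "integrable \<pi> (\<lambda>z. snd z $ i - fst z $ i)"
proof (rule Bochner_Integration.integrable_diff)
  show "integrable \<pi> (\<lambda>z. snd z $ i)"
    by (rule iffD2[OF marginal_integral_snd(1) integrable_id(2)]) measurable
  show "integrable \<pi> (\<lambda>z. fst z $ i)"
    by (rule iffD2[OF marginal_integral_fst(1) integrable_id(1)]) measurable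
qed

lemma integrable_bounded_increment:
  assumes [measurable]: "h \<in> borel_measurable borel" and h: "\<And>x. \<bar>h x\<bar> \<le> B"
  shows "integrable \<pi> (\<lambda>z. h (fst z) * (snd z $ i - fst z $ i))"
proof (rule Bochner_Integration.integrable_bound)
  show "integrable \<pi> (\<lambda>z. B * (snd z $ i - fst z $ i))"
    using integrable_increment by simp
  show "AE z in \<pi>. norm (h (fst z) * (snd z $ i - fst z $ i)) \<le> norm (B * (snd z $ i - fst z $ i))"
    using h by (intro AE_I2) (auto simp: abs_mult intro!: mult_right_mono order_trans[OF h abs_ge_self])
qed measurable

end

lemma VMT_D:
  assumes "\<pi> \<in> VMT \<mu> \<nu>"
  shows "prob_space \<pi>" "sets \<pi> = sets borel"
    "\<And>i. distr \<pi> borel (\<lambda>z. fst z $ i) = \<mu> i" "\<And>i. distr \<pi> borel (\<lambda>z. snd z $ i) = \<nu> i"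
    "\<And>i. AE z in \<pi>. real_cond_exp \<pi> (vimage_algebra (space \<pi>) fst borel) (\<lambda>z. snd z $ i) z = fst z $ i"
  using assms unfolding VMT_def by auto

text \<open>The factor \<open>h (fst z)\<close> is measurable for the sigma-algebra generated by
  \<open>fst\<close> and can be taken into the conditional expectation.\<close>

lemma VMT_martingale:
  assumes \<pi>: "\<pi> \<in> VMT \<mu> \<nu>" and [measurable]: "h \<in> borel_measurable borel" and h: "\<And>x. \<bar>h x\<bar> \<le> B"
  shows "(\<integral>z. h (fst z) * (snd z $ i - fst z $ i) \<partial>\<pi>) = 0"
proof -
  note [measurable_cong] = VMT_D(2)[OF \<pi>]
  interpret prob_space \<pi> by (rule VMT_D(1)[OF \<pi>])
  define F where "F = vimage_algebra (space \<pi>) (fst :: (real ^ 'd) \<times> (real ^ 'd) \<Rightarrow> _) borel"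
  have fst_F [measurable]: "(fst :: (real ^ 'd) \<times> (real ^ 'd) \<Rightarrow> _) \<in> measurable F borel"
    unfolding F_def by (rule measurable_vimage_algebra1) auto
  have "fst \<in> measurable \<pi> (borel :: (real ^ 'd) measure)" by measurable
  then have sub: "subalgebra \<pi> F"
    unfolding subalgebra_def F_def by (auto simp: sets_vimage_algebra2 intro!: measurable_sets)
  interpret finite_measure_subalgebra \<pi> F
    by standard (rule sub)
  have int_h: "integrable \<pi> (\<lambda>z. h (fst z) * f z)" if "integrable \<pi> f" for f :: "_ \<Rightarrow> real"
  proof (rule Bochner_Integration.integrable_bound)
    show "integrable \<pi> (\<lambda>z. B * f z)" using that by simp
    have [measurable]: "f \<in> borel_measurable \<pi>" using that by auto
    show "(\<lambda>z. h (fst z) * f z) \<in> borel_measurable \<pi>" by measurable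
    show "AE z in \<pi>. norm (h (fst z) * f z) \<le> norm (B * f z)"
      by (intro AE_I2) (auto simp: abs_mult intro!: mult_right_mono order_trans[OF h abs_ge_self])
  qed
  have ify: "integrable \<pi> (\<lambda>z. fst z $ i)" "integrable \<pi> (\<lambda>z. snd z $ i)"
    by (rule iffD2[OF marginal_integral_fst(1)[OF VMT_D(2-4)[OF \<pi>]] integrable_id(1)], measurable)
      (rule iffD2[OF marginal_integral_snd(1)[OF VMT_D(2-4)[OF \<pi>]] integrable_id(2)], measurable)
  have "(\<integral>z. h (fst z) * (snd z $ i) \<partial>\<pi>) = (\<integral>z. h (fst z) * real_cond_exp \<pi> F (\<lambda>z. snd z $ i) z \<partial>\<pi>)"
    by (rule real_cond_exp_intg(2)[symmetric]) (use int_h[OF ify(2)] in \<open>auto intro: measurable_compose[OF fst_F]\<close>)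
  also have "\<dots> = (\<integral>z. h (fst z) * (fst z $ i) \<partial>\<pi>)"
  proof (rule integral_cong_AE)
    show "AE z in \<pi>. h (fst z) * real_cond_exp \<pi> F (\<lambda>z. snd z $ i) z = h (fst z) * (fst z $ i)"
      using VMT_D(5)[OF \<pi>, of i] unfolding F_def by auto
  qed measurable
  finally show ?thesis
    using int_h[OF ify(1)] int_h[OF ify(2)] by (simp add: right_diff_distrib)
qed

text \<open>Weak duality in the form of an equality: the expectation of a dual sum is the same for
  all martingale transports.\<close>

lemma VMT_integral_dual_sum:
  assumes \<pi>: "\<pi> \<in> VMT \<mu> \<nu>" and adm: "admissible \<phi> \<psi> h"
  shows "integrable \<pi> (dual_sum \<phi> \<psi> h)" and "integral\<^sup>L \<pi> (dual_sum \<phi> \<psi> h) = dual_value \<phi> \<psi>"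
proof -
  note m = VMT_D(2-4)[OF \<pi>]
  have \<phi>: "integrable \<pi> (\<lambda>z. \<phi> i (fst z $ i))" "(\<integral>z. \<phi> i (fst z $ i) \<partial>\<pi>) = integral\<^sup>L (\<mu> i) (\<phi> i)" for i
  proof -
    have *: "integrable (\<mu> i) (\<phi> i)" using adm unfolding admissible_def by auto
    then have "\<phi> i \<in> borel_measurable (\<mu> i)" by auto
    then have "\<phi> i \<in> borel_measurable borel" by measurable
    then show "integrable \<pi> (\<lambda>z. \<phi> i (fst z $ i))" "(\<integral>z. \<phi> i (fst z $ i) \<partial>\<pi>) = integral\<^sup>L (\<mu> i) (\<phi> i)"
      using marginal_integral_fst[OF m] * by auto
  qed
  have \<psi>: "integrable \<pi> (\<lambda>z. \<psi> i (snd z $ i))" "(\<integral>z. \<psi> i (snd z $ i) \<partial>\<pi>) = integral\<^sup>L (\<nu> i) (\<psi> i)" for i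
  proof -
    have *: "integrable (\<nu> i) (\<psi> i)" using adm unfolding admissible_def by auto
    then have "\<psi> i \<in> borel_measurable (\<nu> i)" by auto
    then have "\<psi> i \<in> borel_measurable borel" by measurable
    then show "integrable \<pi> (\<lambda>z. \<psi> i (snd z $ i))" "(\<integral>z. \<psi> i (snd z $ i) \<partial>\<pi>) = integral\<^sup>L (\<nu> i) (\<psi> i)"
      using marginal_integral_snd[OF m] * by auto
  qed
  have h: "integrable \<pi> (\<lambda>z. h i (fst z) * (snd z $ i - fst z $ i))"
    "(\<integral>z. h i (fst z) * (snd z $ i - fst z $ i) \<partial>\<pi>) = 0" for i
  proof -
    obtain B where B: "\<And>x. \<bar>h i x\<bar> \<le> B" and hm: "h i \<in> borel_measurable borel"
      using adm unfolding admissible_def by blast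
    show "integrable \<pi> (\<lambda>z. h i (fst z) * (snd z $ i - fst z $ i))"
      by (rule integrable_bounded_increment[OF m hm B])
    show "(\<integral>z. h i (fst z) * (snd z $ i - fst z $ i) \<partial>\<pi>) = 0"
      by (rule VMT_martingale[OF \<pi> hm B])
  qed
  have eq: "dual_sum \<phi> \<psi> h = (\<lambda>z. \<Sum>i\<in>UNIV. (\<phi> i (fst z $ i) + \<psi> i (snd z $ i))
      + h i (fst z) * (snd z $ i - fst z $ i))"
    by (simp add: dual_sum_def fun_eq_iff)
  show "integrable \<pi> (dual_sum \<phi> \<psi> h)"
    unfolding eq using \<phi> \<psi> h by (intro Bochner_Integration.integrable_sum Bochner_Integration.integrable_add) auto
  show "integral\<^sup>L \<pi> (dual_sum \<phi> \<psi> h) = dual_value \<phi> \<psi>"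
    unfolding eq dual_value_def
    by (subst Bochner_Integration.integral_sum)
      (use \<phi> \<psi> h in \<open>auto intro!: sum.cong simp del: right_diff_distrib\<close>)
qed

end

section \<open>Strong duality\<close>

lemma Basis_pair_cart_cases:
  fixes b :: "(real ^ 'd::finite) \<times> (real ^ 'd)"
  assumes "b \<in> Basis"
  obtains i where "\<And>z. z \<bullet> b = fst z $ i" | i where "\<And>z. z \<bullet> b = snd z $ i"
proof -
  have "(\<exists>i. b = (axis i 1, 0)) \<or> (\<exists>i. b = (0, axis i 1))"
    using assms by (auto simp: Basis_prod_def Basis_vec_def)
  then show thesis
  proof (elim disjE exE)
    fix i assume "b = (axis i 1, 0)"
    then have "z \<bullet> b = fst z $ i" for z by (simp add: inner_prod_def inner_axis)
    then show thesis by (rule that(1))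
  next
    fix i assume "b = (0, axis i 1)"
    then have "z \<bullet> b = snd z $ i" for z by (simp add: inner_prod_def inner_axis)
    then show thesis by (rule that(2))
  qed
qed

text \<open>Open right half-lines are used because \<open>representing_measure\<close> reproduces
  the charge of exactly these half-spaces.\<close>

lemma real_distribution_eqI:
  assumes M: "real_distribution M" and N: "real_distribution N"
    and eq: "\<And>t. measure M {t<..} = measure N {t<..}"
  shows "M = N"
proof (rule cdf_unique[OF M N])
  interpret M: real_distribution M by fact
  interpret N: real_distribution N by fact
  have "measure M {..t} = 1 - measure M {t<..}" "measure N {..t} = 1 - measure N {t<..}" for t
    using M.prob_compl[of "{t<..}"] N.prob_compl[of "{t<..}"] by (simp_all add: Compl_greaterThan flip: Compl_eq_Diff_UNIV)
  then show "cdf M = cdf N"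
    using eq by (auto simp: cdf_def fun_eq_iff)
qed

section \<open>Linear structure of the dual pairs and the transport that represents a
  functional\<close>

context marginals
begin

lemma dual_pairsI:
  assumes "admissible \<phi> \<psi> h" "\<And>z. s z = dual_sum \<phi> \<psi> h z" "v = dual_value \<phi> \<psi>"
  shows "(s, v) \<in> dual_pairs"
proof -
  have "s = dual_sum \<phi> \<psi> h" using assms(2) by auto
  then show ?thesis using assms unfolding dual_pairs_def by auto
qed

lemma admissibleD:
  assumes "admissible \<phi> \<psi> h"
  shows "integrable (\<mu> i) (\<phi> i)" "integrable (\<nu> i) (\<psi> i)" "h i \<in> borel_measurable borel"
    "\<exists>B. \<forall>x. \<bar>h i x\<bar> \<le> B"
  using assms unfolding admissible_def by auto

lemma admissibleI:
  assumes "\<And>i. integrable (\<mu> i) (\<phi> i)" "\<And>i. integrable (\<nu> i) (\<psi> i)"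
    "\<And>i. h i \<in> borel_measurable borel" "\<And>i. \<exists>B. \<forall>x. \<bar>h i x\<bar> \<le> B"
  shows "admissible \<phi> \<psi> h"
  using assms unfolding admissible_def by auto

lemma admissible_add:
  assumes a: "admissible \<phi> \<psi> h" and b: "admissible \<phi>' \<psi>' h'"
  shows "admissible (\<lambda>i x. \<phi> i x + \<phi>' i x) (\<lambda>i x. \<psi> i x + \<psi>' i x) (\<lambda>i x. h i x + h' i x)"
    and "dual_value (\<lambda>i x. \<phi> i x + \<phi>' i x) (\<lambda>i x. \<psi> i x + \<psi>' i x) = dual_value \<phi> \<psi> + dual_value \<phi>' \<psi>'"
proof -
  show "admissible (\<lambda>i x. \<phi> i x + \<phi>' i x) (\<lambda>i x. \<psi> i x + \<psi>' i x) (\<lambda>i x. h i x + h' i x)"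
  proof (rule admissibleI)
    fix i
    obtain B B' where "\<And>x. \<bar>h i x\<bar> \<le> B" "\<And>x. \<bar>h' i x\<bar> \<le> B'"
      using admissibleD(4)[OF a, of i] admissibleD(4)[OF b, of i] by blast
    then have "\<bar>h i x + h' i x\<bar> \<le> B + B'" for x
      using abs_triangle_ineq[of "h i x" "h' i x"] add_mono[of "\<bar>h i x\<bar>" B "\<bar>h' i x\<bar>" B']
      by (meson order_trans)
    then show "\<exists>B. \<forall>x. \<bar>h i x + h' i x\<bar> \<le> B" by blast
  qed (use admissibleD[OF a] admissibleD[OF b] in auto)
  show "dual_value (\<lambda>i x. \<phi> i x + \<phi>' i x) (\<lambda>i x. \<psi> i x + \<psi>' i x) = dual_value \<phi> \<psi> + dual_value \<phi>' \<psi>'"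
    unfolding dual_value_def using admissibleD[OF a] admissibleD[OF b]
    by (simp add: sum.distrib algebra_simps)
qed

lemma dual_sum_add:
  "dual_sum (\<lambda>i x. \<phi> i x + \<phi>' i x) (\<lambda>i x. \<psi> i x + \<psi>' i x) (\<lambda>i x. h i x + h' i x) z
    = dual_sum \<phi> \<psi> h z + dual_sum \<phi>' \<psi>' h' z"
  unfolding dual_sum_def sum.distrib[symmetric] by (intro sum.cong) (auto simp: algebra_simps)

lemma admissible_scale:
  assumes a: "admissible \<phi> \<psi> h"
  shows "admissible (\<lambda>i x. t * \<phi> i x) (\<lambda>i x. t * \<psi> i x) (\<lambda>i x. t * h i x)"
    and "dual_value (\<lambda>i x. t * \<phi> i x) (\<lambda>i x. t * \<psi> i x) = t * dual_value \<phi> \<psi>"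
proof -
  show "admissible (\<lambda>i x. t * \<phi> i x) (\<lambda>i x. t * \<psi> i x) (\<lambda>i x. t * h i x)"
  proof (rule admissibleI)
    fix i
    obtain B where "\<And>x. \<bar>h i x\<bar> \<le> B"
      using admissibleD(4)[OF a, of i] by blast
    then have "\<bar>t * h i x\<bar> \<le> \<bar>t\<bar> * B" for x
      by (simp add: abs_mult mult_left_mono)
    then show "\<exists>B. \<forall>x. \<bar>t * h i x\<bar> \<le> B" by blast
  qed (use admissibleD[OF a] in auto)
  show "dual_value (\<lambda>i x. t * \<phi> i x) (\<lambda>i x. t * \<psi> i x) = t * dual_value \<phi> \<psi>"
    unfolding dual_value_def by (simp add: sum_distrib_left algebra_simps)
qed

lemma dual_sum_scale:
  "dual_sum (\<lambda>i x. t * \<phi> i x) (\<lambda>i x. t * \<psi> i x) (\<lambda>i x. t * h i x) z = t * dual_sum \<phi> \<psi> h z"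
  unfolding dual_sum_def by (simp add: sum_distrib_left algebra_simps)

lemma dual_pairs_add:
  assumes "(s, v) \<in> dual_pairs" "(s', v') \<in> dual_pairs"
  shows "(\<lambda>z. s z + s' z, v + v') \<in> dual_pairs"
proof -
  obtain \<phi> \<psi> h where a: "admissible \<phi> \<psi> h" "s = dual_sum \<phi> \<psi> h" "v = dual_value \<phi> \<psi>"
    using assms(1) unfolding dual_pairs_def by blast
  obtain \<phi>' \<psi>' h' where b: "admissible \<phi>' \<psi>' h'" "s' = dual_sum \<phi>' \<psi>' h'" "v' = dual_value \<phi>' \<psi>'"
    using assms(2) unfolding dual_pairs_def by blast
  show ?thesis
    by (rule dual_pairsI[OF admissible_add(1)[OF a(1) b(1)]])
      (simp_all add: dual_sum_add admissible_add(2)[OF a(1) b(1)] a b)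
qed

lemma dual_pairs_scale:
  assumes "(s, v) \<in> dual_pairs"
  shows "(\<lambda>z. t * s z, t * v) \<in> dual_pairs"
proof -
  obtain \<phi> \<psi> h where a: "admissible \<phi> \<psi> h" "s = dual_sum \<phi> \<psi> h" "v = dual_value \<phi> \<psi>"
    using assms unfolding dual_pairs_def by blast
  show ?thesis
    by (rule dual_pairsI[OF admissible_scale(1)[OF a(1), of t]])
      (simp_all add: dual_sum_scale admissible_scale(2)[OF a(1)] a)
qed

lemma dual_pairs_fst:
  assumes f: "integrable (\<mu> i) f"
  shows "(\<lambda>z. f (fst z $ i), integral\<^sup>L (\<mu> i) f) \<in> dual_pairs"
proof (rule dual_pairsI[of "\<lambda>j x. if j = i then f x else 0" "\<lambda>_ _. 0" "\<lambda>_ _. 0"])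
  show "admissible (\<lambda>j x. if j = i then f x else 0) (\<lambda>_ _. 0) (\<lambda>_ _. 0)"
  proof (rule admissibleI)
    fix j show "integrable (\<mu> j) (\<lambda>x. if j = i then f x else 0)"
      using f by (cases "j = i") auto
  qed (auto intro: exI[of _ 0])
  have "integral\<^sup>L (\<mu> j) (\<lambda>x. if j = i then f x else 0) = (if j = i then integral\<^sup>L (\<mu> j) f else 0)" for j
    by simp
  then show "integral\<^sup>L (\<mu> i) f = dual_value (\<lambda>j x. if j = i then f x else 0) (\<lambda>_ _. 0)"
    by (simp add: dual_value_def)
qed (simp add: dual_sum_def)

lemma dual_pairs_snd:
  assumes f: "integrable (\<nu> i) f"
  shows "(\<lambda>z. f (snd z $ i), integral\<^sup>L (\<nu> i) f) \<in> dual_pairs"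
proof (rule dual_pairsI[of "\<lambda>_ _. 0" "\<lambda>j x. if j = i then f x else 0" "\<lambda>_ _. 0"])
  show "admissible (\<lambda>_ _. 0) (\<lambda>j x. if j = i then f x else 0) (\<lambda>_ _. 0)"
  proof (rule admissibleI)
    fix j show "integrable (\<nu> j) (\<lambda>x. if j = i then f x else 0)"
      using f by (cases "j = i") auto
  qed (auto intro: exI[of _ 0])
  have "integral\<^sup>L (\<nu> j) (\<lambda>x. if j = i then f x else 0) = (if j = i then integral\<^sup>L (\<nu> j) f else 0)" for j
    by simp
  then show "integral\<^sup>L (\<nu> i) f = dual_value (\<lambda>_ _. 0) (\<lambda>j x. if j = i then f x else 0)"
    by (simp add: dual_value_def)
qed (simp add: dual_sum_def)

lemma dual_pairs_increment:
  assumes g: "g \<in> borel_measurable borel" "\<And>x. \<bar>g x\<bar> \<le> B"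
  shows "(\<lambda>z. g (fst z) * (snd z $ i - fst z $ i), 0) \<in> dual_pairs"
proof (rule dual_pairsI[of "\<lambda>_ _. 0" "\<lambda>_ _. 0" "\<lambda>j x. if j = i then g x else 0"])
  show "admissible (\<lambda>_ _. 0) (\<lambda>_ _. 0) (\<lambda>j x. if j = i then g x else 0)"
  proof (rule admissibleI)
    fix j show "\<exists>B. \<forall>x. \<bar>if j = i then g x else 0\<bar> \<le> B"
      using g(2) by (cases "j = i") (auto intro: exI[of _ 0])
    show "(\<lambda>x. if j = i then g x else 0) \<in> borel_measurable borel"
      using g(1) by (cases "j = i") auto
  qed auto
qed (auto simp: dual_sum_def dual_value_def if_distrib[of "\<lambda>a. a * _"] cong: if_cong)

lemma dual_pairs_const: "(\<lambda>_. a, a) \<in> dual_pairs"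
proof -
  \<comment> \<open>Types are inhabited, so an index is available; the constant is charged to one
    marginal.\<close>
  fix i :: 'd
  show ?thesis
    using dual_pairs_fst[OF integrable_const(1), of a i] unfolding integral_const .
qed

text \<open>A bound \<open>B i\<close> on \<open>h i\<close> turns the martingale term into
  \<open>B i\<close> times the sum of the absolute values of both coordinates, which is separable
  and integrable by the first moments.\<close>

lemma dual_pairs_abs:
  assumes "(s, v) \<in> dual_pairs"
  shows "\<exists>s' v'. (s', v') \<in> dual_pairs \<and> (\<forall>z. \<bar>s z\<bar> \<le> s' z)"
proof -
  obtain \<phi> \<psi> h where a: "admissible \<phi> \<psi> h" "s = dual_sum \<phi> \<psi> h"
    using assms unfolding dual_pairs_def by blast
  have "\<forall>i. \<exists>B. \<forall>x. \<bar>h i x\<bar> \<le> B"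
    using admissibleD(4)[OF a(1)] by blast
  from choice[OF this] obtain B where B: "\<And>i x. \<bar>h i x\<bar> \<le> B i"
    by blast
  define \<phi>' \<psi>' where "\<phi>' i x = \<bar>\<phi> i x\<bar> + B i * \<bar>x\<bar>" and "\<psi>' i x = \<bar>\<psi> i x\<bar> + B i * \<bar>x\<bar>" for i x
  have "admissible \<phi>' \<psi>' (\<lambda>_ _. 0)"
  proof (rule admissibleI)
    fix i
    show "integrable (\<mu> i) (\<phi>' i)" "integrable (\<nu> i) (\<psi>' i)"
      unfolding \<phi>'_def \<psi>'_def
      by (intro Bochner_Integration.integrable_add integrable_mult_right integrable_abs
          admissibleD(1,2)[OF a(1)] integrable_id)+
    show "\<exists>B. \<forall>x::real ^ 'd. \<bar>0::real\<bar> \<le> B" by (intro exI[of _ 0]) simp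
  qed simp
  then have "(dual_sum \<phi>' \<psi>' (\<lambda>_ _. 0), dual_value \<phi>' \<psi>') \<in> dual_pairs"
    unfolding dual_pairs_def by blast
  moreover have "\<bar>s z\<bar> \<le> dual_sum \<phi>' \<psi>' (\<lambda>_ _. 0) z" for z
  proof -
    have "\<bar>s z\<bar> \<le> (\<Sum>i\<in>UNIV. \<bar>\<phi> i (fst z $ i) + \<psi> i (snd z $ i) + h i (fst z) * (snd z $ i - fst z $ i)\<bar>)"
      unfolding a(2) dual_sum_def by (rule sum_abs)
    also have "\<dots> \<le> (\<Sum>i\<in>UNIV. \<phi>' i (fst z $ i) + \<psi>' i (snd z $ i))"
    proof (rule sum_mono)
      fix i
      have "\<bar>h i (fst z) * (snd z $ i - fst z $ i)\<bar> \<le> B i * \<bar>snd z $ i - fst z $ i\<bar>"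
        unfolding abs_mult by (intro mult_right_mono B) auto
      also have "\<dots> \<le> B i * (\<bar>snd z $ i\<bar> + \<bar>fst z $ i\<bar>)"
        using B[of i "fst z"] by (intro mult_left_mono) auto
      finally show "\<bar>\<phi> i (fst z $ i) + \<psi> i (snd z $ i) + h i (fst z) * (snd z $ i - fst z $ i)\<bar>
          \<le> \<phi>' i (fst z $ i) + \<psi>' i (snd z $ i)"
        unfolding \<phi>'_def \<psi>'_def by (simp add: algebra_simps)
    qed
    finally show ?thesis by (simp add: dual_sum_def)
  qed
  ultimately show ?thesis by blast
qed

text \<open>Integrating \<open>D\<close> over preimages of \<open>A\<close> is countably additive in
  \<open>A\<close>, and closed sets form an intersection-stable generator. Complements use that the
  whole space is closed.\<close>

lemma martingale_closed_imp_borel: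
  fixes \<pi> :: "((real ^ 'd) \<times> (real ^ 'd)) measure" and D :: "_ \<Rightarrow> real"
  assumes [measurable_cong]: "sets \<pi> = sets borel" and D: "integrable \<pi> D"
    and closed: "\<And>C. closed C \<Longrightarrow> set_lebesgue_integral \<pi> (fst -` C) D = 0"
    and A: "A \<in> sets borel"
  shows "set_lebesgue_integral \<pi> (fst -` A) D = 0"
proof -
  have sp: "space \<pi> = UNIV" using sets_eq_imp_space_eq[OF assms(1)] by simp
  have stable: "Int_stable (Collect closed :: (real ^ 'd) set set)"
    unfolding Int_stable_def by auto
  have sub: "Collect closed \<subseteq> Pow (UNIV :: (real ^ 'd) set)"
    by simp
  have gen: "A \<in> sigma_sets UNIV (Collect closed)"
    using A by (simp add: borel_eq_closed)
  from stable sub gen show ?thesis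
  proof (induction rule: sigma_sets_induct_disjoint)
    case (basic A)
    then show ?case using closed by auto
  next
    case empty
    then show ?case by (simp add: set_lebesgue_integral_def)
  next
    case (compl A)
    then have A: "A \<in> sets borel" by (simp add: borel_eq_closed)
    have fA: "fst -` A \<in> sets \<pi>"
      using measurable_sets[OF measurable_coord(3) A] assms(1) by simp
    have U: "fst -` A \<union> fst -` (UNIV - A) = (UNIV :: ((real ^ 'd) \<times> (real ^ 'd)) set)" by auto
    have "set_lebesgue_integral \<pi> (fst -` A \<union> fst -` (UNIV - A)) D
        = set_lebesgue_integral \<pi> (fst -` A) D + set_lebesgue_integral \<pi> (fst -` (UNIV - A)) D"
    proof (rule set_integral_Un)
      have "fst -` (UNIV - A) = space \<pi> - fst -` A" using sp by auto
      then have "fst -` (UNIV - A) \<in> sets \<pi>" using fA by auto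
      then show "set_integrable \<pi> (fst -` A) D" "set_integrable \<pi> (fst -` (UNIV - A)) D"
        unfolding set_integrable_def using fA D by (auto intro!: integrable_mult_indicator simp del: real_scaleR_def)
    qed auto
    then show ?case unfolding U using closed[of UNIV] compl by simp
  next
    case (union A)
    have fA: "fst -` A i \<in> sets \<pi>" for i
    proof -
      have "A i \<in> sets borel" using union by (auto simp: borel_eq_closed)
      then show ?thesis using measurable_sets[OF measurable_coord(3), of "A i"] assms(1) by simp
    qed
    have "fst -` (\<Union>i. A i) = (\<Union>i. fst -` A i)" by auto
    then have "set_lebesgue_integral \<pi> (fst -` (\<Union>i. A i)) D = set_lebesgue_integral \<pi> (\<Union>i. fst -` A i) D"
      by (rule arg_cong)
    also have "\<dots> = (\<Sum>i. set_lebesgue_integral \<pi> (fst -` A i) D)"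
    proof (rule lebesgue_integral_countable_add)
      show "set_integrable \<pi> (\<Union>i. fst -` A i) D"
        unfolding set_integrable_def using fA D by (intro integrable_mult_indicator) auto
      show "fst -` A i \<inter> fst -` A j = {}" if "i \<noteq> j" for i j
        using union(1) that unfolding disjoint_family_on_def by auto
    qed (use fA in auto)
    also have "\<dots> = 0" using union by simp
    finally show ?case .
  qed
qed

lemma admissible_no_increment:
  assumes "\<And>i. integrable (\<mu> i) (\<phi> i)" "\<And>i. integrable (\<nu> i) (\<psi> i)"
  shows "admissible \<phi> \<psi> (\<lambda>_ _. 0)"
proof (rule admissibleI[OF assms])
  show "\<exists>B. \<forall>x::real ^ 'd. \<bar>0::real\<bar> \<le> B"
    by (intro exI[of _ 0]) simp
qed simp

definition dominated :: "((real ^ 'd) \<times> (real ^ 'd) \<Rightarrow> real) set" where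
  "dominated = {f. \<exists>s v. (s, v) \<in> dual_pairs \<and> (\<forall>z. \<bar>f z\<bar> \<le> s z)}"

text \<open>The exact values of \<open>L\<close> on functions of a single coordinate give tightness,
  the slab conditions and the marginals. The comparison of integrals is available only for
  nonnegative functions; the auxiliary pair \<open>(s, v)\<close> lifts \<open>f\<close> above 0,
  and since \<open>s\<close> has the value \<open>v\<close> both under \<open>L\<close> and under
  \<pi>, it cancels afterwards.\<close>

lemma representing_transport:
  assumes L: "positive_functional dominated L"
    and L_pairs: "\<And>s v. (s, v) \<in> dual_pairs \<Longrightarrow> s \<in> dominated \<and> L s = v"
  obtains \<pi> where "\<pi> \<in> VMT \<mu> \<nu>"
    and "\<And>f s v. lower_semicontinuous f \<Longrightarrow> f \<in> dominated \<Longrightarrow> integrable \<pi> f \<Longrightarrow>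
           (s, v) \<in> dual_pairs \<Longrightarrow> continuous_on UNIV s \<Longrightarrow> integrable \<pi> s \<Longrightarrow> integral\<^sup>L \<pi> s = v \<Longrightarrow>
           (\<And>z. 0 \<le> f z + s z) \<Longrightarrow> integral\<^sup>L \<pi> f \<le> L f"
proof -
  interpret positive_functional dominated L by fact
  have charge_fst: "charge {z. fst z $ i \<in> B} = measure (\<mu> i) B" if B: "B \<in> sets borel" for i B
  proof -
    interpret real_distribution "\<mu> i" by (rule \<mu>)
    have eq: "(indicator {z. fst z $ i \<in> B} :: _ \<Rightarrow> real) = (\<lambda>z. indicator B (fst z $ i))"
      by (auto simp: indicator_def)
    have "integrable (\<mu> i) (indicator B :: _ \<Rightarrow> real)" "integral\<^sup>L (\<mu> i) (indicator B) = measure (\<mu> i) B"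
      using B by (auto simp: emeasure_eq_measure)
    then show ?thesis
      unfolding charge_def eq using L_pairs[OF dual_pairs_fst, of i "indicator B"] by auto
  qed
  have charge_snd: "charge {z. snd z $ i \<in> B} = measure (\<nu> i) B" if B: "B \<in> sets borel" for i B
  proof -
    interpret real_distribution "\<nu> i" by (rule \<nu>)
    have eq: "(indicator {z. snd z $ i \<in> B} :: _ \<Rightarrow> real) = (\<lambda>z. indicator B (snd z $ i))"
      by (auto simp: indicator_def)
    have "integrable (\<nu> i) (indicator B :: _ \<Rightarrow> real)" "integral\<^sup>L (\<nu> i) (indicator B) = measure (\<nu> i) B"
      using B by (auto simp: emeasure_eq_measure)
    then show ?thesis
      unfolding charge_def eq using L_pairs[OF dual_pairs_snd, of i "indicator B"] by auto
  qed
  interpret tight_positive_functional dominated L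
  proof
    fix e :: real assume e: "e > 0"
    \<comment> \<open>A Markov inequality: \<open>W\<close> dominates the norm and has a finite
      value under \<open>L\<close>.\<close>
    define W where "W = dual_sum (\<lambda>(i::'d) x. \<bar>x\<bar>) (\<lambda>i x. \<bar>x\<bar>) (\<lambda>_ _. 0)"
    have "admissible (\<lambda>i x. \<bar>x\<bar>) (\<lambda>i x. \<bar>x\<bar>) (\<lambda>_ _. 0)"
      by (intro admissible_no_increment integrable_abs integrable_id)
    then obtain C where C: "(W, C) \<in> dual_pairs"
      unfolding W_def dual_pairs_def by blast
    have W_mem: "W \<in> dominated" and LW: "L W = C"
      using L_pairs[OF C] by auto
    have W_ge: "norm z \<le> W z" for z
    proof -
      have "norm z \<le> norm (fst z) + norm (snd z)"
        using norm_Pair_le[of "fst z" "snd z"] by simp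
      also have "\<dots> \<le> (\<Sum>i\<in>UNIV. \<bar>fst z $ i\<bar>) + (\<Sum>i\<in>UNIV. \<bar>snd z $ i\<bar>)"
        using norm_le_l1_cart[of "fst z"] norm_le_l1_cart[of "snd z"] by linarith
      finally show ?thesis by (simp add: W_def dual_sum_def sum.distrib)
    qed
    have "C \<ge> 0"
      using L_mono[OF zero_mem W_mem] W_ge order_trans[OF norm_ge_zero W_ge] by (simp add: L_zero LW)
    define R where "R = (C + 1) / e"
    have R: "R > 0" using \<open>C \<ge> 0\<close> e by (simp add: R_def)
    have "charge (- cball 0 R) \<le> L (\<lambda>z. (1 / R) * W z)"
      unfolding charge_def
    proof (rule L_mono[OF indicator_mem scale_mem[OF W_mem]])
      fix z show "indicator (- cball 0 R) z \<le> 1 / R * W z"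
        using W_ge[of z] R order_trans[OF norm_ge_zero W_ge[of z]] by (auto simp: indicator_def field_simps)
    qed
    also have "\<dots> = C / R" using L_scale[OF W_mem, of "1 / R"] LW by simp
    also have "\<dots> < e" using e \<open>C \<ge> 0\<close> by (simp add: R_def field_simps)
    finally show "\<exists>K::((real ^ 'd) \<times> (real ^ 'd)) set. compact K \<and> charge (- K) < e"
      by (intro exI[of _ "cball 0 R"]) auto
  next
    fix b :: "(real ^ 'd) \<times> (real ^ 'd)" and t e :: real assume b: "b \<in> Basis" and e: "e > 0"
    show "\<exists>s<t. charge {z. s < z \<bullet> b \<and> z \<bullet> b < t} < e"
    proof (cases rule: Basis_pair_cart_cases[OF b])
      case (1 i)
      then show ?thesis
        using real_distribution.measure_small_left_interval[OF \<mu> e, where t = t] charge_fst[of "{_<..<t}" i] by auto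
    next
      case (2 i)
      then show ?thesis
        using real_distribution.measure_small_left_interval[OF \<nu> e, where t = t] charge_snd[of "{_<..<t}" i] by auto
    qed
    show "\<exists>s>t. charge {z. t < z \<bullet> b \<and> z \<bullet> b < s} < e"
    proof (cases rule: Basis_pair_cart_cases[OF b])
      case (1 i)
      then show ?thesis
        using real_distribution.measure_small_right_interval[OF \<mu> e, where t = t] charge_fst[of "{t<..<_}" i] by auto
    next
      case (2 i)
      then show ?thesis
        using real_distribution.measure_small_right_interval[OF \<nu> e, where t = t] charge_snd[of "{t<..<_}" i] by auto
    qed
  qed
  obtain \<pi> :: "((real ^ 'd) \<times> (real ^ 'd)) measure" where prob: "prob_space \<pi>"
    and \<pi>_sets: "sets \<pi> = sets borel"
    and \<pi>_open: "\<And>U. open U \<Longrightarrow> measure \<pi> U \<le> charge U"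
    and \<pi>_half: "\<And>b t. b \<in> Basis \<Longrightarrow> measure \<pi> {z. t < z \<bullet> b} = charge {z. t < z \<bullet> b}"
    using representing_measure by blast
  note [measurable_cong] = \<pi>_sets
  interpret \<pi>: prob_space \<pi> by (rule prob)
  have sp: "space \<pi> = UNIV" using sets_eq_imp_space_eq[OF \<pi>_sets] by simp
  have \<pi>_fst: "distr \<pi> borel (\<lambda>z. fst z $ i) = \<mu> i" for i
  proof (rule real_distribution_eqI[OF _ \<mu>])
    have m: "(\<lambda>z. fst z $ i) \<in> borel_measurable \<pi>" by measurable
    then show "real_distribution (distr \<pi> borel (\<lambda>z. fst z $ i))"
      by (rule \<pi>.real_distribution_distr)
    fix t
    have b: "(axis i 1, 0) \<in> (Basis :: ((real ^ 'd) \<times> (real ^ 'd)) set)"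
      by (auto simp: Basis_prod_def Basis_vec_def)
    have "measure (distr \<pi> borel (\<lambda>z. fst z $ i)) {t<..} = measure \<pi> {z. t < fst z $ i}"
      using m by (subst measure_distr) (auto simp: sp vimage_def)
    also have "\<dots> = measure (\<mu> i) {t<..}"
      using \<pi>_half[OF b, of t] charge_fst[of "{t<..}" i] by (simp add: inner_prod_def inner_axis)
    finally show "measure (distr \<pi> borel (\<lambda>z. fst z $ i)) {t<..} = measure (\<mu> i) {t<..}" .
  qed
  have \<pi>_snd: "distr \<pi> borel (\<lambda>z. snd z $ i) = \<nu> i" for i
  proof (rule real_distribution_eqI[OF _ \<nu>])
    have m: "(\<lambda>z. snd z $ i) \<in> borel_measurable \<pi>" by measurable
    then show "real_distribution (distr \<pi> borel (\<lambda>z. snd z $ i))"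
      by (rule \<pi>.real_distribution_distr)
    fix t
    have b: "(0, axis i 1) \<in> (Basis :: ((real ^ 'd) \<times> (real ^ 'd)) set)"
      by (auto simp: Basis_prod_def Basis_vec_def)
    have "measure (distr \<pi> borel (\<lambda>z. snd z $ i)) {t<..} = measure \<pi> {z. t < snd z $ i}"
      using m by (subst measure_distr) (auto simp: sp vimage_def)
    also have "\<dots> = measure (\<nu> i) {t<..}"
      using \<pi>_half[OF b, of t] charge_snd[of "{t<..}" i] by (simp add: inner_prod_def inner_axis)
    finally show "measure (distr \<pi> borel (\<lambda>z. snd z $ i)) {t<..} = measure (\<nu> i) {t<..}" .
  qed
  note marg = \<pi>_sets \<pi>_fst \<pi>_snd
  have int_coord: "integrable \<pi> (\<lambda>z. fst z $ i)" "integrable \<pi> (\<lambda>z. snd z $ i)" for i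
    by (rule iffD2[OF marginal_integral_fst(1)[OF marg] integrable_id(1)], measurable)
      (rule iffD2[OF marginal_integral_snd(1)[OF marg] integrable_id(2)], measurable)
  have le_L: "integral\<^sup>L \<pi> f \<le> L f"
    if f: "lower_semicontinuous f" "f \<in> dominated" "integrable \<pi> f"
      and s: "(s, v) \<in> dual_pairs" "continuous_on UNIV s" "integrable \<pi> s" "integral\<^sup>L \<pi> s = v"
      and pos: "\<And>z. 0 \<le> f z + s z" for f s v
  proof -
    have smem: "s \<in> dominated" "L s = v" using L_pairs[OF s(1)] by auto
    have "(\<integral>\<^sup>+z. ennreal (f z + s z) \<partial>\<pi>) \<le> ennreal (L (\<lambda>z. f z + s z))"
    proof (rule nn_integral_le_functional[OF L prob \<pi>_sets])
      show "open {z. a < f z + s z}" for a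
        by (rule open_lower_semicontinuous[OF lower_semicontinuous_add_continuous[OF f(1) s(2)]])
    qed (use \<pi>_open pos f smem in \<open>auto simp: charge_def intro: add_mem\<close>)
    moreover have "(\<integral>\<^sup>+z. ennreal (f z + s z) \<partial>\<pi>) = ennreal (\<integral>z. f z + s z \<partial>\<pi>)"
      using f(3) s(3) pos by (intro nn_integral_eq_integral) auto
    moreover have "0 \<le> L (\<lambda>z. f z + s z)"
      using L_mono[OF zero_mem add_mem[OF f(2) smem(1)]] pos by (simp add: L_zero)
    ultimately have "(\<integral>z. f z + s z \<partial>\<pi>) \<le> L (\<lambda>z. f z + s z)"
      by (simp add: ennreal_le_iff)
    then show ?thesis
      using f s smem by (simp add: L_add)
  qed
  \<comment> \<open>A continuous function is lower semicontinuous together with its negative, so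
    applying the one-sided bound to \<open>g\<close> and \<open>- g\<close> will give
    equality.\<close>
  have cont_mart: "(\<integral>z. g (fst z) * (snd z $ i - fst z $ i) \<partial>\<pi>) \<le> 0"
    if g: "continuous_on UNIV g" "\<And>x. \<bar>g x\<bar> \<le> 1" for g i
  proof -
    have gm: "g \<in> borel_measurable borel" using g(1) by (rule borel_measurable_continuous_onI)
    have c: "continuous_on UNIV (\<lambda>z. g (fst z) * (snd z $ i - fst z $ i))"
      by (intro continuous_intros continuous_on_compose2[OF g(1)]) auto
    have mem: "(\<lambda>z. g (fst z) * (snd z $ i - fst z $ i)) \<in> dominated"
      and L0: "L (\<lambda>z. g (fst z) * (snd z $ i - fst z $ i)) = 0"
      using L_pairs[OF dual_pairs_increment[OF gm g(2), of i]] by auto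
    have "integral\<^sup>L \<pi> (\<lambda>z. g (fst z) * (snd z $ i - fst z $ i)) \<le> L (\<lambda>z. g (fst z) * (snd z $ i - fst z $ i))"
    proof (rule le_L[of _ "\<lambda>z. \<bar>snd z $ i\<bar> + \<bar>fst z $ i\<bar>"
          "integral\<^sup>L (\<nu> i) (\<lambda>x. \<bar>x\<bar>) + integral\<^sup>L (\<mu> i) (\<lambda>x. \<bar>x\<bar>)"])
      show "(\<lambda>z. \<bar>snd z $ i\<bar> + \<bar>fst z $ i\<bar>, integral\<^sup>L (\<nu> i) (\<lambda>x. \<bar>x\<bar>) + integral\<^sup>L (\<mu> i) (\<lambda>x. \<bar>x\<bar>)) \<in> dual_pairs"
        using dual_pairs_add[OF dual_pairs_snd[of i "\<lambda>x. \<bar>x\<bar>"] dual_pairs_fst[of i "\<lambda>x. \<bar>x\<bar>"]] integrable_id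
        by auto
      show "integrable \<pi> (\<lambda>z. g (fst z) * (snd z $ i - fst z $ i))"
        by (rule integrable_bounded_increment[OF marg gm g(2)])
      have "(\<integral>z. \<bar>snd z $ i\<bar> \<partial>\<pi>) = integral\<^sup>L (\<nu> i) (\<lambda>x. \<bar>x\<bar>)" "(\<integral>z. \<bar>fst z $ i\<bar> \<partial>\<pi>) = integral\<^sup>L (\<mu> i) (\<lambda>x. \<bar>x\<bar>)"
        by (rule marginal_integral_snd(2)[OF marg], measurable) (rule marginal_integral_fst(2)[OF marg], measurable)
      then show "(\<integral>z. \<bar>snd z $ i\<bar> + \<bar>fst z $ i\<bar> \<partial>\<pi>) = integral\<^sup>L (\<nu> i) (\<lambda>x. \<bar>x\<bar>) + integral\<^sup>L (\<mu> i) (\<lambda>x. \<bar>x\<bar>)"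
        using int_coord by (subst Bochner_Integration.integral_add) auto
      fix z
      have aux: "\<bar>X\<bar> \<le> 1 * \<bar>a - b\<bar> \<Longrightarrow> 0 \<le> X + (\<bar>a\<bar> + \<bar>b\<bar>)" for X a b :: real
        by (auto simp: abs_if split: if_splits)
      have "\<bar>g (fst z) * (snd z $ i - fst z $ i)\<bar> \<le> 1 * \<bar>snd z $ i - fst z $ i\<bar>"
        unfolding abs_mult by (intro mult_right_mono g) auto
      then show "0 \<le> g (fst z) * (snd z $ i - fst z $ i) + (\<bar>snd z $ i\<bar> + \<bar>fst z $ i\<bar>)"
        by (rule aux)
    qed (use int_coord mem c in \<open>auto intro!: lower_semicontinuous_continuous continuous_intros\<close>)
    then show ?thesis using L0 by simp
  qed
  have cont_mart0: "(\<integral>z. g (fst z) * (snd z $ i - fst z $ i) \<partial>\<pi>) = 0"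
    if g: "continuous_on UNIV g" "\<And>x. \<bar>g x\<bar> \<le> 1" for g i
    using cont_mart[OF g, of i] cont_mart[of "\<lambda>x. - g x" i] g by (auto intro: continuous_intros)
  have closed_mart: "set_lebesgue_integral \<pi> (fst -` C) (\<lambda>z. snd z $ i - fst z $ i) = 0"
    if C: "closed C" for C :: "(real ^ 'd) set" and i
  proof (cases "C = {}")
    case True
    then show ?thesis by (simp add: set_lebesgue_integral_def)
  next
    case False
    \<comment> \<open>Continuous functions decreasing to the indicator of the closed set
      \<open>C\<close>.\<close>
    define g where "g n x = max 0 (1 - real n * infdist x C)" for n x
    have g_cont: "continuous_on UNIV (g n)" for n
      unfolding g_def by (intro continuous_intros)
    have g_le: "\<bar>g n x\<bar> \<le> 1" for n x
      unfolding g_def using infdist_nonneg[of x C] by (auto simp: max_def)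
    have [measurable]: "g n \<in> borel_measurable borel" for n
      using g_cont by (rule borel_measurable_continuous_onI)
    have C_borel [measurable]: "C \<in> sets borel" using C by auto
    have g_lim: "(\<lambda>n. g n x) \<longlonglongrightarrow> indicator C x" for x
    proof (cases "x \<in> C")
      case True
      then show ?thesis by (simp add: g_def)
    next
      case outside: False
      then have "infdist x C > 0"
        using C False by (metis in_closed_iff_infdist_zero infdist_nonneg less_eq_real_def)
      then obtain N where N: "1 < real N * infdist x C"
        using reals_Archimedean3 by blast
      have "g n x = 0" if "n \<ge> N" for n
        using N mult_right_mono[of "real N" "real n" "infdist x C"] that infdist_nonneg[of x C]
        by (simp add: g_def)
      then have "\<forall>\<^sub>F n in sequentially. g n x = 0"
        by (auto simp: eventually_sequentially)
      then show ?thesis using outside by (simp add: tendsto_eventually)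
    qed
    have "(\<lambda>n. \<integral>z. g n (fst z) * (snd z $ i - fst z $ i) \<partial>\<pi>) \<longlonglongrightarrow>
        (\<integral>z. indicator C (fst z) * (snd z $ i - fst z $ i) \<partial>\<pi>)"
    proof (rule integral_dominated_convergence[where w = "\<lambda>z. \<bar>snd z $ i - fst z $ i\<bar>"])
      show "integrable \<pi> (\<lambda>z. \<bar>snd z $ i - fst z $ i\<bar>)" using int_coord by auto
      show "AE z in \<pi>. (\<lambda>n. g n (fst z) * (snd z $ i - fst z $ i))
          \<longlonglongrightarrow> indicator C (fst z) * (snd z $ i - fst z $ i)"
        by (intro AE_I2 tendsto_intros g_lim)
      show "AE z in \<pi>. norm (g n (fst z) * (snd z $ i - fst z $ i)) \<le> \<bar>snd z $ i - fst z $ i\<bar>" for n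
        using g_le by (intro AE_I2) (auto simp: abs_mult intro: mult_left_le_one_le)
    qed measurable
    moreover have "(\<integral>z. g n (fst z) * (snd z $ i - fst z $ i) \<partial>\<pi>) = 0" for n
      by (rule cont_mart0[OF g_cont g_le])
    ultimately have "(\<integral>z. indicator C (fst z) * (snd z $ i - fst z $ i) \<partial>\<pi>) = 0"
      by (simp add: LIMSEQ_const_iff)
    moreover have "(indicator (fst -` C) z :: real) = indicator C (fst z)" for z :: "(real ^ 'd) \<times> (real ^ 'd)"
      by (simp add: indicator_def)
    ultimately show ?thesis
      by (simp add: set_lebesgue_integral_def)
  qed
  have ce: "AE z in \<pi>. real_cond_exp \<pi> (vimage_algebra (space \<pi>) fst borel) (\<lambda>z. snd z $ i) z = fst z $ i" for i
  proof -
    define F where "F = vimage_algebra (space \<pi>) (fst :: (real ^ 'd) \<times> (real ^ 'd) \<Rightarrow> _) borel"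
    have fst_F [measurable]: "(fst :: (real ^ 'd) \<times> (real ^ 'd) \<Rightarrow> _) \<in> measurable F borel"
      unfolding F_def by (rule measurable_vimage_algebra1) auto
    have F_sets: "sets F = (\<lambda>A. fst -` A) ` sets borel"
      unfolding F_def using sp by (auto simp: sets_vimage_algebra2)
    have fst_meas: "fst \<in> measurable \<pi> (borel :: (real ^ 'd) measure)" by measurable
    then have sub: "subalgebra \<pi> F"
      unfolding subalgebra_def F_def by (auto simp: sets_vimage_algebra2 intro!: measurable_sets)
    interpret finite_measure_subalgebra \<pi> F
      by standard (rule sub)
    have "AE z in \<pi>. real_cond_exp \<pi> F (\<lambda>z. snd z $ i) z = fst z $ i"
    proof (rule real_cond_exp_charact)
      fix B assume "B \<in> sets F"
      then obtain A where A: "A \<in> sets borel" "B = fst -` A" unfolding F_sets by auto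
      have B: "B \<in> sets \<pi>" using \<open>B \<in> sets F\<close> sub unfolding subalgebra_def by auto
      have "set_lebesgue_integral \<pi> B (\<lambda>z. snd z $ i - fst z $ i) = 0"
        unfolding A(2)
        by (rule martingale_closed_imp_borel[OF \<pi>_sets _ closed_mart A(1)])
          (intro Bochner_Integration.integrable_diff int_coord)
      moreover have "set_lebesgue_integral \<pi> B (\<lambda>z. snd z $ i - fst z $ i)
          = set_lebesgue_integral \<pi> B (\<lambda>z. snd z $ i) - set_lebesgue_integral \<pi> B (\<lambda>z. fst z $ i)"
        unfolding set_lebesgue_integral_def scaleR_diff_right
        by (intro Bochner_Integration.integral_diff integrable_mult_indicator B int_coord)
      ultimately show "set_lebesgue_integral \<pi> B (\<lambda>z. snd z $ i) = set_lebesgue_integral \<pi> B (\<lambda>z. fst z $ i)"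
        by simp
    next
      have "(\<lambda>x :: real ^ 'd. x $ i) \<in> borel_measurable borel"
        by (intro borel_measurable_continuous_onI continuous_intros)
      then show "(\<lambda>z. fst z $ i) \<in> borel_measurable F"
        using fst_F by (rule measurable_compose[rotated])
    qed (use int_coord in auto)
    then show ?thesis unfolding F_def .
  qed
  have "\<pi> \<in> VMT \<mu> \<nu>"
    unfolding VMT_def using prob \<pi>_sets \<pi>_fst \<pi>_snd ce by auto
  with le_L show thesis using that by blast
qed

text \<open>If every dual value were at most \<open>P - e\<close>, the functional extremal at
  \<open>c\<close> would satisfy \<open>L c \<le> P - e\<close>, and the transport representing it
  would cost less than the lower bound \<open>P\<close>. Lower semicontinuity of \<open>c\<close> is
  what bounds the cost of this transport by \<open>L c\<close>.\<close>

theorem strong_duality: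
  assumes \<pi>0: "\<pi>0 \<in> VMT \<mu> \<nu>" and P: "\<And>\<pi>. \<pi> \<in> VMT \<mu> \<nu> \<Longrightarrow> P \<le> integral\<^sup>L \<pi> c"
    and c: "lower_semicontinuous c"
    and v: "\<And>i. continuous_on UNIV (v i)" "\<And>i. integrable (\<mu> i) (v i)"
    and w: "\<And>i. continuous_on UNIV (w i)" "\<And>i. integrable (\<nu> i) (w i)"
    and bound: "\<And>z. \<bar>c z\<bar> \<le> dual_sum v w (\<lambda>_ _. 0) z"
    and e: "e > 0"
  obtains \<phi> \<psi> h where "admissible \<phi> \<psi> h" "\<And>z. dual_sum \<phi> \<psi> h z \<le> c z" "P - e < dual_value \<phi> \<psi>"
proof (rule ccontr)
  assume "\<not> thesis"
  then have none: "\<And>\<phi> \<psi> h. admissible \<phi> \<psi> h \<Longrightarrow> (\<And>z. dual_sum \<phi> \<psi> h z \<le> c z) \<Longrightarrow> \<not> P - e < dual_value \<phi> \<psi>"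
    using that by blast
  have neg: "v' \<le> P - e" if sv: "(s, v') \<in> dual_pairs" and le: "\<And>z. s z \<le> c z" for s v'
  proof -
    obtain \<phi> \<psi> h where "admissible \<phi> \<psi> h" "s = dual_sum \<phi> \<psi> h" "v' = dual_value \<phi> \<psi>"
      using sv unfolding dual_pairs_def by blast
    then show ?thesis using none le by force
  qed
  define W where "W = dual_sum v w (\<lambda>_ _. 0)"
  have W_adm: "admissible v w (\<lambda>_ _. 0)"
    by (intro admissible_no_increment v w)
  then have W_pair: "(W, dual_value v w) \<in> dual_pairs"
    unfolding dual_pairs_def W_def by blast
  have c_mem: "c \<in> dominated"
    unfolding dominated_def using W_pair bound W_def by blast
  obtain L where L: "positive_functional dominated L"
    and L_pairs: "\<And>s v. (s, v) \<in> dual_pairs \<Longrightarrow> s \<in> dominated \<and> L s = v"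
    and Lc: "\<And>r. (\<And>s v. (s, v) \<in> dual_pairs \<Longrightarrow> (\<And>z. s z \<le> c z) \<Longrightarrow> v \<le> r) \<Longrightarrow> L c \<le> r"
  proof (rule dominated_functional_exists[of dual_pairs c, folded dominated_def])
    \<comment> \<open>The given transport \<open>\<pi>0\<close> integrates each dual function to its
      value, so values respect the order of functions.\<close>
    show "v \<le> v'" if sv: "(s, v) \<in> dual_pairs" and sv': "(s', v') \<in> dual_pairs"
      and le: "\<And>z. s z \<le> s' z" for s v s' v'
    proof -
      obtain \<phi> \<psi> h where a: "admissible \<phi> \<psi> h" "s = dual_sum \<phi> \<psi> h" "v = dual_value \<phi> \<psi>"
        using sv unfolding dual_pairs_def by blast
      obtain \<phi>' \<psi>' h' where b: "admissible \<phi>' \<psi>' h'" "s' = dual_sum \<phi>' \<psi>' h'" "v' = dual_value \<phi>' \<psi>'"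
        using sv' unfolding dual_pairs_def by blast
      show ?thesis
        unfolding a(3) b(3) VMT_integral_dual_sum(2)[OF \<pi>0 a(1), symmetric]
          VMT_integral_dual_sum(2)[OF \<pi>0 b(1), symmetric]
        using le a b VMT_integral_dual_sum(1)[OF \<pi>0] by (intro integral_mono) auto
    qed
  next
    show "(\<lambda>z. s z + s' z, v + v') \<in> dual_pairs" if "(s, v) \<in> dual_pairs" "(s', v') \<in> dual_pairs" for s v s' v'
      using that by (rule dual_pairs_add)
    show "(\<lambda>z. t * s z, t * v) \<in> dual_pairs" if "(s, v) \<in> dual_pairs" for s v t
      using that by (rule dual_pairs_scale)
    show "\<exists>s' v'. (s', v') \<in> dual_pairs \<and> (\<forall>z. \<bar>s z\<bar> \<le> s' z)" if "(s, v) \<in> dual_pairs" for s v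
      using that by (rule dual_pairs_abs)
    show "(\<lambda>_. 1, 1) \<in> dual_pairs" by (rule dual_pairs_const)
    show "c \<in> dominated" by (rule c_mem)
  next
    fix L assume L1: "positive_functional dominated L"
      and L2: "\<And>s v. (s, v) \<in> dual_pairs \<Longrightarrow> s \<in> dominated \<and> L s = v"
      and L3: "\<And>r. (\<And>s v. (s, v) \<in> dual_pairs \<Longrightarrow> (\<And>z. s z \<le> c z) \<Longrightarrow> v \<le> r) \<Longrightarrow> L c \<le> r"
    show thesis
      by (rule that) (fact L1 L2 L3)+
  qed
  obtain \<pi> where \<pi>: "\<pi> \<in> VMT \<mu> \<nu>"
    and le_L: "\<And>f s v. lower_semicontinuous f \<Longrightarrow> f \<in> dominated \<Longrightarrow> integrable \<pi> f \<Longrightarrow>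
           (s, v) \<in> dual_pairs \<Longrightarrow> continuous_on UNIV s \<Longrightarrow> integrable \<pi> s \<Longrightarrow> integral\<^sup>L \<pi> s = v \<Longrightarrow>
           (\<And>z. 0 \<le> f z + s z) \<Longrightarrow> integral\<^sup>L \<pi> f \<le> L f"
    using representing_transport[OF L L_pairs] by blast
  note [measurable_cong] = VMT_D(2)[OF \<pi>]
  have W_int: "integrable \<pi> W" "integral\<^sup>L \<pi> W = dual_value v w"
    using VMT_integral_dual_sum[OF \<pi> W_adm] unfolding W_def by auto
  have c_int: "integrable \<pi> c"
  proof (rule Bochner_Integration.integrable_bound[OF W_int(1)])
    have [measurable]: "c \<in> borel_measurable borel" by (rule borel_measurable_lower_semicontinuous[OF c])
    show "c \<in> borel_measurable \<pi>" by measurable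
    show "AE z in \<pi>. norm (c z) \<le> norm (W z)"
      using bound by (intro AE_I2) (auto simp: W_def intro: order_trans[OF _ abs_ge_self])
  qed
  have W_cont: "continuous_on UNIV W"
  proof -
    have "W = (\<lambda>z. \<Sum>i\<in>UNIV. v i (fst z $ i) + w i (snd z $ i))"
      by (simp add: W_def dual_sum_def fun_eq_iff)
    moreover have "continuous_on UNIV (\<lambda>z. \<Sum>i\<in>UNIV. v i (fst z $ i) + w i (snd z $ i))"
      by (intro continuous_intros continuous_on_compose2[OF v(1)] continuous_on_compose2[OF w(1)]) auto
    ultimately show ?thesis by simp
  qed
  have "0 \<le> c z + W z" for z
    using bound[of z] unfolding W_def by linarith
  from le_L[OF c c_mem c_int W_pair W_cont W_int this] have "integral\<^sup>L \<pi> c \<le> L c" .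
  moreover have "L c \<le> P - e"
    using neg by (rule Lc)
  ultimately show False
    using P[OF \<pi>] e by simp
qed

end

section \<open>Convex functions along an irreducible pair\<close>

text \<open>Since \<open>g\<close> attains its minimum 0 at \<open>p\<close>, it is decreasing to
  the left of \<open>p\<close>; a convex decreasing function of the concave function
  \<open>min y p\<close> is convex.\<close>

lemma convex_on_comp_min:
  fixes g :: "real \<Rightarrow> real"
  assumes g: "convex_on UNIV g" and pos: "\<And>y. 0 \<le> g y" and zero: "g p = 0"
  shows "convex_on UNIV (\<lambda>y. g (min y p))"
proof (rule convex_onI)
  have anti: "g t \<le> g s" if "s \<le> t" "t \<le> p" for s t
  proof (cases "s = p")
    case True
    then show ?thesis using that by auto
  next
    case False
    then have "s < p" using that by auto
    define l where "l = (t - s) / (p - s)"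
    have l: "0 \<le> l" "l \<le> 1"
      using that \<open>s < p\<close> by (auto simp: l_def field_simps)
    have "l * (p - s) = t - s" using \<open>s < p\<close> by (simp add: l_def)
    then have "t = (1 - l) *\<^sub>R s + l *\<^sub>R p" by (simp add: algebra_simps)
    then have "g t \<le> (1 - l) * g s + l * g p"
      using convex_onD[OF g l, of s p] by simp
    also have "\<dots> \<le> g s"
      using l pos[of s] zero by (simp add: mult_left_le_one_le)
    finally show ?thesis .
  qed
  fix t x y :: real assume t: "0 < t" "t < 1"
  have "(1 - t) * min x p + t * min y p \<le> (1 - t) * x + t * y"
    using t by (intro add_mono mult_left_mono) auto
  moreover have "(1 - t) * min x p + t * min y p \<le> (1 - t) * p + t * p"
    using t by (intro add_mono mult_left_mono) auto
  ultimately have "(1 - t) * min x p + t * min y p \<le> min ((1 - t) * x + t * y) p"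
    by (simp add: algebra_simps)
  then have "g (min ((1 - t) * x + t * y) p) \<le> g ((1 - t) * min x p + t * min y p)"
    by (intro anti) auto
  also have "\<dots> \<le> (1 - t) * g (min x p) + t * g (min y p)"
    using convex_onD[OF g, of t "min x p" "min y p"] t by simp
  finally show "g (min ((1 - t) *\<^sub>R x + t *\<^sub>R y) p) \<le> (1 - t) * g (min x p) + t * g (min y p)"
    by simp
qed auto

lemma convex_on_uminus_arg:
  fixes g :: "real \<Rightarrow> real"
  assumes g: "convex_on UNIV g"
  shows "convex_on UNIV (\<lambda>y. g (- y))"
proof (rule convex_onI)
  fix t x y :: real assume "0 < t" "t < 1"
  then show "g (- ((1 - t) *\<^sub>R x + t *\<^sub>R y)) \<le> (1 - t) * g (- x) + t * g (- y)"
    using convex_onD[OF g, of t "- x" "- y"] by (simp add: algebra_simps)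
qed auto

lemma convex_on_comp_max:
  fixes g :: "real \<Rightarrow> real"
  assumes g: "convex_on UNIV g" and pos: "\<And>y. 0 \<le> g y" and zero: "g q = 0"
  shows "convex_on UNIV (\<lambda>y. g (max y q))"
proof -
  have "convex_on UNIV (\<lambda>y. g (- min y (- q)))"
    by (rule convex_on_comp_min[OF convex_on_uminus_arg[OF g], where p = "- q"]) (use pos zero in auto)
  from convex_on_uminus_arg[OF this] show ?thesis
    by (simp add: minus_min_eq_max)
qed

lemma convex_on_diff_affine:
  fixes f :: "real \<Rightarrow> real"
  assumes "convex_on UNIV f"
  shows "convex_on UNIV (\<lambda>y. f y - c - a * (y - p))"
proof (rule convex_onI)
  fix t x y :: real assume "0 < t" "t < 1"
  then show "f ((1 - t) *\<^sub>R x + t *\<^sub>R y) - c - a * ((1 - t) *\<^sub>R x + t *\<^sub>R y - p)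
      \<le> (1 - t) * (f x - c - a * (x - p)) + t * (f y - c - a * (y - p))"
    using convex_onD[OF assms, of t x y] by (simp add: algebra_simps)
qed auto

lemma convex_subgradient:
  fixes f :: "real \<Rightarrow> real"
  assumes "convex_on UNIV f"
  obtains a where "\<And>y. f p + a * (y - p) \<le> f y"
  using convex_le_Inf_differential[OF assms, of p] that by auto

lemma borel_measurable_convex:
  fixes f :: "real \<Rightarrow> real"
  assumes "convex_on UNIV f"
  shows "f \<in> borel_measurable borel"
  using convex_on_continuous[OF open_UNIV assms] by (rule borel_measurable_continuous_onI)

lemma extended_integral_integrable:
  assumes "integrable M f"
  shows "extended_integral M f = ereal (integral\<^sup>L M f)"
proof -
  have fin: "(\<integral>\<^sup>+ x. ennreal (f x) \<partial>M) < \<infinity>" "(\<integral>\<^sup>+ x. ennreal (- f x) \<partial>M) < \<infinity>"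
    using integrableD(2,3)[OF assms] by (auto simp: top.not_eq_extremum)
  have e: "enn2ereal a = ereal (enn2real a)" if "a < \<infinity>" for a
    using that by (cases a) auto
  show ?thesis
    unfolding extended_integral_def real_lebesgue_integral_def[OF assms] e[OF fin(1)] e[OF fin(2)]
    by simp
qed

section \<open>Potentials and convex functions of one irreducible pair\<close>

locale irreducible = M: real_distribution \<mu> + N: real_distribution \<nu>
  for \<mu> \<nu> :: "real measure" +
  assumes moment_\<mu>: "finite_first_moment \<mu>" and moment_\<nu>: "finite_first_moment \<nu>"
    and irreducible: "irreducible_pair \<mu> \<nu>"
begin

definition gap :: "real \<Rightarrow> real" where
  "gap r = potential_function \<nu> r - potential_function \<mu> r"

lemma int_id [simp]: "integrable \<mu> (\<lambda>x. x)" "integrable \<nu> (\<lambda>x. x)"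
  using moment_\<mu> moment_\<nu> unfolding finite_first_moment_def by auto

lemma prob_UNIV [simp]: "measure \<mu> UNIV = 1" "measure \<nu> UNIV = 1"
  using M.prob_space N.prob_space by simp_all

lemma convex_order_integral:
  assumes f: "convex_on UNIV f" "integrable \<mu> f" "integrable \<nu> f"
  shows "integral\<^sup>L \<mu> f \<le> integral\<^sup>L \<nu> f"
  using irreducible f extended_integral_integrable[OF f(2)] extended_integral_integrable[OF f(3)]
  unfolding irreducible_pair_def convex_order_def by fastforce

text \<open>The extended integrals are comparable even when infinite, so finiteness under \<nu>
  carries over to \<mu>.\<close>

lemma convex_integrable_\<mu>:
  assumes f: "convex_on UNIV f" "\<And>y. 0 \<le> f y" "integrable \<nu> f"
  shows "integrable \<mu> f"
proof -
  have "extended_integral \<mu> f \<le> extended_integral \<nu> f"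
    using irreducible f(1) unfolding irreducible_pair_def convex_order_def by blast
  also have "\<dots> = ereal (integral\<^sup>L \<nu> f)"
    by (rule extended_integral_integrable[OF f(3)])
  finally have "enn2ereal (\<integral>\<^sup>+ x. ennreal (f x) \<partial>\<mu>) \<le> ereal (integral\<^sup>L \<nu> f)"
    using f(2) by (simp add: extended_integral_def ennreal_neg zero_ennreal.rep_eq)
  then have "(\<integral>\<^sup>+ x. ennreal (f x) \<partial>\<mu>) < \<infinity>"
    by (cases "\<integral>\<^sup>+ x. ennreal (f x) \<partial>\<mu>") auto
  moreover have "f \<in> borel_measurable \<mu>"
    using borel_measurable_convex[OF f(1)] by simp
  ultimately show ?thesis
    using f(2) by (intro integrableI_nonneg) auto
qed

lemma convex_gap_nonneg:
  assumes f: "convex_on UNIV f" "\<And>y. 0 \<le> f y" "integrable \<nu> f"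
  shows "integral\<^sup>L \<mu> f \<le> integral\<^sup>L \<nu> f"
  using convex_order_integral[OF f(1) convex_integrable_\<mu>[OF f] f(3)] .

lemma convex_affine: "convex_on UNIV (\<lambda>x::real. a * x)"
  using convex_on_linorderI[of UNIV "\<lambda>x::real. a * x"] by (auto simp: algebra_simps)

lemma mean_eq: "integral\<^sup>L \<mu> (\<lambda>x. x) = integral\<^sup>L \<nu> (\<lambda>x. x)"
  using convex_order_integral[OF convex_affine[of 1]] convex_order_integral[OF convex_affine[of "-1"]]
  by simp

lemma int_dist [simp]: "integrable \<mu> (\<lambda>y. \<bar>r - y\<bar>)" "integrable \<nu> (\<lambda>y. \<bar>r - y\<bar>)"
  by (intro integrable_abs Bochner_Integration.integrable_diff M.integrable_const N.integrable_const int_id)+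

lemma int_pos_part [simp]: "integrable \<mu> (\<lambda>y. max 0 (y - r))" "integrable \<nu> (\<lambda>y. max 0 (y - r))"
  by (intro integrable_max Bochner_Integration.integrable_diff M.integrable_const N.integrable_const int_id)+

lemma int_neg_part [simp]: "integrable \<mu> (\<lambda>y. max 0 (r - y))" "integrable \<nu> (\<lambda>y. max 0 (r - y))"
  by (intro integrable_max Bochner_Integration.integrable_diff M.integrable_const N.integrable_const int_id)+

text \<open>The positive part of \<open>y - r\<close> is half of
  \<open>\<bar>r - y\<bar> + y - r\<close>, and the affine part drops out because both measures have
  the same mean.\<close>

lemma gap_pos_part:
  "(\<integral>y. max 0 (y - r) \<partial>\<nu>) - (\<integral>y. max 0 (y - r) \<partial>\<mu>) = gap r / 2"
proof -
  have eq: "(\<lambda>y. max 0 (y - r)) = (\<lambda>y. (\<bar>r - y\<bar> + y - r) / 2)"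
    by (auto simp: fun_eq_iff max_def abs_if field_simps)
  show ?thesis
    unfolding eq gap_def potential_function_def using mean_eq
    by (simp add: field_simps)
qed

lemma gap_neg_part:
  "(\<integral>y. max 0 (r - y) \<partial>\<nu>) - (\<integral>y. max 0 (r - y) \<partial>\<mu>) = gap r / 2"
proof -
  have eq: "(\<lambda>y. max 0 (r - y)) = (\<lambda>y. (\<bar>r - y\<bar> - y + r) / 2)"
    by (auto simp: fun_eq_iff max_def abs_if field_simps)
  show ?thesis
    unfolding eq gap_def potential_function_def using mean_eq
    by (simp add: field_simps)
qed

lemma potential_lipschitz:
  assumes X: "real_distribution X" "integrable X (\<lambda>x. x)"
  shows "\<bar>potential_function X r - potential_function X s\<bar> \<le> \<bar>r - s\<bar>"
proof -
  interpret X: real_distribution X by fact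
  have int: "integrable X (\<lambda>y. \<bar>r - y\<bar>)" for r
    by (intro integrable_abs Bochner_Integration.integrable_diff X.integrable_const X(2))
  have le: "potential_function X r \<le> potential_function X s + \<bar>r - s\<bar>" for r s
  proof -
    have "potential_function X r \<le> (\<integral>y. \<bar>s - y\<bar> + \<bar>r - s\<bar> \<partial>X)"
      unfolding potential_function_def using int by (intro integral_mono) auto
    then show ?thesis
      using int X.prob_space by (simp add: potential_function_def)
  qed
  show ?thesis using le[of r s] le[of s r] by linarith
qed

lemma continuous_gap: "continuous_on UNIV gap"
proof -
  have "continuous_on UNIV (potential_function X)" if "real_distribution X" "integrable X (\<lambda>x. x)" for X
  proof (rule lipschitz_on_continuous_on)
    show "1-lipschitz_on UNIV (potential_function X)"
      using potential_lipschitz[OF that] by (intro lipschitz_onI) (auto simp: dist_real_def)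
  qed
  then show ?thesis
    unfolding gap_def[abs_def]
    by (intro continuous_intros) (auto simp: M.real_distribution_axioms N.real_distribution_axioms)
qed

definition I :: "real set" where "I = potential_gap \<mu> \<nu>"

lemma mem_I: "r \<in> I \<longleftrightarrow> 0 < gap r"
  by (auto simp: I_def potential_gap_def gap_def)

lemma open_I: "open I"
proof -
  have "I = {r. 0 < gap r}" using mem_I by auto
  then show ?thesis
    using continuous_gap by (auto intro!: open_Collect_less continuous_on_const)
qed

lemma gap_nonneg: "0 \<le> gap r"
proof -
  have "convex_on UNIV (\<lambda>y. \<bar>r - y\<bar>)"
  proof (rule convex_onI)
    fix t x y :: real assume t: "0 < t" "t < 1"
    have "r - ((1 - t) *\<^sub>R x + t *\<^sub>R y) = (1 - t) * (r - x) + t * (r - y)"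
      by (simp add: algebra_simps)
    then show "\<bar>r - ((1 - t) *\<^sub>R x + t *\<^sub>R y)\<bar> \<le> (1 - t) * \<bar>r - x\<bar> + t * \<bar>r - y\<bar>"
      using abs_triangle_ineq[of "(1 - t) * (r - x)" "t * (r - y)"] t by (simp add: abs_mult)
  qed auto
  from convex_order_integral[OF this] show ?thesis
    by (simp add: gap_def potential_function_def)
qed

lemma prob_I: "measure \<mu> I = 1"
  using irreducible M.prob_space unfolding irreducible_pair_def I_def by simp

lemma AE_I: "AE x in \<mu>. x \<in> I"
  by (rule M.AE_prob_1[OF prob_I])

lemma connected_I: "connected I"
  using irreducible unfolding irreducible_pair_def I_def by simp

lemma I_interval: "x \<in> I \<Longrightarrow> y \<in> I \<Longrightarrow> x \<le> z \<Longrightarrow> z \<le> y \<Longrightarrow> z \<in> I"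
  using connected_I unfolding connected_iff_interval by blast

lemma I_nonempty: "I \<noteq> {}"
  using prob_I by auto

text \<open>\<open>R\<close> and \<open>S\<close> are the excesses of \<open>f\<close> over its
  tangent at \<open>p\<close> on the left and at \<open>q\<close> on the right. Up to an affine
  function and an error \<open>e\<close> between 0 and \<open>(b - a) * (q - p)\<close>,
  \<open>f\<close> is \<open>R + S\<close> plus a kink of size \<open>b - a\<close> at
  \<open>p\<close>. The kink contributes \<open>(b - a) * gap p / 2\<close> to the difference of the
  integrals, at least twice \<open>(b - a) * (q - p)\<close> by the constant 4: one half pays for
  \<open>e\<close>, the other is kept. What remains are three nonnegative terms with sum at most
  \<open>C\<close>.\<close>

lemma slope_gap:
  assumes f: "convex_on UNIV f" "\<And>y. 0 \<le> f y" "integrable \<nu> f"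
    and C: "integral\<^sup>L \<nu> f - integral\<^sup>L \<mu> f \<le> C" and pq: "p < q"
    and a: "\<And>y. f p + a * (y - p) \<le> f y" and b: "\<And>y. f q + b * (y - q) \<le> f y"
    and gap: "4 * (q - p) \<le> gap p"
  defines "R \<equiv> (\<lambda>y. f (min y p) - f p - a * (min y p - p))"
    and "S \<equiv> (\<lambda>y. f (max y q) - f q - b * (max y q - q))"
  shows "(b - a) * (q - p) \<le> C"
    and "integrable \<mu> R" "integrable \<nu> R" "integral\<^sup>L \<nu> R - integral\<^sup>L \<mu> R \<le> C"
    and "integrable \<mu> S" "integrable \<nu> S" "integral\<^sup>L \<nu> S - integral\<^sup>L \<mu> S \<le> C"
proof -
  have f_int: "integrable \<mu> f" by (rule convex_integrable_\<mu>[OF f])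
  define g where "g y = f y - f p - a * (y - p)" for y
  define k where "k y = f y - f q - b * (y - q)" for y
  have g: "convex_on UNIV g" "\<And>y. 0 \<le> g y" "g p = 0"
    unfolding g_def[abs_def]
    by (rule convex_on_diff_affine[OF f(1)]) (use a in \<open>simp_all add: algebra_simps\<close>)
  have k: "convex_on UNIV k" "\<And>y. 0 \<le> k y" "k q = 0"
    unfolding k_def[abs_def]
    by (rule convex_on_diff_affine[OF f(1)]) (use b in \<open>simp_all add: algebra_simps\<close>)
  have R: "R = (\<lambda>y. g (min y p))" and S: "S = (\<lambda>y. k (max y q))"
    by (simp_all add: R_def S_def g_def k_def)
  have R_conv: "convex_on UNIV R" and S_conv: "convex_on UNIV S"
    unfolding R S by (rule convex_on_comp_min[OF g], rule convex_on_comp_max[OF k])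
  have R_pos: "0 \<le> R y" and S_pos: "0 \<le> S y" for y
    unfolding R S using g k by auto
  have R_le: "R y \<le> g y" and S_le: "S y \<le> k y" for y
    unfolding R S using g k by (auto simp: min_def max_def)
  have gk_int: "integrable \<nu> g" "integrable \<nu> k"
    unfolding g_def[abs_def] k_def[abs_def] using f(3) by auto
  show R_int\<nu>: "integrable \<nu> R"
  proof (rule Bochner_Integration.integrable_bound[OF gk_int(1)])
    show "R \<in> borel_measurable \<nu>" using borel_measurable_convex[OF R_conv] by simp
    show "AE x in \<nu>. norm (R x) \<le> norm (g x)" using R_pos R_le g(2) by (intro AE_I2) auto
  qed
  show S_int\<nu>: "integrable \<nu> S"
  proof (rule Bochner_Integration.integrable_bound[OF gk_int(2)])
    show "S \<in> borel_measurable \<nu>" using borel_measurable_convex[OF S_conv] by simp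
    show "AE x in \<nu>. norm (S x) \<le> norm (k x)" using S_pos S_le k(2) by (intro AE_I2) auto
  qed
  show R_int\<mu>: "integrable \<mu> R" and S_int\<mu>: "integrable \<mu> S"
    using convex_integrable_\<mu> R_conv R_pos R_int\<nu> S_conv S_pos S_int\<nu> by auto
  have R_gap: "integral\<^sup>L \<mu> R \<le> integral\<^sup>L \<nu> R" and S_gap: "integral\<^sup>L \<mu> S \<le> integral\<^sup>L \<nu> S"
    using convex_gap_nonneg R_conv R_pos R_int\<nu> S_conv S_pos S_int\<nu> by auto
  have ab: "a \<le> b"
  proof -
    have "a * (q - p) \<le> b * (q - p)"
      using a[of q] b[of p] by (simp add: algebra_simps)
    then show ?thesis using pq by simp
  qed
  \<comment> \<open>Outside \<open>{p<..<q}\<close> the function \<open>f - R - S\<close> is affine, so up to \<open>e\<close> it is a kink at \<open>p\<close>.\<close>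
  define e where "e y = f p + a * (y - p) + (b - a) * max 0 (y - p) - (f y - R y - S y)" for y
  have e: "0 \<le> e y \<and> e y \<le> (b - a) * (q - p)" for y
  proof -
    consider "y \<le> p" | "p < y" "y < q" | "q \<le> y" by linarith
    then show ?thesis
    proof cases
      case 1
      then have "e y = 0"
        using pq by (simp add: e_def R_def S_def min_def max_def algebra_simps)
      then show ?thesis using ab pq by simp
    next
      case 2
      then have e_eq: "e y = f p + b * (y - p) - f y"
        by (simp add: e_def R_def S_def min_def max_def algebra_simps)
      define l where "l = (y - p) / (q - p)"
      have l: "0 \<le> l" "l \<le> 1" using 2 by (auto simp: l_def field_simps)
      have lq: "l * (q - p) = y - p" using pq by (simp add: l_def)
      then have "y = (1 - l) *\<^sub>R p + l *\<^sub>R q" by (simp add: algebra_simps)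
      then have "f y \<le> (1 - l) * f p + l * f q"
        using convex_onD[OF f(1) l, of p q] by simp
      also have "\<dots> = f p + l * (f q - f p)" by (simp add: algebra_simps)
      also have "\<dots> \<le> f p + l * (b * (q - p))"
        using b[of p] l by (intro add_left_mono mult_left_mono) (auto simp: algebra_simps)
      also have "\<dots> = f p + b * (y - p)" using lq by (metis mult.left_commute)
      finally have "0 \<le> e y" unfolding e_eq by simp
      moreover have "e y \<le> (b - a) * (y - p)"
        unfolding e_eq using a[of y] by (simp add: algebra_simps)
      moreover have "(b - a) * (y - p) \<le> (b - a) * (q - p)"
        using ab 2 by (intro mult_left_mono) auto
      ultimately show ?thesis by linarith
    next
      case 3
      then have e_eq: "e y = f p + b * (q - p) - f q"
        using pq by (simp add: e_def R_def S_def min_def max_def algebra_simps)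
      show ?thesis
        unfolding e_eq using a[of q] b[of p] by (simp add: algebra_simps)
    qed
  qed
  define J where "J X = (\<integral>y. max 0 (y - p) \<partial>X)" for X :: "real measure"
  have e_int: "integrable \<mu> e" "integrable \<nu> e"
    unfolding e_def[abs_def] using f_int f(3) R_int\<mu> R_int\<nu> S_int\<mu> S_int\<nu> by auto
  have f_eq: "f = (\<lambda>y. R y + S y + (f p + a * (y - p)) + (b - a) * max 0 (y - p) - e y)"
    by (simp add: e_def fun_eq_iff)
  have int_f: "integral\<^sup>L \<mu> f = integral\<^sup>L \<mu> R + integral\<^sup>L \<mu> S
      + (f p + a * (integral\<^sup>L \<mu> (\<lambda>x. x) - p)) + (b - a) * J \<mu> - integral\<^sup>L \<mu> e"
    using R_int\<mu> S_int\<mu> e_int by (subst f_eq) (simp add: J_def)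
  have int_f': "integral\<^sup>L \<nu> f = integral\<^sup>L \<nu> R + integral\<^sup>L \<nu> S
      + (f p + a * (integral\<^sup>L \<nu> (\<lambda>x. x) - p)) + (b - a) * J \<nu> - integral\<^sup>L \<nu> e"
    using R_int\<nu> S_int\<nu> e_int by (subst f_eq) (simp add: J_def)
  have e\<mu>: "0 \<le> integral\<^sup>L \<mu> e" using e by (intro Bochner_Integration.integral_nonneg) auto
  have e\<nu>: "integral\<^sup>L \<nu> e \<le> (b - a) * (q - p)"
    using integral_mono[OF e_int(2), of "\<lambda>_. (b - a) * (q - p)"] e by simp
  have "(b - a) * (2 * (q - p)) \<le> (b - a) * (J \<nu> - J \<mu>)"
    using gap_pos_part[of p] gap ab by (intro mult_left_mono) (auto simp: J_def)
  then have key: "(b - a) * (q - p) + (b - a) * (q - p) \<le> (b - a) * J \<nu> - (b - a) * J \<mu>"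
    by (simp add: algebra_simps)
  have main: "(b - a) * (q - p) + (integral\<^sup>L \<nu> R - integral\<^sup>L \<mu> R) + (integral\<^sup>L \<nu> S - integral\<^sup>L \<mu> S) \<le> C"
    using key C e\<mu> e\<nu> int_f int_f' unfolding mean_eq by linarith
  have "0 \<le> (b - a) * (q - p)" using ab pq by simp
  with main R_gap S_gap show "(b - a) * (q - p) \<le> C"
    "integral\<^sup>L \<nu> R - integral\<^sup>L \<mu> R \<le> C" "integral\<^sup>L \<nu> S - integral\<^sup>L \<mu> S \<le> C"
    by linarith+
qed

section \<open>Pointwise bounds uniform over normalised convex functions of bounded gap\<close>

definition bounded_gap_convex :: "real \<Rightarrow> real \<Rightarrow> (real \<Rightarrow> real) set" where
  "bounded_gap_convex a C = {f. convex_on UNIV f \<and> (\<forall>y. 0 \<le> f y) \<and> f a = 0 \<and> integrable \<nu> f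
     \<and> integral\<^sup>L \<nu> f - integral\<^sup>L \<mu> f \<le> C}"

lemma bounded_gap_convexD:
  assumes "f \<in> bounded_gap_convex a C"
  shows "convex_on UNIV f" "\<And>y. 0 \<le> f y" "f a = 0" "integrable \<nu> f"
    "integral\<^sup>L \<nu> f - integral\<^sup>L \<mu> f \<le> C"
  using assms unfolding bounded_gap_convex_def by auto

text \<open>The tangents at \<open>m - s\<close> and \<open>m + s\<close> bound the sum of the two
  values by \<open>2 * f m\<close> plus \<open>s\<close> times the slope difference, and
  \<open>slope_gap\<close> bounds the latter term by \<open>C / 2\<close>. Nonnegativity of
  \<open>f\<close> then separates the two values. The constant 8 is the 4 of
  \<open>slope_gap\<close> for points at distance \<open>2 * s\<close>.\<close>

lemma second_difference_bound:
  assumes f: "f \<in> bounded_gap_convex a C" and s: "s > 0" and gap: "8 * s \<le> gap (m - s)"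
  shows "f (m - s) \<le> 2 * f m + C" "f (m + s) \<le> 2 * f m + C"
proof -
  note f = bounded_gap_convexD[OF f]
  obtain \<alpha> where \<alpha>: "\<And>y. f (m - s) + \<alpha> * (y - (m - s)) \<le> f y"
    using convex_subgradient[OF f(1)] by blast
  obtain \<beta> where \<beta>: "\<And>y. f (m + s) + \<beta> * (y - (m + s)) \<le> f y"
    using convex_subgradient[OF f(1)] by blast
  have "(\<beta> - \<alpha>) * ((m + s) - (m - s)) \<le> C"
    by (rule slope_gap(1)[OF f(1,2,4,5) _ \<alpha> \<beta>]) (use s gap in auto)
  moreover have "f (m - s) + f (m + s) + (\<alpha> - \<beta>) * s \<le> 2 * f m"
    using \<alpha>[of m] \<beta>[of m] by (simp add: algebra_simps)
  moreover have "0 \<le> C"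
    using f(5) convex_gap_nonneg[OF f(1,2,4)] by linarith
  ultimately show "f (m - s) \<le> 2 * f m + C" "f (m + s) \<le> 2 * f m + C"
    using f(2)[of "m - s"] f(2)[of "m + s"] by (auto simp: algebra_simps)
qed

lemma chain_bound:
  assumes f: "f \<in> bounded_gap_convex a C"
    and step: "\<And>j. j < n \<Longrightarrow> f (a + real (Suc j) * s) \<le> 2 * f (a + real j * s) + C"
  shows "f (a + real n * s) \<le> C * (2 ^ n - 1)"
  using step
proof (induction n)
  case 0
  then show ?case using bounded_gap_convexD(3)[OF f] by simp
next
  case (Suc n)
  then have "f (a + real n * s) \<le> C * (2 ^ n - 1)" by simp
  then show ?case using Suc.prems[of n] by (simp add: algebra_simps)
qed

text \<open>A chain of Harnack type: equal steps lead from \<open>a\<close>, where \<open>f\<close>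
  vanishes, to \<open>t\<close>, and each of them at most doubles the value and adds
  \<open>C\<close>. The number of steps depends on \<open>a\<close> and \<open>t\<close> only, so
  the bound is uniform in \<open>f\<close>.\<close>

lemma interior_bound:
  assumes a: "a \<in> I" and t: "t \<in> I"
  obtains K where "\<And>f. f \<in> bounded_gap_convex a C \<Longrightarrow> f t \<le> K"
proof -
  \<comment> \<open>A step to the right evaluates the gap one step to its left, so the compact
    interval needs a margin on the left.\<close>
  obtain \<eta> where \<eta>: "\<eta> > 0" "cball (min a t) \<eta> \<subseteq> I"
    using open_I open_contains_cball a t by (metis min_def)
  have sub: "{min a t - \<eta>..max a t} \<subseteq> I"
  proof
    fix x assume x: "x \<in> {min a t - \<eta>..max a t}"
    show "x \<in> I"
    proof (cases "x \<le> min a t")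
      case True
      then have "x \<in> cball (min a t) \<eta>" using x \<eta> by (auto simp: dist_real_def)
      then show ?thesis using \<eta> by blast
    next
      case False
      then show ?thesis using I_interval[of "min a t" "max a t" x] a t x
        by (auto simp: min_def max_def split: if_splits)
    qed
  qed
  obtain x0 where x0: "x0 \<in> {min a t - \<eta>..max a t}" "\<And>x. x \<in> {min a t - \<eta>..max a t} \<Longrightarrow> gap x0 \<le> gap x"
    using continuous_attains_inf[of "{min a t - \<eta>..max a t}" gap] continuous_on_subset[OF continuous_gap] \<eta>
    by (auto simp: min_def max_def split: if_splits)
  have gap0: "gap x0 > 0" using x0(1) sub mem_I by blast
  \<comment> \<open>Here \<open>gap x0\<close> is the minimum of the gap on that interval, and 8 is
    the constant of \<open>second_difference_bound\<close>.\<close>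
  define \<epsilon> where "\<epsilon> = min \<eta> (gap x0 / 8)"
  have \<epsilon>: "\<epsilon> > 0" using \<eta> gap0 by (simp add: \<epsilon>_def)
  obtain n where n: "\<bar>t - a\<bar> < real n * \<epsilon>"
    using reals_Archimedean3[OF \<epsilon>] by blast
  then have n0: "n > 0" by (cases n) auto
  define s where "s = (t - a) / real n"
  have s_le: "\<bar>s\<bar> \<le> \<epsilon>"
    using n n0 by (simp add: s_def field_simps abs_divide)
  have t_eq: "t = a + real n * s" using n0 by (simp add: s_def)
  have "f t \<le> C * (2 ^ n - 1)" if f: "f \<in> bounded_gap_convex a C" for f
  proof (cases "s = 0")
    case True
    then show ?thesis
      using chain_bound[OF f, of n 0] t_eq bounded_gap_convexD[OF f] convex_gap_nonneg[of f] by simp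
  next
    case False
    have "f (a + real (Suc j) * s) \<le> 2 * f (a + real j * s) + C" if j: "j < n" for j
    proof (cases "s > 0")
      case True
      have "real j * s \<le> real n * s" using j True by (intro mult_right_mono) auto
      moreover have pos: "0 \<le> real j * s" "s \<le> \<eta>" "0 \<le> real n * s"
        using True s_le by (auto simp: \<epsilon>_def)
      moreover have minmax: "min a t = a" "max a t = t"
        using t_eq pos(3) by auto
      ultimately have "a + real j * s - s \<in> {min a t - \<eta>..max a t}"
        unfolding atLeastAtMost_iff minmax using True t_eq by linarith
      from x0(2)[OF this] have "8 * s \<le> gap (a + real j * s - s)"
        using s_le True by (simp add: \<epsilon>_def)
      from second_difference_bound(2)[OF f True this] show ?thesis
        by (simp add: algebra_simps)
    next
      case neg: False
      have "real n * s \<le> real (Suc j) * s"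
        using j neg by (intro mult_right_mono_neg) auto
      moreover have "real (Suc j) * s \<le> 0" using neg by (simp add: mult_nonneg_nonpos)
      ultimately have "a + real j * s - (- s) \<in> {min a t - \<eta>..max a t}"
        using t_eq \<eta> by (auto simp: min_def max_def algebra_simps)
      from x0(2)[OF this] have "8 * (- s) \<le> gap (a + real j * s - (- s))"
        using s_le neg by (simp add: \<epsilon>_def)
      from second_difference_bound(1)[OF f _ this] show ?thesis
        using neg False by (simp add: algebra_simps)
    qed
    then show ?thesis using chain_bound[OF f] t_eq by simp
  qed
  then show thesis by (rule that)
qed

section \<open>Position of the mass of \<nu> relative to \<open>I\<close>, and bounds at atoms on
  its boundary\<close>

lemma AE_\<mu>_less_all: "\<forall>x\<in>I. x < t \<Longrightarrow> AE x in \<mu>. x < t"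
  using AE_I by (auto elim: AE_mp)

lemma AE_\<mu>_greater_all: "\<forall>x\<in>I. t < x \<Longrightarrow> AE x in \<mu>. t < x"
  using AE_I by (auto elim: AE_mp)

text \<open>Off \<open>I\<close> the gap vanishes, so the positive part of \<open>y - t\<close> has
  the same integral under \<nu> as under \<mu>, namely 0.\<close>

lemma \<nu>_null_above:
  assumes "AE x in \<mu>. x \<le> t" "t \<notin> I"
  shows "AE y in \<nu>. y \<le> t"
proof -
  have "(\<integral>y. max 0 (y - t) \<partial>\<mu>) = (\<integral>y. 0 \<partial>\<mu>)"
    using assms(1) by (intro integral_cong_AE) auto
  then have "(\<integral>y. max 0 (y - t) \<partial>\<nu>) = 0"
    using gap_pos_part[of t] assms(2) mem_I[of t] gap_nonneg[of t] by simp
  then have "AE y in \<nu>. max 0 (y - t) = 0"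
    by (subst (asm) integral_nonneg_eq_0_iff_AE) auto
  then show ?thesis by eventually_elim (auto simp: max_def split: if_splits)
qed

lemma \<nu>_null_below:
  assumes "AE x in \<mu>. t \<le> x" "t \<notin> I"
  shows "AE y in \<nu>. t \<le> y"
proof -
  have "(\<integral>y. max 0 (t - y) \<partial>\<mu>) = (\<integral>y. 0 \<partial>\<mu>)"
    using assms(1) by (intro integral_cong_AE) auto
  then have "(\<integral>y. max 0 (t - y) \<partial>\<nu>) = 0"
    using gap_neg_part[of t] assms(2) mem_I[of t] gap_nonneg[of t] by simp
  then have "AE y in \<nu>. max 0 (t - y) = 0"
    by (subst (asm) integral_nonneg_eq_0_iff_AE) auto
  then show ?thesis by eventually_elim (auto simp: max_def split: if_splits)
qed

text \<open>A positive gap at \<open>x\<close> means that the positive part of \<open>y - x\<close>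
  has a strictly larger integral under \<nu> than under \<mu>, hence a positive one.\<close>

lemma \<nu>_charges_above:
  assumes "x \<in> I"
  shows "\<not> (AE y in \<nu>. y \<le> x)"
proof
  assume "AE y in \<nu>. y \<le> x"
  then have "(\<integral>y. max 0 (y - x) \<partial>\<nu>) = (\<integral>y. 0 \<partial>\<nu>)"
    by (intro integral_cong_AE) auto
  then have "(\<integral>y. max 0 (y - x) \<partial>\<nu>) = 0"
    by simp
  moreover have "0 \<le> (\<integral>y. max 0 (y - x) \<partial>\<mu>)"
    by (intro Bochner_Integration.integral_nonneg) auto
  ultimately show False
    using gap_pos_part[of x] assms[unfolded mem_I] by linarith
qed

lemma \<nu>_charges_below:
  assumes "x \<in> I"
  shows "\<not> (AE y in \<nu>. x \<le> y)"
proof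
  assume "AE y in \<nu>. x \<le> y"
  then have "(\<integral>y. max 0 (x - y) \<partial>\<nu>) = (\<integral>y. 0 \<partial>\<nu>)"
    by (intro integral_cong_AE) auto
  then have "(\<integral>y. max 0 (x - y) \<partial>\<nu>) = 0"
    by simp
  moreover have "0 \<le> (\<integral>y. max 0 (x - y) \<partial>\<mu>)"
    by (intro Bochner_Integration.integral_nonneg) auto
  ultimately show False
    using gap_neg_part[of x] assms[unfolded mem_I] by linarith
qed

lemma not_AE_atom:
  assumes "measure \<nu> {t} > 0" "\<not> P t"
  shows "\<not> (AE y in \<nu>. P y)"
proof
  assume "AE y in \<nu>. P y"
  then have "AE y in \<nu>. y \<noteq> t" by eventually_elim (use assms(2) in auto)
  then have "measure \<nu> {t} = 0"
    by (subst (asm) AE_iff_measurable[of "{t}"]) (auto simp: measure_def)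
  with assms(1) show False by simp
qed

text \<open>As \<open>p\<close> tends to \<open>q\<close> from the left, \<open>4 * (q - p)\<close>
  tends to 0 while the gap stays near its positive value at \<open>q\<close>. This provides the
  hypothesis of \<open>slope_gap\<close>.\<close>

lemma near_pair:
  assumes q: "q \<in> I"
  obtains p where "p < q" "p \<in> I" "4 * (q - p) \<le> gap p"
proof -
  have "isCont (\<lambda>p. gap p - 4 * (q - p)) q"
    using continuous_gap by (intro continuous_intros) (simp add: continuous_on_eq_continuous_at)
  then have "((\<lambda>p. gap p - 4 * (q - p)) \<longlongrightarrow> gap q - 4 * (q - q)) (at_left q)"
    unfolding isCont_def by (rule tendsto_mono[rotated]) (simp add: at_le)
  then have "\<forall>\<^sub>F p in at_left q. 0 < gap p - 4 * (q - p)"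
    using q mem_I by (intro order_tendstoD) auto
  moreover have "\<forall>\<^sub>F p in at_left q. p < q"
    by (simp add: eventually_at_filter)
  ultimately have "\<forall>\<^sub>F p in at_left q. 0 < gap p - 4 * (q - p) \<and> p < q"
    by eventually_elim auto
  then obtain p where "0 < gap p - 4 * (q - p)" "p < q"
    using eventually_happens[of _ "at_left q"] by (auto simp: trivial_limit_at_left_real)
  then show thesis
    using that[of p] mem_I[of p] by auto
qed

text \<open>The excess \<open>S\<close> over the tangent at \<open>q\<close> increases up to
  \<open>t\<close> and vanishes left of \<open>q\<close>. Its \<nu>-integral is at least
  \<open>S t\<close> times the atom, its \<mu>-integral at most \<open>S t\<close> times half the
  atom, and the difference is at most \<open>C\<close>. This bounds \<open>S t\<close>; the tangent
  itself is bounded by values inside \<open>I\<close>.\<close>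

lemma right_endpoint_bound:
  assumes a: "a \<in> I" and t: "\<forall>x\<in>I. x < t" and atom: "measure \<nu> {t} > 0"
  obtains K where "\<And>f. f \<in> bounded_gap_convex a C \<Longrightarrow> f t \<le> K"
proof -
  obtain s where s: "s < t" "measure \<mu> {s<..<t} < measure \<nu> {t} / 2"
    using M.measure_small_left_interval[of "measure \<nu> {t} / 2" t] atom by auto
  \<comment> \<open>\<open>I\<close> must reach beyond \<open>s\<close>; otherwise \<nu> would be
    carried by a half-line ending before \<open>t\<close>, against the atom at
    \<open>t\<close>.\<close>
  have "\<exists>x\<in>I. s < x"
  proof (rule ccontr)
    assume "\<not> ?thesis"
    then have below: "\<forall>x\<in>I. x < (s + t) / 2" using s(1) by force
    then have "(s + t) / 2 \<notin> I" by blast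
    moreover have "AE x in \<mu>. x \<le> (s + t) / 2"
      using AE_\<mu>_less_all[OF below] by eventually_elim simp
    ultimately have "AE y in \<nu>. y \<le> (s + t) / 2"
      by (intro \<nu>_null_above)
    with not_AE_atom[OF atom, of "\<lambda>y. y \<le> (s + t) / 2"] s(1) show False by simp
  qed
  then obtain q where q: "q \<in> I" "s < q" by blast
  \<comment> \<open>A second inner point: the tangent at \<open>q\<close> lies below
    \<open>f\<close> at \<open>q'\<close>, so the bound there limits its slope.\<close>
  obtain q' where q': "q' \<in> I" "q < q'"
  proof -
    obtain e where "e > 0" "ball q e \<subseteq> I" using open_I q open_contains_ball by blast
    then show thesis using that[of "q + e / 2"] by (auto simp: dist_real_def subset_eq)
  qed
  obtain p where p: "p < q" "p \<in> I" "4 * (q - p) \<le> gap p" using near_pair[OF q(1)] by blast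
  obtain K1 where K1: "\<And>f. f \<in> bounded_gap_convex a C \<Longrightarrow> f q \<le> K1"
    using interior_bound[OF a q(1)] by blast
  obtain K2 where K2: "\<And>f. f \<in> bounded_gap_convex a C \<Longrightarrow> f q' \<le> K2"
    using interior_bound[OF a q'(1)] by blast
  have qt: "q < t" using t q(1) by blast
  have "f t \<le> 2 * C / measure \<nu> {t} + K1 + K2 / (q' - q) * (t - q)" if f: "f \<in> bounded_gap_convex a C" for f
  proof -
    note f' = bounded_gap_convexD[OF f]
    obtain \<alpha> where \<alpha>: "\<And>y. f p + \<alpha> * (y - p) \<le> f y"
      using convex_subgradient[OF f'(1)] by blast
    obtain \<beta> where \<beta>: "\<And>y. f q + \<beta> * (y - q) \<le> f y"
      using convex_subgradient[OF f'(1)] by blast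
    define S where "S = (\<lambda>y. f (max y q) - f q - \<beta> * (max y q - q))"
    have S: "integrable \<mu> S" "integrable \<nu> S" "integral\<^sup>L \<nu> S - integral\<^sup>L \<mu> S \<le> C"
      using slope_gap(5,6,7)[OF f'(1,2,4,5) p(1) \<alpha> \<beta> p(3)] unfolding S_def by auto
    have S_pos: "0 \<le> S y" for y
      using \<beta>[of "max y q"] unfolding S_def by (simp add: algebra_simps)
    have S_conv: "convex_on UNIV (\<lambda>y. f y - f q - \<beta> * (y - q))"
      by (rule convex_on_diff_affine[OF f'(1)])
    have S_mono: "S y \<le> S t" if y: "y \<le> t" for y
    proof (cases "y \<le> q")
      case True
      then have "S y = 0" by (simp add: S_def max_def)
      then show ?thesis using S_pos[of t] by simp
    next
      case False
      define l where "l = (y - q) / (t - q)"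
      have l: "0 \<le> l" "l \<le> 1" using False y qt by (auto simp: l_def field_simps)
      have "l * (t - q) = y - q" using qt by (simp add: l_def)
      then have "y = (1 - l) *\<^sub>R q + l *\<^sub>R t" by (simp add: algebra_simps)
      then have "S y \<le> l * S t"
        using convex_onD[OF S_conv l, of q t] False qt by (simp add: S_def max_def)
      also have "\<dots> \<le> S t" using l S_pos[of t] by (simp add: mult_left_le_one_le)
      finally show ?thesis .
    qed
    have "S t * measure \<nu> {t} = (\<integral>y. S t * indicator {t} y \<partial>\<nu>)" by simp
    also have "\<dots> \<le> integral\<^sup>L \<nu> S"
      using S(2) S_pos by (intro integral_mono integrable_mult_right integrable_real_indicator)
        (auto simp: indicator_def N.emeasure_eq_measure)
    finally have lower: "S t * measure \<nu> {t} \<le> integral\<^sup>L \<nu> S" .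
    have "integral\<^sup>L \<mu> S \<le> (\<integral>y. S t * indicator {s<..<t} y \<partial>\<mu>)"
    proof (rule integral_mono_AE[OF S(1)])
      show "integrable \<mu> (\<lambda>y. S t * indicator {s<..<t} y)"
        by (intro integrable_mult_right integrable_real_indicator) (auto simp: M.emeasure_eq_measure)
      show "AE y in \<mu>. S y \<le> S t * indicator {s<..<t} y"
        using AE_\<mu>_less_all[OF t]
      proof eventually_elim
        case (elim y)
        show ?case
        proof (cases "y \<le> q")
          case True
          then have "S y = 0" by (simp add: S_def max_def)
          then show ?thesis using S_pos[of t] by (simp add: indicator_def)
        next
          case False
          then show ?thesis using elim S_mono[of y] q(2) by (simp add: indicator_def)
        qed
      qed
    qed
    also have "\<dots> = S t * measure \<mu> {s<..<t}" by simp
    also have "\<dots> \<le> S t * (measure \<nu> {t} / 2)"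
      using s(2) S_pos[of t] by (intro mult_left_mono) auto
    finally have "S t * (measure \<nu> {t} / 2) \<le> C"
      using lower S(3) by (simp add: field_simps)
    then have S_t: "S t \<le> 2 * C / measure \<nu> {t}"
      using atom by (simp add: field_simps)
    have "\<beta> * (q' - q) \<le> K2"
      using \<beta>[of q'] K2[OF f] f'(2)[of q] by linarith
    then have "\<beta> \<le> K2 / (q' - q)"
      using q'(2) by (simp add: field_simps)
    then have "\<beta> * (t - q) \<le> K2 / (q' - q) * (t - q)"
      using qt by (intro mult_right_mono) auto
    moreover have "f t = S t + f q + \<beta> * (t - q)" using qt by (simp add: S_def max_def)
    ultimately show ?thesis using S_t K1[OF f] by linarith
  qed
  then show thesis by (rule that)
qed

text \<open>The mirror argument with the excess \<open>R\<close> over the tangent at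
  \<open>p\<close>. The pair is still chosen from \<open>q\<close> leftwards because
  \<open>slope_gap\<close> measures the gap at the left point, so a further point \<open>p'\<close>
  left of \<open>p\<close> is needed to bound the slope.\<close>

lemma left_endpoint_bound:
  assumes a: "a \<in> I" and t: "\<forall>x\<in>I. t < x" and atom: "measure \<nu> {t} > 0"
  obtains K where "\<And>f. f \<in> bounded_gap_convex a C \<Longrightarrow> f t \<le> K"
proof -
  obtain s where s: "t < s" "measure \<mu> {t<..<s} < measure \<nu> {t} / 2"
    using M.measure_small_right_interval[of "measure \<nu> {t} / 2" t] atom by auto
  have "\<exists>x\<in>I. x < s"
  proof (rule ccontr)
    assume "\<not> ?thesis"
    then have above: "\<forall>x\<in>I. (s + t) / 2 < x" using s(1) by force
    then have "(s + t) / 2 \<notin> I" by blast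
    moreover have "AE x in \<mu>. (s + t) / 2 \<le> x"
      using AE_\<mu>_greater_all[OF above] by eventually_elim simp
    ultimately have "AE y in \<nu>. (s + t) / 2 \<le> y"
      by (intro \<nu>_null_below)
    with not_AE_atom[OF atom, of "\<lambda>y. (s + t) / 2 \<le> y"] s(1) show False by simp
  qed
  then obtain q where q: "q \<in> I" "q < s" by blast
  obtain p where p: "p < q" "p \<in> I" "4 * (q - p) \<le> gap p" using near_pair[OF q(1)] by blast
  obtain p' where p': "p' \<in> I" "p' < p" using near_pair[OF p(2)] by blast
  obtain K1 where K1: "\<And>f. f \<in> bounded_gap_convex a C \<Longrightarrow> f p \<le> K1"
    using interior_bound[OF a p(2)] by blast
  obtain K2 where K2: "\<And>f. f \<in> bounded_gap_convex a C \<Longrightarrow> f p' \<le> K2"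
    using interior_bound[OF a p'(1)] by blast
  have tp: "t < p" using t p(2) by blast
  have "f t \<le> 2 * C / measure \<nu> {t} + K1 + K2 / (p - p') * (p - t)" if f: "f \<in> bounded_gap_convex a C" for f
  proof -
    note f' = bounded_gap_convexD[OF f]
    obtain \<alpha> where \<alpha>: "\<And>y. f p + \<alpha> * (y - p) \<le> f y"
      using convex_subgradient[OF f'(1)] by blast
    obtain \<beta> where \<beta>: "\<And>y. f q + \<beta> * (y - q) \<le> f y"
      using convex_subgradient[OF f'(1)] by blast
    define R where "R = (\<lambda>y. f (min y p) - f p - \<alpha> * (min y p - p))"
    have R: "integrable \<mu> R" "integrable \<nu> R" "integral\<^sup>L \<nu> R - integral\<^sup>L \<mu> R \<le> C"
      using slope_gap(2,3,4)[OF f'(1,2,4,5) p(1) \<alpha> \<beta> p(3)] unfolding R_def by auto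
    have R_pos: "0 \<le> R y" for y
      using \<alpha>[of "min y p"] unfolding R_def by (simp add: algebra_simps)
    have R_conv: "convex_on UNIV (\<lambda>y. f y - f p - \<alpha> * (y - p))"
      by (rule convex_on_diff_affine[OF f'(1)])
    have R_mono: "R y \<le> R t" if y: "t \<le> y" for y
    proof (cases "p \<le> y")
      case True
      then have "R y = 0" by (simp add: R_def min_def)
      then show ?thesis using R_pos[of t] by simp
    next
      case False
      define l where "l = (p - y) / (p - t)"
      have l: "0 \<le> l" "l \<le> 1" using False y tp by (auto simp: l_def field_simps)
      have "l * (p - t) = p - y" using tp by (simp add: l_def)
      then have "y = (1 - l) *\<^sub>R p + l *\<^sub>R t" by (simp add: algebra_simps)
      then have "R y \<le> l * R t"
        using convex_onD[OF R_conv l, of p t] False tp by (simp add: R_def min_def)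
      also have "\<dots> \<le> R t" using l R_pos[of t] by (simp add: mult_left_le_one_le)
      finally show ?thesis .
    qed
    have "R t * measure \<nu> {t} = (\<integral>y. R t * indicator {t} y \<partial>\<nu>)" by simp
    also have "\<dots> \<le> integral\<^sup>L \<nu> R"
      using R(2) R_pos by (intro integral_mono integrable_mult_right integrable_real_indicator)
        (auto simp: indicator_def N.emeasure_eq_measure)
    finally have lower: "R t * measure \<nu> {t} \<le> integral\<^sup>L \<nu> R" .
    have "integral\<^sup>L \<mu> R \<le> (\<integral>y. R t * indicator {t<..<s} y \<partial>\<mu>)"
    proof (rule integral_mono_AE[OF R(1)])
      show "integrable \<mu> (\<lambda>y. R t * indicator {t<..<s} y)"
        by (intro integrable_mult_right integrable_real_indicator) (auto simp: M.emeasure_eq_measure)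
      show "AE y in \<mu>. R y \<le> R t * indicator {t<..<s} y"
        using AE_\<mu>_greater_all[OF t]
      proof eventually_elim
        case (elim y)
        show ?case
        proof (cases "p \<le> y")
          case True
          then have "R y = 0" by (simp add: R_def min_def)
          then show ?thesis using R_pos[of t] by (simp add: indicator_def)
        next
          case False
          then show ?thesis using elim R_mono[of y] q(2) p(1) by (simp add: indicator_def)
        qed
      qed
    qed
    also have "\<dots> = R t * measure \<mu> {t<..<s}" by simp
    also have "\<dots> \<le> R t * (measure \<nu> {t} / 2)"
      using s(2) R_pos[of t] by (intro mult_left_mono) auto
    finally have "R t * (measure \<nu> {t} / 2) \<le> C"
      using lower R(3) by (simp add: field_simps)
    then have R_t: "R t \<le> 2 * C / measure \<nu> {t}"
      using atom by (simp add: field_simps)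
    have "(- \<alpha>) * (p - p') \<le> K2"
      using \<alpha>[of p'] K2[OF f] f'(2)[of p] by (simp add: algebra_simps)
    then have "- \<alpha> \<le> K2 / (p - p')"
      using p'(2) by (simp add: field_simps)
    then have "(- \<alpha>) * (p - t) \<le> K2 / (p - p') * (p - t)"
      using tp by (intro mult_right_mono) auto
    moreover have "f t = R t + f p + (- \<alpha>) * (p - t)" using tp by (simp add: R_def min_def algebra_simps)
    ultimately show ?thesis using R_t K1[OF f] by linarith
  qed
  then show thesis by (rule that)
qed

lemma pointwise_bound:
  assumes a: "a \<in> I" and t: "t \<in> I \<or> measure \<nu> {t} > 0"
  obtains K where "\<And>f. f \<in> bounded_gap_convex a C \<Longrightarrow> f t \<le> K"
proof (cases "t \<in> I")
  case True
  then show thesis using interior_bound[OF a] that by blast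
next
  case False
  have "(\<forall>x\<in>I. x < t) \<or> (\<forall>x\<in>I. t < x)"
    using I_interval False by (metis linorder_neqE_linordered_idom order_less_imp_le)
  then show thesis
    using right_endpoint_bound[OF a] left_endpoint_bound[OF a] False t that by meson
qed

text \<open>\<nu> is carried by \<open>I\<close> and its finite endpoints; an endpoint that is not
  an atom is a null set.\<close>

lemma AE_\<nu>_inner: "AE y in \<nu>. y \<in> I \<or> measure \<nu> {y} > 0"
proof -
  have up: "AE y in \<nu>. (\<forall>x\<in>I. x < y) \<longrightarrow> measure \<nu> {y} > 0"
  proof (cases "bdd_above I")
    case False
    then have "\<not> (\<forall>x\<in>I. x < y)" for y
      by (meson bdd_aboveI less_imp_le)
    then show ?thesis by (intro AE_I2) blast
  next
    case True
    define b where "b = Sup I"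
    have le: "x \<le> b" if "x \<in> I" for x
      using that True unfolding b_def by (rule cSup_upper)
    have "b \<notin> I"
    proof
      assume "b \<in> I"
      then obtain e where "e > 0" "ball b e \<subseteq> I" using open_I open_contains_ball by blast
      then have "b + e / 2 \<in> I" by (auto simp: dist_real_def subset_eq)
      with le \<open>e > 0\<close> show False by fastforce
    qed
    then have less: "\<forall>x\<in>I. x < b"
      using le by (metis order_le_less)
    have "AE y in \<nu>. y \<le> b"
    proof (rule \<nu>_null_above[OF _ \<open>b \<notin> I\<close>])
      show "AE x in \<mu>. x \<le> b"
        using AE_\<mu>_less_all[OF less] by eventually_elim simp
    qed
    moreover have "AE y in \<nu>. y = b \<longrightarrow> measure \<nu> {y} > 0"
    proof (cases "measure \<nu> {b} > 0")
      case False
      then have "measure \<nu> {b} = 0" using zero_less_measure_iff by blast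
      then have "AE y in \<nu>. y \<noteq> b"
        by (subst AE_iff_measurable[of "{b}"]) (auto simp: N.emeasure_eq_measure)
      then show ?thesis by eventually_elim simp
    qed auto
    ultimately show ?thesis
    proof eventually_elim
      case (elim y)
      have "b \<le> y" if "\<forall>x\<in>I. x < y"
        unfolding b_def using that I_nonempty by (intro cSup_least) (auto intro: less_imp_le)
      with elim show ?case by auto
    qed
  qed
  have dn: "AE y in \<nu>. (\<forall>x\<in>I. y < x) \<longrightarrow> measure \<nu> {y} > 0"
  proof (cases "bdd_below I")
    case False
    then have "\<not> (\<forall>x\<in>I. y < x)" for y
      by (meson bdd_belowI less_imp_le)
    then show ?thesis by (intro AE_I2) blast
  next
    case True
    define b where "b = Inf I"
    have le: "b \<le> x" if "x \<in> I" for x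
      using that True unfolding b_def by (rule cInf_lower)
    have "b \<notin> I"
    proof
      assume "b \<in> I"
      then obtain e where "e > 0" "ball b e \<subseteq> I" using open_I open_contains_ball by blast
      then have "b - e / 2 \<in> I" by (auto simp: dist_real_def subset_eq)
      with le \<open>e > 0\<close> show False by fastforce
    qed
    then have less: "\<forall>x\<in>I. b < x"
      using le by (metis order_le_less)
    have "AE y in \<nu>. b \<le> y"
    proof (rule \<nu>_null_below[OF _ \<open>b \<notin> I\<close>])
      show "AE x in \<mu>. b \<le> x"
        using AE_\<mu>_greater_all[OF less] by eventually_elim simp
    qed
    moreover have "AE y in \<nu>. y = b \<longrightarrow> measure \<nu> {y} > 0"
    proof (cases "measure \<nu> {b} > 0")
      case False
      then have "measure \<nu> {b} = 0" using zero_less_measure_iff by blast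
      then have "AE y in \<nu>. y \<noteq> b"
        by (subst AE_iff_measurable[of "{b}"]) (auto simp: N.emeasure_eq_measure)
      then show ?thesis by eventually_elim simp
    qed auto
    ultimately show ?thesis
    proof eventually_elim
      case (elim y)
      have "y \<le> b" if "\<forall>x\<in>I. y < x"
        unfolding b_def using that I_nonempty by (intro cInf_greatest) (auto intro: less_imp_le)
      with elim show ?case by auto
    qed
  qed
  from up dn show ?thesis
  proof eventually_elim
    case (elim y)
    show ?case
    proof (cases "y \<in> I")
      case False
      then have "(\<forall>x\<in>I. x < y) \<or> (\<forall>x\<in>I. y < x)"
        using I_interval by (metis linorder_neqE_linordered_idom order_less_imp_le)
      with elim show ?thesis by auto
    qed auto
  qed
qed

end

section \<open>Decoupling the dual constraint\<close>

text \<open>The coordinates of \<open>y\<close> vary independently, so the infimum of the sum is the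
  sum of the infima. Freezing all coordinates but one shows that each infimum is finite.\<close>

lemma sum_INF_ge:
  fixes b :: "'d::finite \<Rightarrow> real \<Rightarrow> real"
  assumes K: "\<And>y :: real ^ 'd. K \<le> (\<Sum>i\<in>UNIV. b i (y $ i))"
  shows "bdd_below (range (b i))" and "K \<le> (\<Sum>i\<in>UNIV. INF t. b i t)"
proof -
  show bdd: "bdd_below (range (b i))" for i
  proof (rule bdd_belowI2)
    fix t
    have "K \<le> (\<Sum>j\<in>UNIV. b j ((\<chi> j. if j = i then t else 0) $ j))" by (rule K)
    also have "\<dots> = b i t + (\<Sum>j\<in>UNIV - {i}. b j 0)"
      by (subst sum.remove[of UNIV i]) (auto intro!: sum.cong)
    finally show "K - (\<Sum>j\<in>UNIV - {i}. b j 0) \<le> b i t" by simp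
  qed
  show "K \<le> (\<Sum>i\<in>UNIV. INF t. b i t)"
  proof (rule field_le_epsilon)
    fix e :: real assume "e > 0"
    define d where "d = e / real CARD('d)"
    have "d > 0" using \<open>e > 0\<close> by (simp add: d_def)
    have "\<exists>t. b i t < (INF t. b i t) + d" for i
    proof -
      have "(INF t. b i t) < (INF t. b i t) + d" using \<open>d > 0\<close> by simp
      then show ?thesis
        using cINF_less_iff[OF _ bdd[of i], of "(INF t. b i t) + d"] by blast
    qed
    then obtain t where t: "\<And>i. b i (t i) < (INF t. b i t) + d" by metis
    have "K \<le> (\<Sum>i\<in>UNIV. b i ((\<chi> i. t i) $ i))" by (rule K)
    also have "\<dots> \<le> (\<Sum>i\<in>UNIV. (INF t. b i t) + d)"
      using t by (intro sum_mono) (simp add: less_imp_le)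
    also have "\<dots> = (\<Sum>i\<in>UNIV. INF t. b i t) + e"
      by (simp add: sum.distrib d_def)
    finally show "K \<le> (\<Sum>i\<in>UNIV. INF t. b i t) + e" .
  qed
qed

lemma convex_on_SUP:
  fixes l :: "'a \<Rightarrow> real \<Rightarrow> real"
  assumes bdd: "\<And>t. bdd_above (range (\<lambda>x. l x t))" and l: "\<And>x. convex_on UNIV (l x)"
  shows "convex_on UNIV (\<lambda>t. SUP x. l x t)"
proof (rule convex_onI)
  fix s u v :: real assume s: "0 < s" "s < 1"
  show "(SUP x. l x ((1 - s) *\<^sub>R u + s *\<^sub>R v)) \<le> (1 - s) * (SUP x. l x u) + s * (SUP x. l x v)"
  proof (rule cSUP_least)
    fix x
    have "l x ((1 - s) *\<^sub>R u + s *\<^sub>R v) \<le> (1 - s) * l x u + s * l x v"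
      using convex_onD[OF l, of s u v] s by simp
    also have "\<dots> \<le> (1 - s) * (SUP x. l x u) + s * (SUP x. l x v)"
      using s by (intro add_mono mult_left_mono cSUP_upper bdd) auto
    finally show "l x ((1 - s) *\<^sub>R u + s *\<^sub>R v) \<le> \<dots>" .
  qed auto
qed auto

text \<open>For fixed x the inequality separates in y, and minimising over each coordinate gives
  \<open>m x i\<close>. The line \<open>l i x\<close> of slope \<open>h i x\<close> through height
  \<open>m x i\<close> at \<open>x $ i\<close> lies below \<open>- \<psi> i\<close>, so the supremum
  \<open>f i\<close> of these lines is convex, lies below \<open>- \<psi> i\<close> and is at least
  \<open>m x i\<close> at \<open>x $ i\<close>. Comparison with \<phi> then separates a second time,
  now in x.\<close>

lemma dual_sum_decouple:
  fixes \<phi> \<psi> :: "'d::finite \<Rightarrow> real \<Rightarrow> real"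
  assumes neg: "\<And>z. dual_sum \<phi> \<psi> h z \<le> 0"
  obtains f r where "\<And>i. convex_on UNIV (f i)" "\<And>i t. f i t \<le> - \<psi> i t" "\<And>i t. \<phi> i t + r i \<le> f i t"
    "(\<Sum>i\<in>UNIV. r i) = (0::real)"
proof -
  define b where "b x i t = - \<psi> i t - h i x * (t - x $ i)" for x :: "real ^ 'd" and i t
  define m where "m x i = (INF t. b x i t)" for x i
  have K: "(\<Sum>i\<in>UNIV. \<phi> i (x $ i)) \<le> (\<Sum>i\<in>UNIV. b x i (y $ i))" for x y
    using neg[of "(x, y)"] unfolding dual_sum_def b_def
    by (simp add: sum.distrib sum_subtractf sum_negf)
  have m_le: "m x i \<le> b x i t" for x i t
    unfolding m_def by (rule cINF_lower[OF sum_INF_ge(1)[where b = "b x", OF K]]) simp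
  have m_sum: "(\<Sum>i\<in>UNIV. \<phi> i (x $ i)) \<le> (\<Sum>i\<in>UNIV. m x i)" for x
    unfolding m_def by (rule sum_INF_ge(2)[where b = "b x", OF K])
  define l where "l i x t = m x i + h i x * (t - x $ i)" for i x t
  have l_le: "l i x t \<le> - \<psi> i t" for i x t
    using m_le[of x i t] by (simp add: l_def b_def)
  define f where "f i t = (SUP x. l i x t)" for i t
  have bdd: "bdd_above (range (\<lambda>x. l i x t))" for i t
    using l_le by (intro bdd_aboveI2)
  have f_conv: "convex_on UNIV (f i)" for i
    unfolding f_def[abs_def]
  proof (rule convex_on_SUP[OF bdd])
    fix x show "convex_on UNIV (l i x)"
    proof (rule convex_onI)
      fix s u v :: real assume "0 < s" "s < 1"
      show "l i x ((1 - s) *\<^sub>R u + s *\<^sub>R v) \<le> (1 - s) * l i x u + s * l i x v"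
        by (simp add: l_def algebra_simps)
    qed auto
  qed
  have f_le: "f i t \<le> - \<psi> i t" for i t
    unfolding f_def using l_le by (intro cSUP_least) auto
  have f_ge: "m x i \<le> f i (x $ i)" for x i
  proof -
    have "l i x (x $ i) \<le> f i (x $ i)"
      unfolding f_def by (rule cSUP_upper[OF _ bdd]) simp
    then show ?thesis by (simp add: l_def)
  qed
  have D: "0 \<le> (\<Sum>i\<in>UNIV. f i (x $ i) - \<phi> i (x $ i))" for x
    using m_sum[of x] sum_mono[of UNIV "m x" "\<lambda>i. f i (x $ i)"] f_ge by (simp add: sum_subtractf)
  define q where "q i = (INF t. f i t - \<phi> i t)" for i
  have q_le: "q i \<le> f i t - \<phi> i t" for i t
    unfolding q_def by (rule cINF_lower[OF sum_INF_ge(1)[where b = "\<lambda>i t. f i t - \<phi> i t", OF D]]) simp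
  have q_sum: "0 \<le> (\<Sum>i\<in>UNIV. q i)"
    unfolding q_def by (rule sum_INF_ge(2)[where b = "\<lambda>i t. f i t - \<phi> i t", OF D])
  \<comment> \<open>The infima \<open>q i\<close> have a nonnegative sum; the surplus is spread
    evenly so that the shifts cancel.\<close>
  define r where "r i = q i - (\<Sum>i\<in>UNIV. q i) / real CARD('d)" for i
  have "r i \<le> q i" for i using q_sum by (simp add: r_def)
  then have "\<phi> i t + r i \<le> f i t" for i t using q_le[of i t] by (smt (verit))
  moreover have "(\<Sum>i\<in>UNIV. r i) = 0" by (simp add: r_def sum_subtractf)
  ultimately show thesis using that f_conv f_le by blast
qed

type_synonym 'd dual_tuple =
  "('d \<Rightarrow> real \<Rightarrow> real) \<times> ('d \<Rightarrow> real \<Rightarrow> real) \<times> ('d \<Rightarrow> real ^ 'd \<Rightarrow> real) \<times> ('d \<Rightarrow> real \<Rightarrow> real)"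

locale irreducible_marginals = marginals \<mu> \<nu> for \<mu> \<nu> :: "'d::finite \<Rightarrow> real measure" +
  assumes irr: "\<And>i. irreducible_pair (\<mu> i) (\<nu> i)"
begin

lemma irreducible_i: "irreducible (\<mu> i) (\<nu> i)"
  using \<mu> \<nu> \<mu>_moment \<nu>_moment irr by (intro irreducible.intro irreducible_axioms.intro)

definition inner :: "'d \<Rightarrow> real set" where "inner i = irreducible.I (\<mu> i) (\<nu> i)"

definition anchor :: "'d \<Rightarrow> real" where "anchor i = (SOME t. t \<in> inner i)"

lemma anchor_mem: "anchor i \<in> inner i"
  using irreducible.I_nonempty[OF irreducible_i, of i] unfolding anchor_def inner_def
  by (simp add: some_in_eq)

text \<open>The normalisation \<open>f (anchor i) = 0 \<le> f\<close> removes the affine freedom in \<open>\<psi>\<close>, which the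
  martingale constraint leaves undetermined.\<close>

definition candidates ::
  "((real ^ 'd) \<times> (real ^ 'd) \<Rightarrow> real) \<Rightarrow> real \<Rightarrow> 'd dual_tuple set" where
  "candidates c r = {(\<phi>, \<psi>, h, f). admissible \<phi> \<psi> h \<and> (\<forall>z. dual_sum \<phi> \<psi> h z \<le> c z) \<and> r \<le> dual_value \<phi> \<psi>
     \<and> (\<forall>i. convex_on UNIV (f i) \<and> f i (anchor i) = 0
         \<and> (\<forall>t. 0 \<le> f i t \<and> \<phi> i t \<le> f i t \<and> f i t \<le> - \<psi> i t))}"

lemma candidatesD:
  assumes "(\<phi>, \<psi>, h, f) \<in> candidates c r"
  shows "admissible \<phi> \<psi> h" "\<And>z. dual_sum \<phi> \<psi> h z \<le> c z" "r \<le> dual_value \<phi> \<psi>"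
    "\<And>i. convex_on UNIV (f i)" "\<And>i. f i (anchor i) = 0"
    "\<And>i t. 0 \<le> f i t" "\<And>i t. \<phi> i t \<le> f i t" "\<And>i t. f i t \<le> - \<psi> i t"
  using assms unfolding candidates_def by auto

text \<open>Subtracting from \<open>f i\<close> its supporting line at the anchor is compensated in
  \<phi>, \<psi> and \<open>h\<close>. The line cancels from the dual sum identically, and from the
  dual value because \<mu> and \<nu> have equal means.\<close>

lemma candidate_exists:
  assumes adm: "admissible \<phi> \<psi> h" and le: "\<And>z. dual_sum \<phi> \<psi> h z \<le> c z" and c: "\<And>z. c z \<le> 0"
  shows "candidates c (dual_value \<phi> \<psi>) \<noteq> {}"
proof -
  have "dual_sum \<phi> \<psi> h z \<le> 0" for z using le[of z] c[of z] by linarith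
  then obtain f r where f: "\<And>i. convex_on UNIV (f i)" "\<And>i t. f i t \<le> - \<psi> i t" "\<And>i t. \<phi> i t + r i \<le> f i t"
      and r: "(\<Sum>i\<in>UNIV. r i) = (0::real)"
    using dual_sum_decouple[of \<phi> \<psi> h] by blast
  have "\<forall>i. \<exists>\<alpha>. \<forall>y. f i (anchor i) + \<alpha> * (y - anchor i) \<le> f i y"
    using convex_subgradient[OF f(1)] by metis
  from choice[OF this] obtain \<alpha> where \<alpha>: "\<And>i y. f i (anchor i) + \<alpha> i * (y - anchor i) \<le> f i y"
    by blast
  define l where "l i y = f i (anchor i) + \<alpha> i * (y - anchor i)" for i y
  define \<phi>' where "\<phi>' i x = \<phi> i x + r i - l i x" for i x
  define \<psi>' where "\<psi>' i y = \<psi> i y + l i y" for i y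
  define h' where "h' i x = h i x - \<alpha> i" for i x
  define f' where "f' i y = f i y - l i y" for i y
  have l_int: "integrable (\<mu> i) (l i)" "integrable (\<nu> i) (l i)"
    "integral\<^sup>L (\<mu> i) (l i) = integral\<^sup>L (\<nu> i) (l i)" for i
  proof -
    interpret irreducible "\<mu> i" "\<nu> i" by (rule irreducible_i)
    show "integrable (\<mu> i) (l i)" "integrable (\<nu> i) (l i)" unfolding l_def by auto
    show "integral\<^sup>L (\<mu> i) (l i) = integral\<^sup>L (\<nu> i) (l i)"
      unfolding l_def using mean_eq by simp
  qed
  have adm': "admissible \<phi>' \<psi>' h'"
  proof (rule admissibleI)
    fix i
    show "integrable (\<mu> i) (\<phi>' i)" "integrable (\<nu> i) (\<psi>' i)"
      unfolding \<phi>'_def \<psi>'_def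
      by (intro Bochner_Integration.integrable_add Bochner_Integration.integrable_diff
          integrable_const l_int admissibleD(1,2)[OF adm])+
    show "h' i \<in> borel_measurable borel"
      unfolding h'_def using admissibleD(3)[OF adm, of i] by simp
    obtain B where "\<And>x. \<bar>h i x\<bar> \<le> B" using admissibleD(4)[OF adm, of i] by blast
    then have "\<bar>h' i x\<bar> \<le> B + \<bar>\<alpha> i\<bar>" for x
      unfolding h'_def using abs_triangle_ineq4[of "h i x" "\<alpha> i"] by (meson add_right_mono order_trans)
    then show "\<exists>B. \<forall>x. \<bar>h' i x\<bar> \<le> B" by blast
  qed
  have summand: "\<phi>' i x + \<psi>' i y + h' i w * (y - x) = (\<phi> i x + \<psi> i y + h i w * (y - x)) + r i" for i x y w
    by (simp add: \<phi>'_def \<psi>'_def h'_def l_def algebra_simps)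
  have "dual_sum \<phi>' \<psi>' h' z = dual_sum \<phi> \<psi> h z" for z
    unfolding dual_sum_def summand using r by (simp add: sum.distrib)
  moreover have "dual_value \<phi>' \<psi>' = dual_value \<phi> \<psi>"
  proof -
    have "integral\<^sup>L (\<mu> i) (\<phi>' i) + integral\<^sup>L (\<nu> i) (\<psi>' i)
        = (integral\<^sup>L (\<mu> i) (\<phi> i) + integral\<^sup>L (\<nu> i) (\<psi> i)) + r i" for i
    proof -
      have "integral\<^sup>L (\<mu> i) (\<phi>' i) = integral\<^sup>L (\<mu> i) (\<phi> i) + r i - integral\<^sup>L (\<mu> i) (l i)"
        unfolding \<phi>'_def using l_int integrable_const admissibleD(1)[OF adm]
        by (subst Bochner_Integration.integral_diff, simp, simp, subst Bochner_Integration.integral_add)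
          (simp_all only: integral_const simp_thms)
      moreover have "integral\<^sup>L (\<nu> i) (\<psi>' i) = integral\<^sup>L (\<nu> i) (\<psi> i) + integral\<^sup>L (\<nu> i) (l i)"
        unfolding \<psi>'_def by (intro Bochner_Integration.integral_add l_int admissibleD(2)[OF adm])
      ultimately show ?thesis using l_int(3)[of i] by simp
    qed
    then show ?thesis unfolding dual_value_def using r by (simp add: sum.distrib)
  qed
  moreover have "convex_on UNIV (f' i) \<and> f' i (anchor i) = 0
      \<and> (\<forall>t. 0 \<le> f' i t \<and> \<phi>' i t \<le> f' i t \<and> f' i t \<le> - \<psi>' i t)" for i
  proof (intro conjI allI)
    show "convex_on UNIV (f' i)"
      using convex_on_diff_affine[OF f(1)[of i], of "f i (anchor i)" "\<alpha> i" "anchor i"]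
      unfolding f'_def[abs_def] l_def by (simp add: diff_diff_eq)
    show "f' i (anchor i) = 0" by (simp add: f'_def l_def)
    fix t
    show "0 \<le> f' i t" using \<alpha>[of i t] by (simp add: f'_def l_def)
    show "\<phi>' i t \<le> f' i t" using f(3)[of i t] by (simp add: f'_def \<phi>'_def)
    show "f' i t \<le> - \<psi>' i t" using f(2)[of i t] by (simp add: f'_def \<psi>'_def)
  qed
  ultimately have "(\<phi>', \<psi>', h', f') \<in> candidates c (dual_value \<phi> \<psi>)"
    unfolding candidates_def using adm' le by auto
  then show ?thesis by blast
qed

text \<open>For each index the three nonnegative quantities add up to minus its share of the dual
  value, so each of them is at most \<open>C\<close>.\<close>

lemma candidates_bounds:
  assumes cand: "(\<phi>, \<psi>, h, f) \<in> candidates c r" and C: "- C \<le> r"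
  shows "f i \<in> irreducible.bounded_gap_convex (\<mu> i) (\<nu> i) (anchor i) C"
    and "integrable (\<mu> i) (f i)" "integrable (\<nu> i) (f i)"
    and "(\<integral>x. f i x - \<phi> i x \<partial>\<mu> i) \<le> C" and "(\<integral>y. - \<psi> i y - f i y \<partial>\<nu> i) \<le> C"
proof -
  note cd = candidatesD[OF cand]
  have adm: "integrable (\<mu> i) (\<phi> i)" "integrable (\<nu> i) (\<psi> i)" for i
    using admissibleD[OF cd(1)] by auto
  have f_int: "integrable (\<mu> i) (f i) \<and> integrable (\<nu> i) (f i)
      \<and> integral\<^sup>L (\<mu> i) (f i) \<le> integral\<^sup>L (\<nu> i) (f i)" for i
  proof -
    interpret irreducible "\<mu> i" "\<nu> i" by (rule irreducible_i)
    have "integrable (\<nu> i) (f i)"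
    proof (rule Bochner_Integration.integrable_bound[OF adm(2)])
      show "f i \<in> borel_measurable (\<nu> i)" using borel_measurable_convex[OF cd(4)] by simp
      show "AE x in \<nu> i. norm (f i x) \<le> norm (\<psi> i x)"
        using cd(6,8) by (intro AE_I2) (smt (verit) real_norm_def)
    qed
    then show ?thesis
      using convex_integrable_\<mu>[OF cd(4,6)] convex_gap_nonneg[OF cd(4,6)] by blast
  qed
  then show f_int': "integrable (\<mu> i) (f i)" "integrable (\<nu> i) (f i)" for i by auto
  define A where "A i = (\<integral>x. f i x - \<phi> i x \<partial>\<mu> i)" for i
  define B where "B i = (\<integral>y. - \<psi> i y - f i y \<partial>\<nu> i)" for i
  define D where "D i = integral\<^sup>L (\<nu> i) (f i) - integral\<^sup>L (\<mu> i) (f i)" for i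
  have nonneg: "0 \<le> A i" "0 \<le> B i" "0 \<le> D i" for i
    unfolding A_def B_def D_def using cd(7,8) f_int
    by (auto intro!: Bochner_Integration.integral_nonneg simp: le_diff_eq)
  have "A i + B i + D i = - (integral\<^sup>L (\<mu> i) (\<phi> i) + integral\<^sup>L (\<nu> i) (\<psi> i))" for i
    unfolding A_def B_def D_def using adm f_int' by simp
  then have "(\<Sum>i\<in>UNIV. A i + B i + D i) = - dual_value \<phi> \<psi>"
    by (simp only: dual_value_def sum_negf)
  then have "(\<Sum>i\<in>UNIV. A i + B i + D i) \<le> C" using cd(3) C by linarith
  moreover have "A i + B i + D i \<le> (\<Sum>i\<in>UNIV. A i + B i + D i)" for i
    using nonneg by (intro member_le_sum) (auto intro: add_nonneg_nonneg)
  ultimately have "A i + B i + D i \<le> C" for i by (rule order_trans[rotated])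
  then have le: "A i \<le> C" "B i \<le> C" "D i \<le> C" for i
    using nonneg[of i] by (smt (verit))+
  show "(\<integral>x. f i x - \<phi> i x \<partial>\<mu> i) \<le> C" "(\<integral>y. - \<psi> i y - f i y \<partial>\<nu> i) \<le> C"
    using le[of i] by (auto simp: A_def B_def)
  show "f i \<in> irreducible.bounded_gap_convex (\<mu> i) (\<nu> i) (anchor i) C"
    unfolding irreducible.bounded_gap_convex_def[OF irreducible_i]
    using cd(4,5,6) f_int'(2) le(3)[of i] by (auto simp: D_def)
qed

definition tuple_mid :: "'d dual_tuple \<Rightarrow> 'd dual_tuple \<Rightarrow> 'd dual_tuple" where
  "tuple_mid = (\<lambda>(\<phi>, \<psi>, h, f) (\<phi>', \<psi>', h', f').
     (\<lambda>i x. (1 / 2) * (\<phi> i x + \<phi>' i x), \<lambda>i x. (1 / 2) * (\<psi> i x + \<psi>' i x),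
      \<lambda>i x. (1 / 2) * (h i x + h' i x), \<lambda>i x. (1 / 2) * (f i x + f' i x)))"

text \<open>Every condition defining a candidate is stable under averaging.\<close>

lemma tuple_mid_mem:
  assumes "\<tau> \<in> candidates c r" "\<sigma> \<in> candidates c r"
  shows "tuple_mid \<tau> \<sigma> \<in> candidates c r"
proof -
  obtain \<phi> \<psi> h f \<phi>' \<psi>' h' f' where \<tau>: "\<tau> = (\<phi>, \<psi>, h, f)" and \<sigma>: "\<sigma> = (\<phi>', \<psi>', h', f')"
    by (metis prod_cases4)
  note a = candidatesD[OF assms(1)[unfolded \<tau>]] and b = candidatesD[OF assms(2)[unfolded \<sigma>]]
  have conv: "convex_on UNIV (\<lambda>x. (1 / 2) * (f i x + f' i x))" for i
    using a(4) b(4) by (intro convex_on_cmul convex_on_add) auto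
  have "admissible (\<lambda>i x. (1 / 2) * (\<phi> i x + \<phi>' i x)) (\<lambda>i x. (1 / 2) * (\<psi> i x + \<psi>' i x))
      (\<lambda>i x. (1 / 2) * (h i x + h' i x))"
    by (rule admissible_scale(1)[OF admissible_add(1)[OF a(1) b(1)]])
  moreover have "dual_sum (\<lambda>i x. (1 / 2) * (\<phi> i x + \<phi>' i x)) (\<lambda>i x. (1 / 2) * (\<psi> i x + \<psi>' i x))
      (\<lambda>i x. (1 / 2) * (h i x + h' i x)) z \<le> c z" for z
    unfolding dual_sum_scale dual_sum_add using a(2)[of z] b(2)[of z] by simp
  moreover have "r \<le> dual_value (\<lambda>i x. (1 / 2) * (\<phi> i x + \<phi>' i x)) (\<lambda>i x. (1 / 2) * (\<psi> i x + \<psi>' i x))"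
    unfolding admissible_scale(2)[OF admissible_add(1)[OF a(1) b(1)]] admissible_add(2)[OF a(1) b(1)]
    using a(3) b(3) by simp
  moreover have "0 \<le> (1 / 2) * (f i t + f' i t)" for i t
    using a(6)[of i t] b(6)[of i t] by argo
  moreover have "(1 / 2) * (\<phi> i t + \<phi>' i t) \<le> (1 / 2) * (f i t + f' i t)" for i t
    using a(7)[of i t] b(7)[of i t] by argo
  moreover have "(1 / 2) * (f i t + f' i t) \<le> - ((1 / 2) * (\<psi> i t + \<psi>' i t))" for i t
    using a(8)[of i t] b(8)[of i t] by argo
  ultimately show ?thesis
    unfolding \<tau> \<sigma> tuple_mid_def candidates_def using conv a(5) b(5) by auto
qed

end

section \<open>Minimising sequences that converge almost everywhere\<close>

lemma convergent_of_exp: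
  fixes z :: "nat \<Rightarrow> real"
  assumes "(\<lambda>n. exp (- z n / 2)) \<longlonglongrightarrow> u" "u \<noteq> 0"
  shows "convergent z"
proof -
  have "0 \<le> u"
    by (rule LIMSEQ_le_const[OF assms(1)]) auto
  then have "u > 0" using assms(2) by simp
  then have "(\<lambda>n. -2 * ln (exp (- z n / 2))) \<longlonglongrightarrow> -2 * ln u"
    by (intro tendsto_intros assms(1)) auto
  then show ?thesis by (auto simp: convergent_def)
qed

lemma convergent_of_exp_bounded:
  fixes z :: "nat \<Rightarrow> real"
  assumes conv: "convergent (\<lambda>n. exp (- z n / 2))" and K: "\<And>n. z n \<le> K"
  shows "convergent z"
proof -
  obtain u where u: "(\<lambda>n. exp (- z n / 2)) \<longlonglongrightarrow> u"
    using conv by (auto simp: convergent_def)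
  have "exp (- K / 2) \<le> u"
    by (rule LIMSEQ_le_const[OF u]) (use K in \<open>auto intro!: exI[of _ 0]\<close>)
  then have "u \<noteq> 0" using exp_gt_zero[of "- K / 2"] by linarith
  with u show ?thesis by (rule convergent_of_exp)
qed

text \<open>The limit of the exponentials can vanish only where \<open>z n\<close> tends to
  infinity, and Fatou's lemma with the uniform bound on the integrals makes that a null set.\<close>

lemma AE_convergent_of_exp:
  fixes z :: "nat \<Rightarrow> 'a \<Rightarrow> real"
  assumes meas: "\<And>n. z n \<in> borel_measurable M" and pos: "\<And>n x. 0 \<le> z n x"
    and int: "\<And>n. integrable M (z n)" "\<And>n. integral\<^sup>L M (z n) \<le> C"
    and conv: "AE x in M. convergent (\<lambda>n. exp (- z n x / 2))"
  shows "AE x in M. convergent (\<lambda>n. z n x)"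
proof -
  have "(\<integral>\<^sup>+x. liminf (\<lambda>n. ennreal (z n x)) \<partial>M) \<le> liminf (\<lambda>n. \<integral>\<^sup>+x. ennreal (z n x) \<partial>M)"
    using meas by (intro nn_integral_liminf) auto
  also have "\<dots> \<le> ennreal C"
  proof (rule Liminf_le)
    show "\<forall>\<^sub>F n in sequentially. (\<integral>\<^sup>+x. ennreal (z n x) \<partial>M) \<le> ennreal C"
      using int pos by (intro always_eventually allI) (simp add: nn_integral_eq_integral ennreal_leI)
  qed simp
  finally have "(\<integral>\<^sup>+x. liminf (\<lambda>n. ennreal (z n x)) \<partial>M) \<noteq> \<infinity>"
    by (auto simp: top_unique)
  then have "AE x in M. liminf (\<lambda>n. ennreal (z n x)) \<noteq> \<infinity>"
    using meas by (intro nn_integral_PInf_AE) auto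
  with conv show ?thesis
  proof eventually_elim
    case (elim x)
    obtain u where u: "(\<lambda>n. exp (- z n x / 2)) \<longlonglongrightarrow> u"
      using elim(1) by (auto simp: convergent_def)
    have "u \<noteq> 0"
    proof
      assume "u = 0"
      have "filterlim (\<lambda>n. z n x) at_top sequentially"
        unfolding filterlim_at_top
      proof
        fix Z :: real
        have "\<forall>\<^sub>F n in sequentially. exp (- z n x / 2) < exp (- Z / 2)"
          using u \<open>u = 0\<close> by (intro order_tendstoD) auto
        then show "\<forall>\<^sub>F n in sequentially. Z \<le> z n x"
          by eventually_elim simp
      qed
      then have "((\<lambda>n. ennreal (z n x)) \<longlongrightarrow> \<infinity>) sequentially"
        by (simp add: ennreal_tendsto_top_eq_at_top)
      then have "liminf (\<lambda>n. ennreal (z n x)) = \<infinity>"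
        by (intro lim_imp_Liminf) auto
      with elim(2) show False by simp
    qed
    with u show ?case by (rule convergent_of_exp)
  qed
qed

lemma AE_summable_of_geometric_integrals:
  fixes g :: "nat \<Rightarrow> 'a \<Rightarrow> real"
  assumes int: "\<And>n. integrable M (g n)" and pos: "\<And>n x. 0 \<le> g n x"
    and le: "\<And>n. integral\<^sup>L M (g n) \<le> C * (1 / 2) ^ n"
  shows "AE x in M. summable (\<lambda>n. g n x)"
proof -
  have C: "0 \<le> C"
    using le[of 0] order_trans[OF Bochner_Integration.integral_nonneg le[of 0]] pos by simp
  have "(\<integral>\<^sup>+x. (\<Sum>n. ennreal (g n x)) \<partial>M) = (\<Sum>n. \<integral>\<^sup>+x. ennreal (g n x) \<partial>M)"
    using int by (intro nn_integral_suminf) auto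
  also have "\<dots> \<le> (\<Sum>n. ennreal (C * (1 / 2) ^ n))"
    using int le pos by (intro suminf_le) (auto simp: nn_integral_eq_integral intro!: ennreal_leI)
  also have "\<dots> = ennreal (\<Sum>n. C * (1 / 2) ^ n)"
    using C by (intro suminf_ennreal2) (auto intro!: summable_mult summable_geometric)
  finally have "(\<integral>\<^sup>+x. (\<Sum>n. ennreal (g n x)) \<partial>M) \<noteq> \<infinity>"
    by (auto simp: top_unique)
  then have "AE x in M. (\<Sum>n. ennreal (g n x)) \<noteq> \<infinity>"
    using int by (intro nn_integral_PInf_AE) auto
  then show ?thesis
    by eventually_elim (use pos in \<open>auto intro: summable_suminf_not_top\<close>)
qed

lemma AE_convergent_of_summable_increments:
  fixes u :: "nat \<Rightarrow> 'a \<Rightarrow> real"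
  assumes int: "\<And>n. integrable M (u n)"
    and le: "\<And>n. (\<integral>x. \<bar>u (Suc n) x - u n x\<bar> \<partial>M) \<le> C * (1 / 2) ^ n"
  shows "AE x in M. convergent (\<lambda>n. u n x)"
proof -
  have "AE x in M. summable (\<lambda>n. \<bar>u (Suc n) x - u n x\<bar>)"
    by (rule AE_summable_of_geometric_integrals[OF _ _ le]) (use int in auto)
  then show ?thesis
  proof eventually_elim
    case (elim x)
    then have "summable (\<lambda>n. u (Suc n) x - u n x)"
      by (rule summable_rabs_cancel)
    then have "(\<lambda>n. \<Sum>i<n. u (Suc i) x - u i x) \<longlonglongrightarrow> (\<Sum>n. u (Suc n) x - u n x)"
      by (rule summable_LIMSEQ)
    then have "(\<lambda>n. u n x - u 0 x + u 0 x) \<longlonglongrightarrow> (\<Sum>n. u (Suc n) x - u n x) + u 0 x"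
      unfolding sum_lessThan_telescope[of "\<lambda>n. u n x"] by (intro tendsto_intros)
    then show ?case by (auto simp: convergent_def)
  qed
qed

text \<open>A forward-convex-combination argument in the style of Delbaen and Schachermayer: since
  \<open>(exp (-a/2) - exp (-b/2))^2 = exp (-a) + exp (-b) - 2 exp (-(a + b)/2)\<close>, almost minimisers of
  the integral of \<open>exp (-Z)\<close> over midpoint-convex sets make \<open>exp (-Z/2)\<close> a Cauchy sequence in
  \<open>L\<^sup>2\<close>.\<close>

lemma exp_minimizing_sequence:
  fixes C :: "nat \<Rightarrow> 't set" and mid :: "'t \<Rightarrow> 't \<Rightarrow> 't" and M :: "'k::finite \<Rightarrow> 'a measure"
    and Z :: "'t \<Rightarrow> 'k \<Rightarrow> 'a \<Rightarrow> real"
  assumes M: "\<And>k. prob_space (M k)"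
    and ne: "\<And>n. C n \<noteq> {}" and dec: "decseq C"
    and mid: "\<And>n \<tau> \<sigma>. \<tau> \<in> C n \<Longrightarrow> \<sigma> \<in> C n \<Longrightarrow> mid \<tau> \<sigma> \<in> C n"
    and Z_mid: "\<And>\<tau> \<sigma> k x. \<tau> \<in> C 0 \<Longrightarrow> \<sigma> \<in> C 0 \<Longrightarrow> Z (mid \<tau> \<sigma>) k x = (Z \<tau> k x + Z \<sigma> k x) / 2"
    and Z_meas: "\<And>\<tau> k. \<tau> \<in> C 0 \<Longrightarrow> Z \<tau> k \<in> borel_measurable (M k)"
    and Z_pos: "\<And>\<tau> k x. \<tau> \<in> C 0 \<Longrightarrow> 0 \<le> Z \<tau> k x"
  obtains \<tau> where "\<And>n. \<tau> n \<in> C n" "\<And>k. AE x in M k. convergent (\<lambda>n. exp (- Z (\<tau> n) k x / 2))"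
proof -
  have C0: "\<tau> \<in> C 0" if "\<tau> \<in> C n" for \<tau> n
    using that decseqD[OF dec, of 0 n] by auto
  have int: "integrable (M k) (\<lambda>x. exp (- Z \<tau> k x))" "integrable (M k) (\<lambda>x. exp (- Z \<tau> k x / 2))"
    if \<tau>: "\<tau> \<in> C 0" for \<tau> k
  proof -
    interpret prob_space "M k" by (rule M)
    note [measurable] = Z_meas[OF \<tau>, of k]
    show "integrable (M k) (\<lambda>x. exp (- Z \<tau> k x))" "integrable (M k) (\<lambda>x. exp (- Z \<tau> k x / 2))"
      using Z_pos[OF \<tau>, of k] by (auto intro!: integrable_const_bound[where B = 1])
  qed
  define J where "J \<tau> = (\<Sum>k\<in>UNIV. \<integral>x. exp (- Z \<tau> k x) \<partial>M k)" for \<tau>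
  have J_nonneg: "0 \<le> J \<tau>" for \<tau>
    unfolding J_def by (intro sum_nonneg Bochner_Integration.integral_nonneg) auto
  have J_le: "J \<tau> \<le> real CARD('k)" if \<tau>: "\<tau> \<in> C 0" for \<tau>
  proof -
    have "(\<integral>x. exp (- Z \<tau> k x) \<partial>M k) \<le> 1" for k
    proof -
      interpret prob_space "M k" by (rule M)
      have "(\<integral>x. exp (- Z \<tau> k x) \<partial>M k) \<le> (\<integral>x. 1 \<partial>M k)"
        using int(1)[OF \<tau>] Z_pos[OF \<tau>] by (intro integral_mono) auto
      then show ?thesis by (simp add: prob_space)
    qed
    then have "J \<tau> \<le> (\<Sum>k\<in>(UNIV :: 'k set). 1)" unfolding J_def by (intro sum_mono)
    then show ?thesis by simp
  qed
  define j where "j n = Inf (J ` C n)" for n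
  have bdd: "bdd_below (J ` C n)" for n
    using J_nonneg by (intro bdd_belowI[of _ 0]) auto
  have j_le: "j n \<le> J \<tau>" if "\<tau> \<in> C n" for n \<tau>
    unfolding j_def using that bdd by (intro cInf_lower) auto
  have "incseq j"
    unfolding incseq_def j_def using ne bdd decseqD[OF dec] by (intro allI impI cInf_superset_mono image_mono) auto
  moreover have "j n \<le> real CARD('k)" for n
  proof -
    obtain \<tau> where "\<tau> \<in> C n" using ne by blast
    then show ?thesis using j_le J_le C0 by (meson order_trans)
  qed
  ultimately obtain jj where jj: "j \<longlonglongrightarrow> jj" "\<And>n. j n \<le> jj"
    using incseq_convergent by blast
  \<comment> \<open>The infima \<open>j n\<close> increase along the shrinking sets; an index at
    least \<open>m\<close> with \<open>j n\<close> close to the limit \<open>jj\<close> keeps the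
    midpoints of later choices almost minimal as well.\<close>
  have "\<exists>\<tau> n. m \<le> n \<and> \<tau> \<in> C n \<and> jj - (1 / 4) ^ m < j n \<and> J \<tau> < jj + (1 / 4) ^ m" for m
  proof -
    have "\<forall>\<^sub>F n in sequentially. jj - (1 / 4) ^ m < j n"
      using jj(1) by (rule order_tendstoD) simp
    then have "\<forall>\<^sub>F n in sequentially. jj - (1 / 4) ^ m < j n \<and> m \<le> n"
      using eventually_ge_at_top[of m] by eventually_elim simp
    then obtain n where n: "jj - (1 / 4) ^ m < j n" "m \<le> n"
      by (auto simp: eventually_sequentially)
    have "j n < jj + (1 / 4) ^ m"
      using jj(2)[of n] zero_less_power[of "1 / 4 :: real" m] by linarith
    then obtain \<tau> where "\<tau> \<in> C n" "J \<tau> < jj + (1 / 4) ^ m"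
      unfolding j_def using cInf_less_iff[of "J ` C n"] ne bdd by auto
    with n show ?thesis by blast
  qed
  then obtain \<tau> N where \<tau>: "\<And>m. m \<le> N m" "\<And>m. \<tau> m \<in> C (N m)" "\<And>m. jj - (1 / 4) ^ m < j (N m)"
      "\<And>m. J (\<tau> m) < jj + (1 / 4) ^ m"
    by metis
  have \<tau>0: "\<tau> m \<in> C 0" for m using C0[OF \<tau>(2)] .
  define u where "u m k x = exp (- Z (\<tau> m) k x / 2)" for m k x
  have u_int: "integrable (M k) (u m k)" for m k
    unfolding u_def[abs_def] by (rule int(2)[OF \<tau>0])
  have sq_eq: "(u (Suc m) k x - u m k x)\<^sup>2 = exp (- Z (\<tau> (Suc m)) k x) + exp (- Z (\<tau> m) k x)
      - 2 * exp (- Z (mid (\<tau> (Suc m)) (\<tau> m)) k x)" for m k x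
  proof -
    have "exp (- Z \<sigma> k x) = (exp (- Z \<sigma> k x / 2))\<^sup>2" for \<sigma>
      by (simp add: power2_eq_square flip: exp_add)
    moreover have "exp (- Z (mid (\<tau> (Suc m)) (\<tau> m)) k x) = u (Suc m) k x * u m k x"
      unfolding Z_mid[OF \<tau>0 \<tau>0] u_def by (simp add: add_divide_distrib diff_divide_distrib flip: exp_add)
    ultimately show ?thesis
      by (simp add: u_def power2_diff)
  qed
  have mid0: "mid (\<tau> (Suc m)) (\<tau> m) \<in> C 0" for m using mid[OF \<tau>0 \<tau>0] .
  have sq_int: "integrable (M k) (\<lambda>x. (u (Suc m) k x - u m k x)\<^sup>2)" for m k
    unfolding sq_eq using int(1)[OF \<tau>0] int(1)[OF mid0] by auto
  have sq_le: "(\<integral>x. (u (Suc m) k x - u m k x)\<^sup>2 \<partial>M k) \<le> 4 * (1 / 4) ^ m" for m k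
  proof -
    \<comment> \<open>The indices \<open>N m\<close> need not be monotone; the smaller one has a set
      containing both elements, hence their midpoint.\<close>
    define n where "n = min (N (Suc m)) (N m)"
    have "\<tau> (Suc m) \<in> C n" "\<tau> m \<in> C n"
      using \<tau>(2)[of "Suc m"] \<tau>(2)[of m] decseqD[OF dec, of n "N (Suc m)"] decseqD[OF dec, of n "N m"]
      unfolding n_def by auto
    then have "mid (\<tau> (Suc m)) (\<tau> m) \<in> C n" by (rule mid)
    then have "j n \<le> J (mid (\<tau> (Suc m)) (\<tau> m))" by (rule j_le)
    moreover have "jj - (1 / 4) ^ m < j (N (Suc m))"
    proof -
      have "(1 / 4 :: real) ^ Suc m \<le> (1 / 4) ^ m" by (intro power_decreasing) auto
      then show ?thesis using \<tau>(3)[of "Suc m"] by linarith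
    qed
    then have "jj - (1 / 4) ^ m < j n"
      using \<tau>(3)[of m] by (simp add: n_def min_def)
    ultimately have J_mid: "jj - (1 / 4) ^ m < J (mid (\<tau> (Suc m)) (\<tau> m))" by linarith
    have "(\<integral>x. (u (Suc m) k x - u m k x)\<^sup>2 \<partial>M k) \<le> (\<Sum>k\<in>UNIV. \<integral>x. (u (Suc m) k x - u m k x)\<^sup>2 \<partial>M k)"
      by (intro member_le_sum) (auto intro!: Bochner_Integration.integral_nonneg)
    also have "\<dots> = (\<Sum>k\<in>UNIV. (\<integral>x. exp (- Z (\<tau> (Suc m)) k x) \<partial>M k) + (\<integral>x. exp (- Z (\<tau> m) k x) \<partial>M k)
        - 2 * (\<integral>x. exp (- Z (mid (\<tau> (Suc m)) (\<tau> m)) k x) \<partial>M k))"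
      unfolding sq_eq using int(1)[OF \<tau>0] int(1)[OF mid0] by (intro sum.cong) auto
    also have "\<dots> = J (\<tau> (Suc m)) + J (\<tau> m) - 2 * J (mid (\<tau> (Suc m)) (\<tau> m))"
      unfolding J_def by (simp add: sum.distrib sum_subtractf sum_distrib_left)
    also have "\<dots> \<le> 4 * (1 / 4) ^ m"
    proof -
      have "J (\<tau> (Suc m)) < jj + (1 / 4) ^ m"
      proof -
        have "(1 / 4 :: real) ^ Suc m \<le> (1 / 4) ^ m" by (intro power_decreasing) auto
        then show ?thesis using \<tau>(4)[of "Suc m"] by linarith
      qed
      then show ?thesis using \<tau>(4)[of m] J_mid by linarith
    qed
    finally show ?thesis .
  qed
  have "AE x in M k. convergent (\<lambda>n. u n k x)" for k
  proof (rule AE_convergent_of_summable_increments[where C = "5 / 2"])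
    interpret prob_space "M k" by (rule M)
    fix m
    have "(\<integral>x. \<bar>u (Suc m) k x - u m k x\<bar> \<partial>M k)
        \<le> (\<integral>x. (1 / 2) ^ m / 2 + (2 ^ m / 2) * (u (Suc m) k x - u m k x)\<^sup>2 \<partial>M k)"
    proof (rule integral_mono)
      fix x
      \<comment> \<open>The weighted inequality of arithmetic and geometric means turns the bound
        \<open>4 * (1 / 4) ^ m\<close> on the squares into a bound of order
        \<open>(1 / 2) ^ m\<close> on the absolute values.\<close>
      define d where "d = \<bar>u (Suc m) k x - u m k x\<bar>"
      have "0 \<le> ((1 / 2) ^ m - d)\<^sup>2 * 2 ^ m" by simp
      also have "\<dots> = (1 / 2) ^ m - 2 * d + 2 ^ m * d\<^sup>2"
        by (simp add: power2_diff power2_eq_square algebra_simps power_divide)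
      finally show "\<bar>u (Suc m) k x - u m k x\<bar> \<le> (1 / 2) ^ m / 2 + (2 ^ m / 2) * (u (Suc m) k x - u m k x)\<^sup>2"
        unfolding d_def by (simp add: field_simps)
    qed (use u_int sq_int in auto)
    also have "\<dots> = (1 / 2) ^ m / 2 + (2 ^ m / 2) * (\<integral>x. (u (Suc m) k x - u m k x)\<^sup>2 \<partial>M k)"
      using sq_int by (subst Bochner_Integration.integral_add) (auto simp: prob_space)
    also have "\<dots> \<le> (1 / 2) ^ m / 2 + (2 ^ m / 2) * (4 * (1 / 4) ^ m)"
      using sq_le by (intro add_left_mono mult_left_mono) auto
    also have "(2 ^ m / 2) * (4 * (1 / 4) ^ m) = 2 * (1 / 2 :: real) ^ m"
      by (simp add: power_divide flip: power_mult_distrib) (simp add: field_simps flip: power_mult_distrib)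
    finally show "(\<integral>x. \<bar>u (Suc m) k x - u m k x\<bar> \<partial>M k) \<le> 5 / 2 * (1 / 2) ^ m" by simp
  qed (rule u_int)
  moreover have "\<tau> n \<in> C n" for n
    using \<tau>(1,2)[of n] decseqD[OF dec, of n "N n"] by auto
  ultimately show thesis
    using that unfolding u_def by blast
qed

section \<open>Dual attainment\<close>

lemma linear_bound_imp_bounded:
  fixes H :: "nat \<Rightarrow> 'd::finite \<Rightarrow> real"
  assumes \<delta>: "\<And>i. \<delta> i > 0" and le: "\<And>n. (\<Sum>i\<in>UNIV. \<bar>H n i\<bar> * \<delta> i) \<le> K"
  shows "bounded (range (\<lambda>n. \<chi> i. H n i))"
proof (rule boundedI)
  fix z assume "z \<in> range (\<lambda>n. \<chi> i. H n i)"
  then obtain n where z: "z = (\<chi> i. H n i)" by auto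
  have "\<bar>H n i\<bar> \<le> K / \<delta> i" for i
  proof -
    have "\<bar>H n i\<bar> * \<delta> i \<le> (\<Sum>i\<in>UNIV. \<bar>H n i\<bar> * \<delta> i)"
      using \<delta> by (intro member_le_sum) (auto intro!: mult_nonneg_nonneg intro: less_imp_le)
    also have "\<dots> \<le> K" by (rule le)
    finally show ?thesis using \<delta>[of i] by (simp add: field_simps)
  qed
  then have "(\<Sum>i\<in>UNIV. \<bar>z $ i\<bar>) \<le> (\<Sum>i\<in>UNIV. K / \<delta> i)"
    unfolding z by (intro sum_mono) simp
  with norm_le_l1_cart[of z] show "norm z \<le> (\<Sum>i\<in>UNIV. K / \<delta> i)" by linarith
qed

section \<open>Limits of near-optimal duals\<close>

context marginals
begin

lemma VMT_integrable_cost: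
  assumes \<pi>: "\<pi> \<in> VMT \<mu> \<nu>" and c: "lower_semicontinuous c" and adm: "admissible v w h"
    and bound: "\<And>z. \<bar>c z\<bar> \<le> dual_sum v w h z"
  shows "integrable \<pi> c"
proof (rule Bochner_Integration.integrable_bound[OF VMT_integral_dual_sum(1)[OF \<pi> adm]])
  note [measurable_cong] = VMT_D(2)[OF \<pi>]
  have [measurable]: "c \<in> borel_measurable borel" by (rule borel_measurable_lower_semicontinuous[OF c])
  show "c \<in> borel_measurable \<pi>" by measurable
  show "AE z in \<pi>. norm (c z) \<le> norm (dual_sum v w h z)"
    using bound by (intro AE_I2) (auto intro: order_trans[OF _ abs_ge_self])
qed

end

context irreducible_marginals
begin

lemma candidates_mono: "r \<le> r' \<Longrightarrow> candidates c r' \<subseteq> candidates c r"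
  unfolding candidates_def by auto

lemma candidate_sequence_converges:
  assumes ne: "\<And>n. candidates c (r n) \<noteq> {}" and inc: "incseq r"
  obtains \<Phi> \<Psi> H F where "\<And>n. (\<Phi> n, \<Psi> n, H n, F n) \<in> candidates c (r n)"
    and "\<And>i. AE x in \<mu> i. convergent (\<lambda>n. \<Phi> n i x)"
    and "\<And>i. AE y in \<nu> i. convergent (\<lambda>n. \<Psi> n i y)"
proof -
  define M :: "'d \<times> bool \<times> bool \<Rightarrow> real measure" where
    "M = (\<lambda>(i, b, _). if b then \<mu> i else \<nu> i)"
  \<comment> \<open>The second flag selects \<open>f\<close> itself; otherwise \<open>Z\<close> is
    the slack between \<open>f\<close> and \<phi> or between \<open>- \<psi>\<close> and
    \<open>f\<close>. The first flag names the measure, so \<open>f\<close> is listed under both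
    marginals.\<close>
  define Z :: "'d dual_tuple \<Rightarrow> 'd \<times> bool \<times> bool \<Rightarrow> real \<Rightarrow> real" where
    "Z = (\<lambda>(\<phi>, \<psi>, h, f) (i, b, b') x. if b' then f i x else if b then f i x - \<phi> i x else - \<psi> i x - f i x)"
  obtain \<tau> where \<tau>: "\<And>n. \<tau> n \<in> candidates c (r n)"
    and conv: "\<And>k. AE x in M k. convergent (\<lambda>n. exp (- Z (\<tau> n) k x / 2))"
  proof (rule exp_minimizing_sequence[of M "\<lambda>n. candidates c (r n)" tuple_mid Z])
    show "prob_space (M k)" for k
      using prob_\<mu> prob_\<nu> by (auto simp: M_def split: prod.splits)
    show "decseq (\<lambda>n. candidates c (r n))"
      unfolding decseq_def using candidates_mono inc by (auto simp: incseq_def)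
    show "tuple_mid \<tau> \<sigma> \<in> candidates c (r n)" if "\<tau> \<in> candidates c (r n)" "\<sigma> \<in> candidates c (r n)" for n \<tau> \<sigma>
      using that by (rule tuple_mid_mem)
    show "Z (tuple_mid \<tau> \<sigma>) k x = (Z \<tau> k x + Z \<sigma> k x) / 2" for \<tau> \<sigma> k x
      by (auto simp: Z_def tuple_mid_def field_simps split: prod.splits)
    fix \<tau> :: "'d dual_tuple" and k :: "'d \<times> bool \<times> bool" assume \<tau>: "\<tau> \<in> candidates c (r 0)"
    obtain \<phi> \<psi> h f where \<tau>_eq: "\<tau> = (\<phi>, \<psi>, h, f)" by (metis prod_cases4)
    obtain i b b' where k_eq: "k = (i, b, b')" by (metis prod_cases3)
    note cd = candidatesD[OF \<tau>[unfolded \<tau>_eq]]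
    have [measurable]: "f i \<in> borel_measurable borel" by (rule borel_measurable_convex[OF cd(4)])
    have [measurable]: "\<phi> i \<in> borel_measurable borel"
      using borel_measurable_integrable[OF admissibleD(1)[OF cd(1), of i]] by simp
    have [measurable]: "\<psi> i \<in> borel_measurable borel"
      using borel_measurable_integrable[OF admissibleD(2)[OF cd(1), of i]] by simp
    show "Z \<tau> k \<in> borel_measurable (M k)"
      unfolding \<tau>_eq k_eq Z_def M_def by (cases b; cases b') auto
    show "0 \<le> Z \<tau> k x" for x
      unfolding \<tau>_eq k_eq Z_def using cd(6)[of i x] cd(7)[of i x] cd(8)[of i x] by simp
  qed (use ne that in blast)+
  have M_eq: "M (i, True, b) = \<mu> i" "M (i, False, b) = \<nu> i" for i b
    by (simp_all add: M_def)
  have "\<forall>n. \<exists>\<phi> \<psi> h f. \<tau> n = (\<phi>, \<psi>, h, f)" by (metis prod_cases4)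
  then obtain \<Phi> \<Psi> H F where \<tau>_eq: "\<And>n. \<tau> n = (\<Phi> n, \<Psi> n, H n, F n)" by metis
  have cand: "(\<Phi> n, \<Psi> n, H n, F n) \<in> candidates c (r n)" for n
    using \<tau>[of n] unfolding \<tau>_eq .
  \<comment> \<open>Since \<open>r\<close> increases, the constant \<open>- r 0\<close> serves in
    \<open>candidates_bounds\<close> for all indices at once.\<close>
  have C: "- (- r 0) \<le> r n" for n
    using inc by (simp add: incseq_def)
  note cd = candidatesD[OF cand] and cb = candidates_bounds[OF cand C]
  have F_meas [measurable]: "F n i \<in> borel_measurable borel" for n i
    by (rule borel_measurable_convex[OF cd(4)])
  have \<Phi>_int: "integrable (\<mu> i) (\<Phi> n i)" and \<Psi>_int: "integrable (\<nu> i) (\<Psi> n i)" for n i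
    using admissibleD(1,2)[OF cd(1)] by auto
  \<comment> \<open>The integrals of \<open>F n i\<close> have no common bound, so Fatou's lemma is
    replaced by the pointwise bounds from irreducibility.\<close>
  have F_bound: "\<exists>K. \<forall>n. F n i t \<le> K" if t: "t \<in> inner i \<or> measure (\<nu> i) {t} > 0" for i t
  proof -
    interpret irreducible "\<mu> i" "\<nu> i" by (rule irreducible_i)
    obtain K where "\<And>f. f \<in> bounded_gap_convex (anchor i) (- r 0) \<Longrightarrow> f t \<le> K"
      using pointwise_bound[of "anchor i" t] anchor_mem[of i] t unfolding inner_def by blast
    then show ?thesis using cb(1) by blast
  qed
  have F\<mu>: "AE x in \<mu> i. convergent (\<lambda>n. F n i x)" for i
  proof -
    interpret irreducible "\<mu> i" "\<nu> i" by (rule irreducible_i)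
    have "AE x in \<mu> i. convergent (\<lambda>n. exp (- F n i x / 2))"
      using conv[of "(i, True, True)"] unfolding M_eq by (simp add: Z_def \<tau>_eq)
    with AE_I show ?thesis
    proof eventually_elim
      case (elim x)
      then obtain K where "\<And>n. F n i x \<le> K" using F_bound[of x i] by (auto simp: inner_def)
      with elim(2) show ?case by (rule convergent_of_exp_bounded)
    qed
  qed
  have F\<nu>: "AE y in \<nu> i. convergent (\<lambda>n. F n i y)" for i
  proof -
    interpret irreducible "\<mu> i" "\<nu> i" by (rule irreducible_i)
    have "AE x in \<nu> i. convergent (\<lambda>n. exp (- F n i x / 2))"
      using conv[of "(i, False, True)"] unfolding M_eq by (simp add: Z_def \<tau>_eq)
    with AE_\<nu>_inner show ?thesis
    proof eventually_elim
      case (elim x)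
      then obtain K where "\<And>n. F n i x \<le> K" using F_bound[of x i] by (auto simp: inner_def)
      with elim(2) show ?case by (rule convergent_of_exp_bounded)
    qed
  qed
  have "AE x in \<mu> i. convergent (\<lambda>n. \<Phi> n i x)" for i
  proof -
    have "AE x in \<mu> i. convergent (\<lambda>n. F n i x - \<Phi> n i x)"
    proof (rule AE_convergent_of_exp[where C = "- r 0"])
      show "AE x in \<mu> i. convergent (\<lambda>n. exp (- (F n i x - \<Phi> n i x) / 2))"
        using conv[of "(i, True, False)"] unfolding M_eq by (simp add: Z_def \<tau>_eq)
      show "integrable (\<mu> i) (\<lambda>x. F n i x - \<Phi> n i x)" for n
        by (intro Bochner_Integration.integrable_diff cb(2) \<Phi>_int)
      then show "(\<lambda>x. F n i x - \<Phi> n i x) \<in> borel_measurable (\<mu> i)" for n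
        by (rule borel_measurable_integrable)
    qed (use cd(7) cb(4) in auto)
    with F\<mu>[of i] show ?thesis
    proof eventually_elim
      case (elim x)
      from convergent_diff[OF this] show ?case by simp
    qed
  qed
  moreover have "AE y in \<nu> i. convergent (\<lambda>n. \<Psi> n i y)" for i
  proof -
    have "AE x in \<nu> i. convergent (\<lambda>n. - \<Psi> n i x - F n i x)"
    proof (rule AE_convergent_of_exp[where C = "- r 0"])
      show "AE x in \<nu> i. convergent (\<lambda>n. exp (- (- \<Psi> n i x - F n i x) / 2))"
        using conv[of "(i, False, False)"] unfolding M_eq by (simp add: Z_def \<tau>_eq)
      show "integrable (\<nu> i) (\<lambda>x. - \<Psi> n i x - F n i x)" for n
        by (intro Bochner_Integration.integrable_diff Bochner_Integration.integrable_minus cb(3) \<Psi>_int)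
      then show "(\<lambda>x. - \<Psi> n i x - F n i x) \<in> borel_measurable (\<nu> i)" for n
        by (rule borel_measurable_integrable)
    qed (use cd(8) cb(5) in \<open>auto simp: le_diff_eq\<close>)
    with F\<nu>[of i] show ?thesis
    proof eventually_elim
      case (elim x)
      from convergent_minus_iff[THEN iffD1, OF convergent_add[OF elim]] show ?case by simp
    qed
  qed
  ultimately show thesis using that cand by blast
qed

text \<open>\<nu> charges both sides of \<open>x $ i\<close>, so there are points
  \<open>dn i\<close> and \<open>up i\<close> on either side at which \<Psi> converges. Inserting
  the one on the side given by the sign of \<open>H n i x\<close> into the dual inequality bounds
  all absolute values at the same time.\<close>

lemma increments_bounded:
  assumes cand: "\<And>n. (\<Phi> n, \<Psi> n, H n, F n) \<in> candidates c (r n)" and c: "\<And>z. c z \<le> 0"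
    and \<Phi>: "\<And>i. x $ i \<in> inner i" "\<And>i. convergent (\<lambda>n. \<Phi> n i (x $ i))"
    and \<Psi>: "\<And>i. AE y in \<nu> i. convergent (\<lambda>n. \<Psi> n i y)"
  shows "bounded (range (\<lambda>n. \<chi> i. H n i x))"
proof -
  have "\<exists>y. x $ i < y \<and> convergent (\<lambda>n. \<Psi> n i y)" for i
  proof (rule ccontr)
    interpret irreducible "\<mu> i" "\<nu> i" by (rule irreducible_i)
    assume *: "\<not> ?thesis"
    have "AE y in \<nu> i. y \<le> x $ i"
      using \<Psi>[of i] by eventually_elim (use * not_less in blast)
    with \<nu>_charges_above[of "x $ i"] \<Phi>(1)[of i] show False by (simp add: inner_def)
  qed
  then obtain up where up: "\<And>i. x $ i < up i" "\<And>i. convergent (\<lambda>n. \<Psi> n i (up i))" by metis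
  have "\<exists>y. y < x $ i \<and> convergent (\<lambda>n. \<Psi> n i y)" for i
  proof (rule ccontr)
    interpret irreducible "\<mu> i" "\<nu> i" by (rule irreducible_i)
    assume *: "\<not> ?thesis"
    have "AE y in \<nu> i. x $ i \<le> y"
      using \<Psi>[of i] by eventually_elim (use * not_less in blast)
    with \<nu>_charges_below[of "x $ i"] \<Phi>(1)[of i] show False by (simp add: inner_def)
  qed
  then obtain dn where dn: "\<And>i. dn i < x $ i" "\<And>i. convergent (\<lambda>n. \<Psi> n i (dn i))" by metis
  have bnd: "\<exists>K. \<forall>n. \<bar>s n\<bar> \<le> K" if "convergent s" for s :: "nat \<Rightarrow> real"
    using convergent_imp_Bseq[OF that] by (auto simp: Bseq_def)
  have "\<forall>i. \<exists>K. \<forall>n. \<bar>\<Phi> n i (x $ i)\<bar> \<le> K" "\<forall>i. \<exists>K. \<forall>n. \<bar>\<Psi> n i (up i)\<bar> \<le> K" "\<forall>i. \<exists>K. \<forall>n. \<bar>\<Psi> n i (dn i)\<bar> \<le> K"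
    using bnd[OF \<Phi>(2)] bnd[OF up(2)] bnd[OF dn(2)] by auto
  then obtain K1 K2 K3 where K: "\<And>i n. \<bar>\<Phi> n i (x $ i)\<bar> \<le> K1 i" "\<And>i n. \<bar>\<Psi> n i (up i)\<bar> \<le> K2 i"
      "\<And>i n. \<bar>\<Psi> n i (dn i)\<bar> \<le> K3 i"
    by metis
  define \<delta> where "\<delta> i = min (up i - x $ i) (x $ i - dn i)" for i
  show ?thesis
  proof (rule linear_bound_imp_bounded[where K = "\<Sum>i\<in>UNIV. K1 i + K2 i + K3 i"])
    show "\<delta> i > 0" for i using up(1) dn(1) by (simp add: \<delta>_def)
    fix n
    \<comment> \<open>This choice makes every product \<open>H n i x * (y $ i - x $ i)\<close>
      nonnegative, so no cancellation occurs in the sum.\<close>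
    define y :: "real ^ 'd" where "y = (\<chi> i. if 0 \<le> H n i x then up i else dn i)"
    have "\<bar>H n i x\<bar> * \<delta> i \<le> H n i x * (y $ i - x $ i)" for i
    proof (cases "0 \<le> H n i x")
      case True
      then have "H n i x * \<delta> i \<le> H n i x * (up i - x $ i)"
        by (intro mult_left_mono) (auto simp: \<delta>_def)
      then show ?thesis using True by (simp add: y_def)
    next
      case False
      then have "(- H n i x) * \<delta> i \<le> (- H n i x) * (x $ i - dn i)"
        by (intro mult_left_mono) (auto simp: \<delta>_def)
      then show ?thesis using False by (simp add: y_def algebra_simps)
    qed
    then have "(\<Sum>i\<in>UNIV. \<bar>H n i x\<bar> * \<delta> i) \<le> (\<Sum>i\<in>UNIV. H n i x * (y $ i - x $ i))"
      by (intro sum_mono)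
    also have "\<dots> = dual_sum (\<Phi> n) (\<Psi> n) (H n) (x, y) + (\<Sum>i\<in>UNIV. - \<Phi> n i (x $ i) - \<Psi> n i (y $ i))"
      unfolding dual_sum_def fst_conv snd_conv sum.distrib[symmetric] by (intro sum.cong) auto
    also have "\<dots> \<le> 0 + (\<Sum>i\<in>UNIV. K1 i + K2 i + K3 i)"
    proof (rule add_mono)
      show "dual_sum (\<Phi> n) (\<Psi> n) (H n) (x, y) \<le> 0"
        using candidatesD(2)[OF cand, of n "(x, y)"] c[of "(x, y)"] by linarith
      show "(\<Sum>i\<in>UNIV. - \<Phi> n i (x $ i) - \<Psi> n i (y $ i)) \<le> (\<Sum>i\<in>UNIV. K1 i + K2 i + K3 i)"
      proof (rule sum_mono)
        fix i
        have "\<bar>\<Psi> n i (y $ i)\<bar> \<le> K2 i + K3 i"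
          using K(2)[of n i] K(3)[of n i] by (auto simp: y_def)
        then show "- \<Phi> n i (x $ i) - \<Psi> n i (y $ i) \<le> K1 i + K2 i + K3 i"
          using K(1)[of n i] by linarith
      qed
    qed
    finally show "(\<Sum>i\<in>UNIV. \<bar>H n i x\<bar> * \<delta> i) \<le> (\<Sum>i\<in>UNIV. K1 i + K2 i + K3 i)" by simp
  qed
qed

text \<open>The sets \<open>A i\<close> and \<open>B i\<close> collect the points of convergence.
  They and the limits depend on the dual sequence only, so one choice serves all minimisers.\<close>

theorem real_dual_attainment:
  assumes \<pi>0: "VMT_minimizer \<mu> \<nu> c \<pi>0"
    and c: "lower_semicontinuous c"
    and v: "\<And>i. continuous_on UNIV (v i)" "\<And>i. integrable (\<mu> i) (v i)"
    and w: "\<And>i. continuous_on UNIV (w i)" "\<And>i. integrable (\<nu> i) (w i)"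
    and bound: "\<And>z. \<bar>c z\<bar> \<le> dual_sum v w (\<lambda>_ _. 0) z"
  obtains \<phi> \<psi> h A B where
    "\<And>x y. (\<And>i. x $ i \<in> A i) \<Longrightarrow> (\<And>i. y $ i \<in> B i) \<Longrightarrow> dual_sum \<phi> \<psi> h (x, y) \<le> c (x, y)"
    "\<And>\<pi>. VMT_minimizer \<mu> \<nu> c \<pi> \<Longrightarrow>
       AE z in \<pi>. (\<forall>i. fst z $ i \<in> A i) \<and> (\<forall>i. snd z $ i \<in> B i) \<and> dual_sum \<phi> \<psi> h z = c z"
proof -
  define P where "P = integral\<^sup>L \<pi>0 c"
  have P_le: "P \<le> integral\<^sup>L \<pi> c" if "\<pi> \<in> VMT \<mu> \<nu>" for \<pi>
    using \<pi>0 that unfolding VMT_minimizer_def is_arg_min_def P_def by (auto simp: not_less)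
  have \<pi>0_mem: "\<pi>0 \<in> VMT \<mu> \<nu>"
    using \<pi>0 unfolding VMT_minimizer_def is_arg_min_def by auto
  have P_eq: "\<pi> \<in> VMT \<mu> \<nu>" "integral\<^sup>L \<pi> c = P" if "VMT_minimizer \<mu> \<nu> c \<pi>" for \<pi>
  proof -
    show \<pi>: "\<pi> \<in> VMT \<mu> \<nu>"
      using that unfolding VMT_minimizer_def is_arg_min_def by auto
    have "integral\<^sup>L \<pi> c \<le> P"
      using that \<pi>0_mem unfolding VMT_minimizer_def is_arg_min_def P_def by (auto simp: not_less)
    with P_le[OF \<pi>] show "integral\<^sup>L \<pi> c = P" by simp
  qed
  define W where "W = dual_sum v w (\<lambda>_ _. 0)"
  define V where "V = dual_value v w"
  have W_adm: "admissible v w (\<lambda>_ _. 0)"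
    by (intro admissible_no_increment v w)
  define c0 where "c0 z = c z - W z" for z
  have c0: "c0 z \<le> 0" for z
    using bound[of z] unfolding c0_def W_def by linarith
  \<comment> \<open>Geometric errors make the duality gaps summable, so that they vanish almost
    surely along the full sequence, hence along every subsequence.\<close>
  define r where "r n = P - V - (1 / 2) ^ n" for n
  have "candidates c0 (r n) \<noteq> {}" for n
  proof -
    obtain \<phi> \<psi> h where sd: "admissible \<phi> \<psi> h" "\<And>z. dual_sum \<phi> \<psi> h z \<le> c z" "P - (1 / 2) ^ n < dual_value \<phi> \<psi>"
      using strong_duality[OF \<pi>0_mem P_le c v w bound, of "(1 / 2) ^ n"] by auto
    note neg = admissible_scale[OF W_adm, of "-1"]
    note sum = admissible_add[OF sd(1) neg(1)]
    have "candidates c0 (dual_value (\<lambda>i x. \<phi> i x + - 1 * v i x) (\<lambda>i x. \<psi> i x + - 1 * w i x)) \<noteq> {}"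
    proof (rule candidate_exists[OF sum(1) _ c0])
      show "dual_sum (\<lambda>i x. \<phi> i x + - 1 * v i x) (\<lambda>i x. \<psi> i x + - 1 * w i x) (\<lambda>i x. h i x + - 1 * 0) z \<le> c0 z" for z
        unfolding dual_sum_add dual_sum_scale using sd(2)[of z] by (simp add: c0_def W_def)
    qed
    moreover have "r n \<le> dual_value (\<lambda>i x. \<phi> i x + - 1 * v i x) (\<lambda>i x. \<psi> i x + - 1 * w i x)"
      unfolding sum(2) neg(2) using sd(3) by (simp add: r_def V_def)
    ultimately show ?thesis using candidates_mono by blast
  qed
  moreover have "incseq r"
    unfolding r_def by (intro incseq_SucI) simp
  ultimately obtain \<Phi> \<Psi> H F where cand: "\<And>n. (\<Phi> n, \<Psi> n, H n, F n) \<in> candidates c0 (r n)"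
    and \<Phi>_conv: "\<And>i. AE x in \<mu> i. convergent (\<lambda>n. \<Phi> n i x)"
    and \<Psi>_conv: "\<And>i. AE y in \<nu> i. convergent (\<lambda>n. \<Psi> n i y)"
    using candidate_sequence_converges by blast
  note cd = candidatesD[OF cand]
  define A where "A i = {t \<in> inner i. convergent (\<lambda>n. \<Phi> n i t)}" for i
  define B where "B i = {t. convergent (\<lambda>n. \<Psi> n i t)}" for i
  define \<phi> where "\<phi> i t = lim (\<lambda>n. \<Phi> n i t)" for i t
  define \<psi> where "\<psi> i t = lim (\<lambda>n. \<Psi> n i t)" for i t
  have \<phi>_lim: "(\<lambda>n. \<Phi> n i t) \<longlonglongrightarrow> \<phi> i t" if "t \<in> A i" for i t
    using that by (simp add: A_def \<phi>_def convergent_LIMSEQ_iff)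
  have \<psi>_lim: "(\<lambda>n. \<Psi> n i t) \<longlonglongrightarrow> \<psi> i t" if "t \<in> B i" for i t
    using that by (simp add: B_def \<psi>_def convergent_LIMSEQ_iff)
  \<comment> \<open>The subsequence may depend on x: the coefficients for different x never occur in
    the same inequality.\<close>
  have "\<exists>l s. (\<forall>i. x $ i \<in> A i) \<longrightarrow> strict_mono s \<and> (\<lambda>n. \<chi> i. H (s n) i x) \<longlonglongrightarrow> l" for x :: "real ^ 'd"
  proof (cases "\<forall>i. x $ i \<in> A i")
    case True
    have "bounded (range (\<lambda>n. \<chi> i. H n i x))"
      by (rule increments_bounded[OF cand c0 _ _ \<Psi>_conv]) (use True in \<open>auto simp: A_def\<close>)
    from bounded_imp_convergent_subsequence[OF this] show ?thesis
      by (auto simp: o_def)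
  qed auto
  then obtain l s where ls: "\<And>x. (\<forall>i. x $ i \<in> A i) \<Longrightarrow> strict_mono (s x)"
      "\<And>x. (\<forall>i. x $ i \<in> A i) \<Longrightarrow> (\<lambda>n. \<chi> i. H (s x n) i x) \<longlonglongrightarrow> l x"
    by metis
  define h where "h i x = l x $ i" for i x
  have sum_lim: "(\<lambda>n. dual_sum (\<Phi> (s x n)) (\<Psi> (s x n)) (H (s x n)) (x, y)) \<longlonglongrightarrow> dual_sum \<phi> \<psi> h (x, y)"
    if x: "\<forall>i. x $ i \<in> A i" and y: "\<forall>i. y $ i \<in> B i" for x y
  proof -
    have sub: "filterlim (s x) sequentially sequentially"
      using ls(1)[OF x] by (rule filterlim_subseq)
    have "(\<lambda>n. (\<chi> i. H (s x n) i x) $ i) \<longlonglongrightarrow> l x $ i" for i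
      using ls(2)[OF x] by (rule tendsto_vec_nth)
    then have H: "(\<lambda>n. H (s x n) i x) \<longlonglongrightarrow> h i x" for i by (simp add: h_def)
    have "(\<lambda>n. \<Phi> (s x n) i (x $ i)) \<longlonglongrightarrow> \<phi> i (x $ i)" "(\<lambda>n. \<Psi> (s x n) i (y $ i)) \<longlonglongrightarrow> \<psi> i (y $ i)" for i
      using filterlim_compose[OF \<phi>_lim sub] filterlim_compose[OF \<psi>_lim sub] x y by auto
    then show ?thesis
      unfolding dual_sum_def fst_conv snd_conv using H by (intro tendsto_intros) auto
  qed
  have le: "dual_sum \<phi> \<psi> h (x, y) \<le> c0 (x, y)"
    if x: "\<forall>i. x $ i \<in> A i" and y: "\<forall>i. y $ i \<in> B i" for x y
    by (rule LIMSEQ_le_const2[OF sum_lim[OF x y]]) (use cd(2) in auto)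
  have eq: "AE z in \<pi>. (\<forall>i. fst z $ i \<in> A i) \<and> (\<forall>i. snd z $ i \<in> B i) \<and> dual_sum \<phi> \<psi> h z = c0 z"
    if "VMT_minimizer \<mu> \<nu> c \<pi>" for \<pi>
  proof -
    note \<pi> = P_eq[OF that]
    note [measurable_cong] = VMT_D(2)[OF \<pi>(1)]
    have c_int: "integrable \<pi> c"
      by (rule VMT_integrable_cost[OF \<pi>(1) c W_adm bound])
    have c0_int: "integrable \<pi> c0" "integral\<^sup>L \<pi> c0 = P - V"
      using c_int VMT_integral_dual_sum[OF \<pi>(1) W_adm] \<pi>(2) unfolding c0_def[abs_def] W_def V_def by auto
    have "AE z in \<pi>. summable (\<lambda>n. c0 z - dual_sum (\<Phi> n) (\<Psi> n) (H n) z)"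
    proof (rule AE_summable_of_geometric_integrals[where C = 1])
      fix n
      note si = VMT_integral_dual_sum[OF \<pi>(1) cd(1), of n]
      show "integrable \<pi> (\<lambda>z. c0 z - dual_sum (\<Phi> n) (\<Psi> n) (H n) z)"
        using c0_int si by auto
      show "(\<integral>z. c0 z - dual_sum (\<Phi> n) (\<Psi> n) (H n) z \<partial>\<pi>) \<le> 1 * (1 / 2) ^ n"
        using c0_int si cd(3)[of n] by (simp add: r_def)
    qed (use cd(2) in simp)
    moreover have "AE z in \<pi>. \<forall>i\<in>UNIV. fst z $ i \<in> A i"
    proof (rule AE_finite_allI)
      fix i
      interpret irreducible "\<mu> i" "\<nu> i" by (rule irreducible_i)
      have "AE t in \<mu> i. t \<in> A i"
        using AE_I \<Phi>_conv[of i] by eventually_elim (simp add: A_def inner_def)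
      then have "AE t in distr \<pi> borel (\<lambda>z. fst z $ i). t \<in> A i"
        unfolding VMT_D(3)[OF \<pi>(1)] .
      then show "AE z in \<pi>. fst z $ i \<in> A i"
        by (rule AE_distrD[rotated]) measurable
    qed simp
    moreover have "AE z in \<pi>. \<forall>i\<in>UNIV. snd z $ i \<in> B i"
    proof (rule AE_finite_allI)
      fix i
      have "AE t in \<nu> i. t \<in> B i"
        using \<Psi>_conv[of i] by (simp add: B_def)
      then have "AE t in distr \<pi> borel (\<lambda>z. snd z $ i). t \<in> B i"
        unfolding VMT_D(4)[OF \<pi>(1)] .
      then show "AE z in \<pi>. snd z $ i \<in> B i"
        by (rule AE_distrD[rotated]) measurable
    qed simp
    ultimately show ?thesis
    proof eventually_elim
      case (elim z)
      then have x: "\<forall>i. fst z $ i \<in> A i" and y: "\<forall>i. snd z $ i \<in> B i" by auto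
      have "(\<lambda>n. c0 z - dual_sum (\<Phi> n) (\<Psi> n) (H n) z) \<longlonglongrightarrow> 0"
        using elim(1) by (rule summable_LIMSEQ_zero)
      then have lim0: "(\<lambda>n. c0 z - dual_sum (\<Phi> (s (fst z) n)) (\<Psi> (s (fst z) n)) (H (s (fst z) n)) z) \<longlonglongrightarrow> 0"
        by (rule filterlim_compose[OF _ filterlim_subseq[OF ls(1)[OF x]]])
      have lim: "(\<lambda>n. c0 z - dual_sum (\<Phi> (s (fst z) n)) (\<Psi> (s (fst z) n)) (H (s (fst z) n)) z)
          \<longlonglongrightarrow> c0 z - dual_sum \<phi> \<psi> h z"
        using sum_lim[OF x y] by (intro tendsto_intros) simp
      have "c0 z - dual_sum \<phi> \<psi> h z = 0" by (rule LIMSEQ_unique[OF lim lim0])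
      with x y show ?case by simp
    qed
  qed
  have shift: "dual_sum (\<lambda>i x. \<phi> i x + v i x) (\<lambda>i x. \<psi> i x + w i x) h z = dual_sum \<phi> \<psi> h z + W z" for z
    using dual_sum_add[of \<phi> v \<psi> w h "\<lambda>_ _. 0" z] by (simp add: W_def)
  show thesis
  proof (rule that)
    fix x y assume "\<And>i. x $ i \<in> A i" "\<And>i. y $ i \<in> B i"
    then show "dual_sum (\<lambda>i x. \<phi> i x + v i x) (\<lambda>i x. \<psi> i x + w i x) h (x, y) \<le> c (x, y)"
      unfolding shift using le[of x y] by (simp add: c0_def)
  next
    fix \<pi> assume "VMT_minimizer \<mu> \<nu> c \<pi>"
    from eq[OF this] show "AE z in \<pi>. (\<forall>i. fst z $ i \<in> A i) \<and> (\<forall>i. snd z $ i \<in> B i)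
        \<and> dual_sum (\<lambda>i x. \<phi> i x + v i x) (\<lambda>i x. \<psi> i x + w i x) h z = c z"
      by eventually_elim (simp add: shift c0_def)
  qed
qed

end

text \<open>In \<open>ereal\<close> the two infinities add up to \<open>\<infinity>\<close>, so the
  value minus infinity survives only if no summand is \<open>\<infinity>\<close>.\<close>

lemma sum_ereal_eq_MInfty:
  fixes f :: "'a \<Rightarrow> ereal"
  assumes "finite S" "i \<in> S" "f i = -\<infinity>" "\<And>j. j \<in> S \<Longrightarrow> f j \<noteq> \<infinity>"
  shows "sum f S = -\<infinity>"
proof -
  have "sum f (S - {i}) \<noteq> \<infinity>"
    using assms(1,4) by (auto simp: sum_Pinfty)
  then show ?thesis
    using assms by (subst sum.remove[of S i]) auto
qed

theorem theorem1p2: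
  fixes \<mu> \<nu> :: "'d::finite \<Rightarrow> real measure"
    and c :: "(real ^ 'd) \<times> (real ^ 'd) \<Rightarrow> real"
    and v w :: "'d \<Rightarrow> real \<Rightarrow> real"
  assumes "\<And>i. real_distribution (\<mu> i)" and "\<And>i. real_distribution (\<nu> i)"
    and "\<And>i. finite_first_moment (\<mu> i)" and "\<And>i. finite_first_moment (\<nu> i)"
    and "\<And>i. irreducible_pair (\<mu> i) (\<nu> i)"
    and "lower_semicontinuous c"
    and "\<And>i. continuous_on UNIV (v i)" and "\<And>i. integrable (\<mu> i) (v i)"
    and "\<And>i. continuous_on UNIV (w i)" and "\<And>i. integrable (\<nu> i) (w i)"
    and "\<And>x y. \<bar>c (x, y)\<bar> \<le> (\<Sum>i\<in>UNIV. v i (x $ i) + w i (y $ i))"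
  shows "\<exists>(\<phi> :: 'd \<Rightarrow> real \<Rightarrow> ereal) (\<psi> :: 'd \<Rightarrow> real \<Rightarrow> ereal) (h :: 'd \<Rightarrow> real ^ 'd \<Rightarrow> real).
    (\<forall>i t. \<phi> i t \<noteq> \<infinity>) \<and> (\<forall>i t. \<psi> i t \<noteq> \<infinity>) \<and>
    (\<forall>x y. (\<Sum>i\<in>UNIV. \<phi> i (x $ i) + \<psi> i (y $ i) + ereal (h i x * (y $ i - x $ i)))
             \<le> ereal (c (x, y))) \<and>
    (\<forall>\<pi>. VMT_minimizer \<mu> \<nu> c \<pi> \<longrightarrow>
       (AE (x, y) in \<pi>.
          (\<Sum>i\<in>UNIV. \<phi> i (x $ i) + \<psi> i (y $ i) + ereal (h i x * (y $ i - x $ i)))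
            = ereal (c (x, y))))"
proof -
  interpret irreducible_marginals \<mu> \<nu>
    by (intro irreducible_marginals.intro marginals.intro irreducible_marginals_axioms.intro assms(1-5))
  have bound: "\<bar>c z\<bar> \<le> dual_sum v w (\<lambda>_ _. 0) z" for z
    using assms(11)[of "fst z" "snd z"] by (simp add: dual_sum_def)
  obtain \<phi> \<psi> h A B where le: "\<And>x y. (\<And>i. x $ i \<in> A i) \<Longrightarrow> (\<And>i. y $ i \<in> B i) \<Longrightarrow> dual_sum \<phi> \<psi> h (x, y) \<le> c (x, y)"
    and eq: "\<And>\<pi>. VMT_minimizer \<mu> \<nu> c \<pi> \<Longrightarrow>
       AE z in \<pi>. (\<forall>i. fst z $ i \<in> A i) \<and> (\<forall>i. snd z $ i \<in> B i) \<and> dual_sum \<phi> \<psi> h z = c z"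
  \<comment> \<open>Without a minimiser the equality is vacuous, and empty sets \<open>A i\<close>
    and \<open>B i\<close> make \<phi> and \<psi> equal to minus infinity everywhere.\<close>
  proof (cases "\<exists>\<pi>. VMT_minimizer \<mu> \<nu> c \<pi>")
    case True
    then obtain \<pi>0 where "VMT_minimizer \<mu> \<nu> c \<pi>0" by blast
    then show thesis
    proof (rule real_dual_attainment[OF _ assms(6-10) bound])
      fix \<phi> \<psi> h A B
      assume 1: "\<And>x y. (\<And>i. x $ i \<in> A i) \<Longrightarrow> (\<And>i. y $ i \<in> B i) \<Longrightarrow> dual_sum \<phi> \<psi> h (x, y) \<le> c (x, y)"
        and 2: "\<And>\<pi>. VMT_minimizer \<mu> \<nu> c \<pi> \<Longrightarrow>
          AE z in \<pi>. (\<forall>i. fst z $ i \<in> A i) \<and> (\<forall>i. snd z $ i \<in> B i) \<and> dual_sum \<phi> \<psi> h z = c z"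
      show thesis by (rule that) (fact 1 2)+
    qed
  next
    case False
    then show thesis
      by (intro that[of "\<lambda>_. {}" "\<lambda>_. {}"]) auto
  qed
  define \<phi>' where "\<phi>' i t = (if t \<in> A i then ereal (\<phi> i t) else -\<infinity>)" for i t
  define \<psi>' where "\<psi>' i t = (if t \<in> B i then ereal (\<psi> i t) else -\<infinity>)" for i t
  define S where "S x y = (\<Sum>i\<in>UNIV. \<phi>' i (x $ i) + \<psi>' i (y $ i) + ereal (h i x * (y $ i - x $ i)))" for x y
  have S_eq: "S x y = ereal (dual_sum \<phi> \<psi> h (x, y))" if "\<forall>i. x $ i \<in> A i" "\<forall>i. y $ i \<in> B i" for x y
    using that by (simp add: S_def \<phi>'_def \<psi>'_def dual_sum_def)
  have S_inf: "S x y = -\<infinity>" if "x $ i \<notin> A i \<or> y $ i \<notin> B i" for x y i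
    unfolding S_def using that
    by (intro sum_ereal_eq_MInfty[where i = i]) (auto simp: \<phi>'_def \<psi>'_def)
  have S_le: "S x y \<le> ereal (c (x, y))" for x y
  proof (cases "(\<forall>i. x $ i \<in> A i) \<and> (\<forall>i. y $ i \<in> B i)")
    case True
    then show ?thesis using S_eq[of x y] le[of x y] by simp
  next
    case False
    then obtain i where "x $ i \<notin> A i \<or> y $ i \<notin> B i" by blast
    from S_inf[OF this] show ?thesis by simp
  qed
  have S_AE: "AE (x, y) in \<pi>. S x y = ereal (c (x, y))" if "VMT_minimizer \<mu> \<nu> c \<pi>" for \<pi>
    using eq[OF that] by eventually_elim (auto simp: S_eq)
  have "\<phi>' i t \<noteq> \<infinity>" "\<psi>' i t \<noteq> \<infinity>" for i t
    by (simp_all add: \<phi>'_def \<psi>'_def)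
  then show ?thesis
    using S_le S_AE unfolding S_def by (intro exI[of _ \<phi>'] exI[of _ \<psi>'] exI[of _ h]) blast
qed

end
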